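(* Let $G$ be a biconnected plane series-parallel 4-graph, let $T$ be an SPQ$^*$-tree of $G$ with respect to a reference edge $e$, and let $\nu$ be a non-root node of $T$. Let $H$ and $H'$ be two different orthogonal representations of $G$ with $e$ on the external face, and let $H_\nu$ and $H'_\nu$ be the restrictions of $H$ and $H'$ to $G_\nu$, respectively. If $\sigma(H_\nu)=\sigma(H'_\nu)$, then the embedded angle-labeled graph $H''$ defined by the substitution $\mathrm{Sub}(H_\nu,H'_\nu)$ is an orthogonal representation of $G$.
   Context: A 4-graph has maximum vertex degree at most $4$. An orthogonal representation of a plane 4-graph $G$ assigns to every angle between consecutive edges around a vertex a value in $\{90^\circ,180^\circ,270^\circ,360^\circ\}$ ($360^\circ$ only at degree-1 vertices) and to every edge a finite ordered sequence of bends, each bend forming $90^\circ$ in one incident face and $270^\circ$ in the other, so that (1) angles at each vertex sum to $360^\circ$; (2) for each face $f$, $N_{90}(f)-N_{270}(f)-2N_{360}(f)$ is $4$ if $f$ is internal and $-4$ if $f$ is external, $N_a(f)$ being the number of $a^\circ$ angles (at vertices and bends) in $f$. Series-parallel graphs (with source and sink) are built from single edges by series compositions (identify the sink of each graph with the source of the next) and parallel compositions (identify all sources and all sinks). $e=(s,t)$ is an edge on the external face. The SPQ$^*$-tree $T$ with respect to $e$ is the rooted decomposition tree whose leaves are Q$^*$-nodes (each representing a path of $\ell\ge1$ edges), whose S-nodes (P-nodes) represent series (parallel) compositions of the graphs of their children, and whose root is a P-node with two children, one being the Q$^*$-node of $e$; no non-root P-node has a P-node child and no S-node has an S-node child. $G_\nu$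 is the subgraph formed by the edges in the Q$^*$-nodes of the subtree at $\nu$; its poles $u,v$ are its source and sink. For a pole $w$, $\mathrm{indeg}_\nu(w)$ and $\mathrm{outdeg}_\nu(w)$ are the degrees of $w$ inside and outside $G_\nu$. Spirality. Let $H$ be an orthogonal representation of $G$ and $H_\nu$ its restriction to $G_\nu$. Alias vertices of a pole $w$: if $\mathrm{indeg}_\nu(w)=1$, the only alias is $w$ itself; if $\mathrm{indeg}_\nu(w)=\mathrm{outdeg}_\nu(w)=2$, there are two aliases $w',w''$, dummy vertices each splitting one of the two edge segments incident to $w$ outside $H_\nu$; if $\mathrm{indeg}_\nu(w)>1$ and $\mathrm{outdeg}_\nu(w)=1$, there is one alias, a dummy vertex splitting the edge segment incident to $w$ outside $H_\nu$. For aliases $u'$ of $u$ and $v'$ of $v$ and any simple path $P$ from $u$ to $v$ in $H_\nu$, let $n(S^{u'v'})$ be the number of right turns minus left turns along the concatenation of $(u',u)$, $P$, $(v,v')$ from $u'$ to $v'$. The spirality $\sigma(H_\nu)$, which does not depend on $P$, is: $n(S^{u'v'})$ if each pole has one alias; $\frac12(n(S^{u'v'})+n(S^{u'v''}))$ if only $v$ has two aliases; $\frac12(n(S^{u'v'})+n(S^{u''v'}))$ if only $u$ has two; and $\frac12(n(S^{u'v'})+n(S^{u''v''}))$ if both have two, where $(u,u')$ precedes $(u,u'')$ counterclockwise around $u$ and $(v,v')$ precedes $(v,v'')$ clockwise around $v$. Substitution. The external boundary of $H_\nu$ consists of a left path $p_l$ (from $u$ to $v$ clockwise along the boundary) and a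 right path $p_r$ (from $u$ to $v$ counterclockwise). Let $f_l$, $f_r$ be the faces of $H$ outside $H_\nu$ incident to $p_l$, $p_r$. For a pole $w$, $a_{w,l}$, $a_{w,r}$ are the angles at $w$ in $f_l$, $f_r$ in $H$. Define $p'_l,p'_r,f'_l,f'_r,a'_{w,l},a'_{w,r}$ analogously for $H'_\nu$ and $H'$. $\mathrm{Sub}(H_\nu,H'_\nu)$ defines $H''$ as follows. Vertices and edges are those of $G$. Faces: all faces of $H$ outside $H_\nu$ other than $f_l,f_r$, all (internal) faces of $H'_\nu$, and two faces $f''_l,f''_r$ obtained from $f_l,f_r$ by replacing $p_l$ with $p'_l$ and $p_r$ with $p'_r$. Angles: (i) all angles at vertices and along edges of $G$ not belonging to $G_\nu$ are as in $H$; (ii) angles at vertices of $G_\nu$ other than $u,v$ are as in $H'_\nu$; (iii) angles along edges of $G_\nu$ are as in $H'_\nu$; (iv) for each pole $w\in\{u,v\}$, angles at $w$ outside $G_\nu$ that are in neither $f''_l$ nor $f''_r$ are as in $H$, angles at $w$ inside $G_\nu$ are as in $H'_\nu$, and the angles at $w$ in $f''_l$ and $f''_r$ are $a_{w,l}$ and $a_{w,r}$ if $\mathrm{indeg}_\nu(w)=1$, and $a'_{w,l}$ and $a'_{w,r}$ if $\mathrm{indeg}_\nu(w)>1$. *)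

theory Defs
  imports "Graph_Theory.Graph_Theory" "HOL-Combinatorics.Orbits"
begin

section \<open>Plane graphs\<close>

text \<open>An undirected (multi)graph is a bidirected digraph: every edge is a pair of opposite darts
  \<open>d\<close>, \<open>opp M d\<close>. A plane embedding is a rotation system of genus 0 with a chosen external face:
  \<open>ccw M d\<close> is the dart following \<open>d\<close> counterclockwise around the tail of \<open>d\<close>.\<close>

record ('v, 'd) plane_map =
  skel :: "('v, 'd) pre_digraph"
  opp :: "'d \<Rightarrow> 'd"
  ccw :: "'d \<Rightarrow> 'd"
  ext_face :: "'d set"

text \<open>\<open>face_next M d\<close> is the next dart on the boundary of the face to the \<^emph>\<open>left\<close> of \<open>d\<close>. A face is
  represented by the set of darts having it on their left; so internal faces are traversed
  counterclockwise. The corner between \<open>d\<close> and \<open>ccw M d\<close> belongs to the face of \<open>d\<close>.\<close>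

definition face_next :: "('v, 'd) plane_map \<Rightarrow> 'd \<Rightarrow> 'd" where
  "face_next M d = inv (ccw M) (opp M d)"

definition map_faces :: "('v, 'd) plane_map \<Rightarrow> 'd set set" where
  "map_faces M = orbit (face_next M) ` arcs (skel M)"

text \<open>The last-but-one conjunct is Euler's formula \<open>V - E + F = 2\<close>, with \<open>E = card (arcs (skel M)) / 2\<close>;
  as usual it characterises planarity of a connected rotation system.\<close>

definition plane_graph :: "('v, 'd) plane_map \<Rightarrow> bool" where
  "plane_graph M \<longleftrightarrow>
     fin_digraph (skel M) \<and> bidirected_digraph (skel M) (opp M) \<and> connected (skel M) \<and>
     ccw M permutes arcs (skel M) \<and>
     (\<forall>v\<in>verts (skel M). out_arcs (skel M) v \<noteq> {} \<longrightarrow> cyclic_on (ccw M) (out_arcs (skel M) v)) \<and>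
     2 * card (verts (skel M)) + 2 * card (map_faces M) = card (arcs (skel M)) + 4 \<and>
     ext_face M \<in> map_faces M"

definition four_graph :: "('v, 'd) plane_map \<Rightarrow> bool" where
  "four_graph M \<longleftrightarrow> (\<forall>v\<in>verts (skel M). out_degree (skel M) v \<le> 4)"

definition biconnected :: "('v, 'd) plane_map \<Rightarrow> bool" where
  "biconnected M \<longleftrightarrow> connected (skel M) \<and>
     (\<forall>v\<in>verts (skel M). connected (pre_digraph.del_vert (skel M) v))"


section \<open>Series-parallel graphs and SPQ*-trees\<close>

text \<open>Subgraphs are given by sets of darts; the following are their vertices and their edges
  (both orientations).\<close>

definition dart_verts :: "('v, 'd) plane_map \<Rightarrow> 'd set \<Rightarrow> 'v set" where
  "dart_verts M A = tail (skel M) ` A \<union> head (skel M) ` A"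

definition sym_darts :: "('v, 'd) plane_map \<Rightarrow> 'd set \<Rightarrow> 'd set" where
  "sym_darts M A = A \<union> opp M ` A"

text \<open>\<open>sp M A s t\<close>: the subgraph with edges \<open>A\<close>, each oriented from source to sink, is
  series-parallel with source \<open>s\<close> and sink \<open>t\<close>.\<close>

inductive sp :: "('v, 'd) plane_map \<Rightarrow> 'd set \<Rightarrow> 'v \<Rightarrow> 'v \<Rightarrow> bool" for M where
  single: "a \<in> arcs (skel M) \<Longrightarrow> tail (skel M) a \<noteq> head (skel M) a \<Longrightarrow>
    sp M {a} (tail (skel M) a) (head (skel M) a)"
| series: "sp M A s w \<Longrightarrow> sp M B w t \<Longrightarrow> dart_verts M A \<inter> dart_verts M B = {w} \<Longrightarrow>
    sp M (A \<union> B) s t"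
| parallel: "sp M A s t \<Longrightarrow> sp M B s t \<Longrightarrow> dart_verts M A \<inter> dart_verts M B = {s, t} \<Longrightarrow>
    sym_darts M A \<inter> sym_darts M B = {} \<Longrightarrow> sp M (A \<union> B) s t"

definition series_parallel :: "('v, 'd) plane_map \<Rightarrow> bool" where
  "series_parallel M \<longleftrightarrow> (\<exists>A s t. sp M A s t \<and>
     arcs (skel M) = sym_darts M A \<and> verts (skel M) = dart_verts M A)"

text \<open>A Q*-node carries its path as a list of darts directed from source to sink.\<close>

datatype 'd spq = is_Q: QStar "'d list" | is_S: SNode "'d spq list" | is_P: PNode "'d spq list"

fun node_darts :: "'d spq \<Rightarrow> 'd set" where
  "node_darts (QStar p) = set p"
| "node_darts (SNode ts) = (\<Union>t\<in>set ts. node_darts t)"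
| "node_darts (PNode ts) = (\<Union>t\<in>set ts. node_darts t)"

fun nodes :: "'d spq \<Rightarrow> 'd spq set" where
  "nodes (QStar p) = {QStar p}"
| "nodes (SNode ts) = insert (SNode ts) (\<Union>t\<in>set ts. nodes t)"
| "nodes (PNode ts) = insert (PNode ts) (\<Union>t\<in>set ts. nodes t)"

fun source :: "('v, 'd) plane_map \<Rightarrow> 'd spq \<Rightarrow> 'v" where
  "source M (QStar p) = tail (skel M) (hd p)"
| "source M (SNode ts) = hd (map (source M) ts)"
| "source M (PNode ts) = hd (map (source M) ts)"

fun sink :: "('v, 'd) plane_map \<Rightarrow> 'd spq \<Rightarrow> 'v" where
  "sink M (QStar p) = head (skel M) (last p)"
| "sink M (SNode ts) = last (map (sink M) ts)"
| "sink M (PNode ts) = last (map (sink M) ts)"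

definition node_edges :: "('v, 'd) plane_map \<Rightarrow> 'd spq \<Rightarrow> 'd set" where
  "node_edges M t = sym_darts M (node_darts t)"

definition node_verts :: "('v, 'd) plane_map \<Rightarrow> 'd spq \<Rightarrow> 'v set" where
  "node_verts M t = dart_verts M (node_darts t)"

text \<open>Every node represents the series or parallel composition of the graphs of its children:
  these meet exactly in the vertices that the composition identifies.\<close>

fun represents :: "('v, 'd) plane_map \<Rightarrow> 'd spq \<Rightarrow> bool" where
  "represents M (QStar p) \<longleftrightarrow>
     p \<noteq> [] \<and> pre_digraph.apath (skel M) (tail (skel M) (hd p)) p (head (skel M) (last p))"
| "represents M (SNode ts) \<longleftrightarrow> 2 \<le> length ts \<and> (\<forall>t\<in>set ts. represents M t) \<and>
     (\<forall>i. Suc i < length ts \<longrightarrow> sink M (ts ! i) = source M (ts ! Suc i)) \<and>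
     (\<forall>i j. i < j \<and> j < length ts \<longrightarrow>
        node_verts M (ts ! i) \<inter> node_verts M (ts ! j) =
          (if j = Suc i then {sink M (ts ! i)} else {}))"
| "represents M (PNode ts) \<longleftrightarrow> 2 \<le> length ts \<and> (\<forall>t\<in>set ts. represents M t) \<and>
     (\<forall>i j. i < j \<and> j < length ts \<longrightarrow>
        source M (ts ! i) = source M (ts ! j) \<and> sink M (ts ! i) = sink M (ts ! j) \<and>
        node_verts M (ts ! i) \<inter> node_verts M (ts ! j) = {source M (ts ! i), sink M (ts ! i)} \<and>
        node_edges M (ts ! i) \<inter> node_edges M (ts ! j) = {})"

fun canonical :: "'d spq \<Rightarrow> bool" where
  "canonical (QStar p) \<longleftrightarrow> True"
| "canonical (SNode ts) \<longleftrightarrow> (\<forall>t\<in>set ts. canonical t \<and> \<not> is_S t)"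
| "canonical (PNode ts) \<longleftrightarrow> (\<forall>t\<in>set ts. canonical t \<and> \<not> is_P t)"

text \<open>The reference edge \<open>e\<close> is a dart directed from the source of the graph to its sink. The root
  is exempt from the condition on P-children.\<close>

definition spq_tree :: "('v, 'd) plane_map \<Rightarrow> 'd \<Rightarrow> 'd spq \<Rightarrow> bool" where
  "spq_tree M e T \<longleftrightarrow> represents M T \<and>
     arcs (skel M) = node_edges M T \<and> verts (skel M) = node_verts M T \<and>
     (\<exists>t. canonical t \<and> (T = PNode [QStar [e], t] \<or> T = PNode [t, QStar [e]]))"


section \<open>Orthogonal representations\<close>

text \<open>An embedded angle-labeled graph on the vertices and edges of a plane graph. \<open>angle H d\<close> is the
  angle, in degrees, at the corner between \<open>d\<close> and \<open>ccw M d\<close>. \<open>bends H d\<close> lists the bends met when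
  traversing \<open>d\<close>, each given by its angle on the left of \<open>d\<close>.\<close>

record 'd angled =
  faces :: "'d set set"
  outer :: "'d set"
  angle :: "'d \<Rightarrow> nat"
  bends :: "'d \<Rightarrow> nat list"

definition num_angles :: "'d angled \<Rightarrow> nat \<Rightarrow> 'd set \<Rightarrow> int" where
  "num_angles H a f = int (card {d \<in> f. angle H d = a}) + (\<Sum>d\<in>f. int (count_list (bends H d) a))"

definition orthogonal_rep :: "('v, 'd) plane_map \<Rightarrow> 'd angled \<Rightarrow> bool" where
  "orthogonal_rep M H \<longleftrightarrow>
     faces H = map_faces M \<and> outer H = ext_face M \<and>
     (\<forall>d\<in>arcs (skel M). angle H d \<in> {90, 180, 270, 360} \<and>
        (angle H d = 360 \<longrightarrow> out_degree (skel M) (tail (skel M) d) = 1)) \<and>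
     (\<forall>d\<in>arcs (skel M). set (bends H d) \<subseteq> {90, 270} \<and>
        bends H (opp M d) = map (\<lambda>a. 360 - a) (rev (bends H d))) \<and>
     (\<forall>v\<in>verts (skel M). (\<Sum>d\<in>out_arcs (skel M) v. angle H d) = 360) \<and>
     (\<forall>f\<in>faces H. num_angles H 90 f - num_angles H 270 f - 2 * num_angles H 360 f =
        (if f = outer H then - 4 else 4))"


section \<open>Spirality\<close>

definition indeg :: "('v, 'd) plane_map \<Rightarrow> 'd spq \<Rightarrow> 'v \<Rightarrow> nat" where
  "indeg M \<nu> w = card (out_arcs (skel M) w \<inter> node_edges M \<nu>)"

definition outdeg :: "('v, 'd) plane_map \<Rightarrow> 'd spq \<Rightarrow> 'v \<Rightarrow> nat" where
  "outdeg M \<nu> w = card (out_arcs (skel M) w - node_edges M \<nu>)"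

text \<open>The angle to the left of a route that enters a vertex along \<open>d\<close> and leaves it along \<open>d'\<close>: the
  sum of the corners met when rotating counterclockwise from \<open>d'\<close> to \<open>opp M d\<close>.\<close>

definition left_angle :: "('v, 'd) plane_map \<Rightarrow> 'd angled \<Rightarrow> 'd \<Rightarrow> 'd \<Rightarrow> nat" where
  "left_angle M H d d' =
     (\<Sum>i < (LEAST k. 0 < k \<and> (ccw M ^^ k) d' = opp M d). angle H ((ccw M ^^ i) d'))"

fun path_angles :: "('v, 'd) plane_map \<Rightarrow> 'd angled \<Rightarrow> 'd list \<Rightarrow> nat list" where
  "path_angles M H [] = []"
| "path_angles M H [d] = bends H d"
| "path_angles M H (d # d' # p) = bends H d @ [left_angle M H d d'] @ path_angles M H (d' # p)"

text \<open>A right turn has angle 270 on its left, a left turn has 90.\<close>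

definition turns :: "nat list \<Rightarrow> int" where
  "turns as = int (count_list as 270) - int (count_list as 90)"

text \<open>An alias of a pole \<open>w\<close> is either \<open>None\<close> (\<open>w\<close> itself) or \<open>Some d\<close> (a dummy vertex splitting the
  first segment of the dart \<open>d\<close> that leaves \<open>w\<close> outside the subgraph). In the latter case the segment
  between alias and pole contains no bend, hence contributes just the turn at the pole.\<close>

definition n_turns ::
  "('v, 'd) plane_map \<Rightarrow> 'd angled \<Rightarrow> 'd option \<Rightarrow> 'd list \<Rightarrow> 'd option \<Rightarrow> int" where
  "n_turns M H a p b = turns (
     (case a of None \<Rightarrow> [] | Some x \<Rightarrow> [left_angle M H (opp M x) (hd p)]) @
     path_angles M H p @
     (case b of None \<Rightarrow> [] | Some y \<Rightarrow> [left_angle M H (last p) y]))"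

definition two_aliases :: "('v, 'd) plane_map \<Rightarrow> 'd spq \<Rightarrow> 'v \<Rightarrow> bool" where
  "two_aliases M \<nu> w \<longleftrightarrow> indeg M \<nu> w = 2 \<and> outdeg M \<nu> w = 2"

definition sole_alias :: "('v, 'd) plane_map \<Rightarrow> 'd spq \<Rightarrow> 'v \<Rightarrow> 'd option" where
  "sole_alias M \<nu> w =
     (if indeg M \<nu> w = 1 then None else Some (THE d. d \<in> out_arcs (skel M) w - node_edges M \<nu>))"

text \<open>For a pole with two aliases: the outside dart whose counterclockwise successor is the other
  outside dart, and that successor.\<close>

definition ccw_first_alias :: "('v, 'd) plane_map \<Rightarrow> 'd spq \<Rightarrow> 'v \<Rightarrow> 'd" where
  "ccw_first_alias M \<nu> w =
     (THE d. d \<in> out_arcs (skel M) w - node_edges M \<nu> \<and> ccw M d \<notin> node_edges M \<nu>)"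

definition ccw_second_alias :: "('v, 'd) plane_map \<Rightarrow> 'd spq \<Rightarrow> 'v \<Rightarrow> 'd" where
  "ccw_second_alias M \<nu> w = ccw M (ccw_first_alias M \<nu> w)"

text \<open>The value does not depend on the simple path \<open>p\<close>. The aliases \<open>u'\<close>, \<open>u''\<close> are in counterclockwise
  order around the source, \<open>v'\<close>, \<open>v''\<close> in clockwise order around the sink.\<close>

definition spirality :: "('v, 'd) plane_map \<Rightarrow> 'd angled \<Rightarrow> 'd spq \<Rightarrow> rat" where
  "spirality M H \<nu> =
     (let u = source M \<nu>; v = sink M \<nu>;
          p = (SOME p. pre_digraph.apath (skel M) u p v \<and> set p \<subseteq> node_edges M \<nu>);
          n = (\<lambda>a b. of_int (n_turns M H a p b));
          u0 = sole_alias M \<nu> u; v0 = sole_alias M \<nu> v;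
          u' = Some (ccw_first_alias M \<nu> u); u'' = Some (ccw_second_alias M \<nu> u);
          v' = Some (ccw_second_alias M \<nu> v); v'' = Some (ccw_first_alias M \<nu> v)
      in if two_aliases M \<nu> u then
           (if two_aliases M \<nu> v then (n u' v' + n u'' v'') / 2 else (n u' v0 + n u'' v0) / 2)
         else
           (if two_aliases M \<nu> v then (n u0 v' + n u0 v'') / 2 else n u0 v0))"


section \<open>Substitution\<close>

text \<open>Walking clockwise from \<open>u\<close> to \<open>v\<close> along the external boundary of the subgraph keeps the outside
  on the left and starts at the counterclockwise last dart of the subgraph at \<open>u\<close>; the right path,
  walked from \<open>v\<close> to \<open>u\<close>, is obtained likewise by starting at \<open>v\<close>. Hence \<open>side_face M H \<nu> w\<close> is \<open>f\<^sub>l\<close> for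
  \<open>w = u\<close> and \<open>f\<^sub>r\<close> for \<open>w = v\<close>, and the darts of the subgraph on its boundary form \<open>p\<^sub>l\<close> and
  the reversal of \<open>p\<^sub>r\<close>, respectively.\<close>

definition side_face :: "('v, 'd) plane_map \<Rightarrow> 'd angled \<Rightarrow> 'd spq \<Rightarrow> 'v \<Rightarrow> 'd set" where
  "side_face M H \<nu> w =
     (THE f. f \<in> faces H \<and>
        (\<exists>d\<in>f. tail (skel M) d = w \<and> d \<in> node_edges M \<nu> \<and> ccw M d \<notin> node_edges M \<nu>))"

definition side_path :: "('v, 'd) plane_map \<Rightarrow> 'd angled \<Rightarrow> 'd spq \<Rightarrow> 'v \<Rightarrow> 'd set" where
  "side_path M H \<nu> w = side_face M H \<nu> w \<inter> node_edges M \<nu>"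

definition new_side_face ::
  "('v, 'd) plane_map \<Rightarrow> 'd spq \<Rightarrow> 'd angled \<Rightarrow> 'd angled \<Rightarrow> 'v \<Rightarrow> 'd set" where
  "new_side_face M \<nu> H H' w = (side_face M H \<nu> w - side_path M H \<nu> w) \<union> side_path M H' \<nu> w"

text \<open>The faces of \<open>H\<close> inside the subgraph are those with all boundary darts in it. A corner at a pole
  belongs to the left or right face iff its dart does; a pole corner whose dart belongs to neither
  lies inside the subgraph iff this dart belongs to the subgraph.\<close>

definition substitution ::
  "('v, 'd) plane_map \<Rightarrow> 'd spq \<Rightarrow> 'd angled \<Rightarrow> 'd angled \<Rightarrow> 'd angled" where
  "substitution M \<nu> H H' =
     (let u = source M \<nu>; v = sink M \<nu>; D = node_edges M \<nu>;
          fl = side_face M H \<nu> u; fr = side_face M H \<nu> v;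
          fl'' = new_side_face M \<nu> H H' u; fr'' = new_side_face M \<nu> H H' v
      in \<lparr> faces = {f \<in> faces H. \<not> f \<subseteq> D \<and> f \<noteq> fl \<and> f \<noteq> fr} \<union> {f \<in> faces H'. f \<subseteq> D} \<union> {fl'', fr''},
           outer = (if outer H = fl then fl'' else if outer H = fr then fr'' else outer H),
           angle = (\<lambda>d. let w = tail (skel M) d in
             if w \<in> {u, v} then
               (if d \<in> fl'' \<union> fr'' then (if indeg M \<nu> w = 1 then angle H d else angle H' d)
                else if d \<in> D then angle H' d else angle H d)
             else if w \<in> node_verts M \<nu> then angle H' d else angle H d),
           bends = (\<lambda>d. if d \<in> D then bends H' d else bends H d) \<rparr>)"

end

theory Submission
  imports Defs
begin

text \<open>Every condition of the definition except the one on the two faces on either side of the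
  subgraph is inherited from \<open>H\<close> or \<open>H'\<close>. For these two faces, compare \<open>H\<close> with \<open>H'\<close>: the differences of
  angles and bends form a 1-form on the darts which is closed at vertices, edges and faces, and
  planarity makes it exact. Its primitive \<open>\<Theta>\<close> says by how much each dart is rotated from \<open>H\<close> to \<open>H'\<close>, so
  the turning number of any route changes by a difference of two values of \<open>\<Theta>\<close>, independently of the
  route; this applies to the path that defines the spirality as well as to the left and the right
  path. Equal spiralities thus make the changes along the two side faces vanish.

  Exactness on plane maps also replaces the Jordan curve theorem. A closed curve through vertices and
  faces has a closed intersection form, and a primitive of it contradicts connectivity. In this way
  one sees that faces of a biconnected plane graph are simple, and that the darts of a node of the tree
  are consecutive around both poles.\<close>

section \<open>Connected components and cycles of permutations\<close>

text \<open>\<open>H\<close> and \<open>H'\<close> share the embedding, so the substitution leaves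
  the faces as they are and only mixes angle and bend values. At a pole with two darts on either
  side all four angles are right angles in both representations, so \<Theta> is constant around that
  pole; this is why the two aliases give the same information. At any other pole one side consists
  of a single dart, and then the rule for pole angles copies all of them from one representation.
  That the darts of a node are consecutive fails in general for a union of some children of a
  P-node, whose order around the poles is arbitrary. It holds if the darts at one pole, either those
  inside or those outside, can be joined without rotating around the poles. Q*-nodes and S-nodes are
  joined inside. A P-node is joined outside, through a sibling in its series parent or through
  \<open>e\<close>; canonicity guarantees one of these. Exactness is proved together with Euler's
  inequality because its induction has to know which reductions a map of genus 0 permits.\<close>

definition conn :: "'a rel \<Rightarrow> 'a rel" where
  "conn R = (R \<union> R\<inverse>)\<^sup>*"

definition num_classes :: "'a set \<Rightarrow> 'a rel \<Rightarrow> nat" where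
  "num_classes S R = card (S // conn R)"

text \<open>Cycles of a permutation become connected components of its graph. In this way the
  vertices, edges, faces and components of a map are all counted by
  \<open>num_classes\<close>.\<close>

definition graph_on :: "'a set \<Rightarrow> ('a \<Rightarrow> 'a) \<Rightarrow> 'a rel" where
  "graph_on S f = {(d, f d) |d. d \<in> S}"

lemma conn_refl [simp]: "(x, x) \<in> conn R"
  by (simp add: conn_def)

lemma conn_sym: "(x, y) \<in> conn R \<Longrightarrow> (y, x) \<in> conn R"
  unfolding conn_def by (metis converse_Un converse_converse rtrancl_converseD sup_commute)

lemma conn_trans: "(x, y) \<in> conn R \<Longrightarrow> (y, z) \<in> conn R \<Longrightarrow> (x, z) \<in> conn R"
  unfolding conn_def by (rule rtrancl_trans)

lemma conn_base: "(x, y) \<in> R \<Longrightarrow> (x, y) \<in> conn R"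
  unfolding conn_def by blast

text \<open>Stands in for rule induction: an invariant of a class is given as an equivalence
  relation, for instance "both or neither equal x".\<close>

lemma conn_least:
  assumes "R \<subseteq> Q" "\<And>x. (x, x) \<in> Q" "sym Q" "trans Q"
  shows "conn R \<subseteq> Q"
proof -
  have "R \<union> R\<inverse> \<subseteq> Q" using assms(1,3) by (auto dest: symD)
  moreover have "(x, y) \<in> (R \<union> R\<inverse>)\<^sup>* \<Longrightarrow> R \<union> R\<inverse> \<subseteq> Q \<Longrightarrow> (x, y) \<in> Q" for x y
    by (induction rule: rtrancl_induct) (use assms(2,4) in \<open>auto dest: transD\<close>)
  ultimately show ?thesis unfolding conn_def by auto
qed

lemma sym_conn: "sym (conn R)" by (auto intro: symI conn_sym)
lemma trans_conn: "trans (conn R)" by (auto intro: transI conn_trans)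

lemma equiv_conn: "equiv UNIV (conn R)"
  by (intro equivI) (auto intro: refl_onI sym_conn trans_conn)

lemma conn_subset_conn: "R \<subseteq> conn Q \<Longrightarrow> conn R \<subseteq> conn Q"
  by (rule conn_least) (auto simp: sym_conn trans_conn)

lemma conn_mono: "R \<subseteq> Q \<Longrightarrow> conn R \<subseteq> conn Q"
  by (rule conn_subset_conn) (auto intro: conn_base)

lemma class_eq_iff: "conn R `` {x} = conn R `` {y} \<longleftrightarrow> (x, y) \<in> conn R"
  using equiv_conn eq_equiv_class_iff[of UNIV "conn R" x y] by auto

lemma class_subset:
  assumes "R \<subseteq> S \<times> S" "x \<in> S" shows "conn R `` {x} \<subseteq> S"
proof -
  have "conn R \<subseteq> S \<times> S \<union> Id"
    by (rule conn_least) (use assms in \<open>auto intro!: symI transI\<close>)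
  then show ?thesis using assms by auto
qed

lemma conn_insert_redundant:
  assumes "(p, x) \<in> conn R" shows "conn (insert (p, x) R) = conn R"
  by (intro equalityI conn_subset_conn conn_mono) (use assms in \<open>auto intro: conn_base\<close>)

text \<open>Joining two classes only adds the square of their union to the equivalence; the union is
  saturated, so nothing else becomes related.\<close>

lemma class_insert:
  "conn (insert (p, x) R) `` {z} =
    (if z \<in> conn R `` {p, x} then conn R `` {p, x} else conn R `` {z})"
proof -
  let ?C = "conn R `` {p, x}"
  have C: "z \<in> ?C \<Longrightarrow> (z, w) \<in> conn R \<Longrightarrow> w \<in> ?C" for z w by (meson ImageE ImageI conn_trans)
  have C': "w \<in> ?C \<Longrightarrow> (z, w) \<in> conn R \<Longrightarrow> z \<in> ?C" for z w by (meson C conn_sym)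
  have "conn (insert (p, x) R) = conn R \<union> ?C \<times> ?C"
  proof
    show "conn (insert (p, x) R) \<subseteq> conn R \<union> ?C \<times> ?C"
    proof (rule conn_least)
      have "p \<in> ?C" "x \<in> ?C" by (auto simp: Image_iff)
      then show "insert (p, x) R \<subseteq> conn R \<union> ?C \<times> ?C" by (auto intro: conn_base)
      show "sym (conn R \<union> ?C \<times> ?C)" by (rule symI) (auto intro: conn_sym)
      show "trans (conn R \<union> ?C \<times> ?C)"
        by (rule transI) (metis C C' UnCI UnE conn_trans mem_Sigma_iff)
    qed auto
    have px: "(p, x) \<in> conn (insert (p, x) R)" by (auto intro: conn_base)
    have "conn R \<subseteq> conn (insert (p, x) R)" by (rule conn_mono) auto
    have pC: "(p, w) \<in> conn (insert (p, x) R)" if "w \<in> ?C" for w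
    proof -
      have "(p, w) \<in> conn R \<or> (x, w) \<in> conn R" using that by auto
      then show ?thesis using \<open>conn R \<subseteq> _\<close> px conn_trans[OF px, of w] by blast
    qed
    have "?C \<times> ?C \<subseteq> conn (insert (p, x) R)"
    proof (rule subrelI, elim SigmaE2)
      fix v w assume "v \<in> ?C" "w \<in> ?C"
      then show "(v, w) \<in> conn (insert (p, x) R)"
        using conn_trans[OF conn_sym[OF pC] pC] by blast
    qed
    then show "conn R \<union> ?C \<times> ?C \<subseteq> conn (insert (p, x) R)"
      using \<open>conn R \<subseteq> _\<close> by blast
  qed
  moreover have "conn R `` {z} \<subseteq> ?C" if "z \<in> ?C" using C[OF that] by blast
  moreover have "(?C \<times> ?C) `` {z} = (if z \<in> ?C then ?C else {})" by auto
  ultimately show ?thesis by (auto simp only: Un_Image split: if_splits)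
qed

text \<open>Two blocks of the quotient are replaced by their union, which was not a block
  before.\<close>

lemma num_classes_insert:
  assumes "finite S" "R \<subseteq> S \<times> S" "p \<in> S" "x \<in> S" "(p, x) \<notin> conn R"
  shows "num_classes S R = num_classes S (insert (p, x) R) + 1"
proof -
  let ?P = "conn R `` {p}" and ?X = "conn R `` {x}"
  have ne: "?P \<noteq> ?X" using assms(5) by (simp add: class_eq_iff)
  have PX: "conn R `` {p, x} = ?P \<union> ?X" by auto
  have rest: "conn R `` {z} = ?P \<or> conn R `` {z} = ?X" if "z \<in> ?P \<union> ?X" for z
    using that by (metis Image_singleton_iff UnE class_eq_iff conn_sym)
  have rest': "conn R `` {z} \<noteq> ?P" "conn R `` {z} \<noteq> ?X" if "z \<notin> ?P \<union> ?X" for z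
    using that by (auto simp: class_eq_iff intro: conn_sym)
  have notin: "?P \<union> ?X \<notin> (S // conn R) - {?P, ?X}"
  proof
    assume "?P \<union> ?X \<in> (S // conn R) - {?P, ?X}"
    then obtain z where "?P \<union> ?X = conn R `` {z}" by (auto simp: quotient_def)
    then have "z \<in> ?P \<union> ?X" by simp
    with rest \<open>?P \<union> ?X \<in> _\<close> \<open>?P \<union> ?X = conn R `` {z}\<close> show False by auto
  qed
  have "S // conn (insert (p, x) R) = insert (?P \<union> ?X) ((S // conn R) - {?P, ?X})" (is "?L = ?R")
  proof
    show "?L \<subseteq> ?R"
    proof
      fix C assume "C \<in> ?L"
      then obtain z where z: "z \<in> S" "C = conn (insert (p, x) R) `` {z}" by (auto simp: quotient_def)
      show "C \<in> ?R"
      proof (cases "z \<in> ?P \<union> ?X")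
        case True
        then show ?thesis using z unfolding class_insert PX by simp
      next
        case False
        then have "C = conn R `` {z}" using z unfolding class_insert PX by simp
        moreover have "conn R `` {z} \<in> S // conn R" using z(1) by (rule quotientI)
        ultimately show ?thesis using rest'[OF False] by simp
      qed
    qed
    show "?R \<subseteq> ?L"
    proof
      fix C assume C: "C \<in> ?R"
      show "C \<in> ?L"
      proof (cases "C = ?P \<union> ?X")
        case True
        then have "C = conn (insert (p, x) R) `` {p}" by (simp add: class_insert PX)
        then show ?thesis using assms(3) by (auto simp: quotient_def)
      next
        case False
        then obtain z where z: "z \<in> S" "C = conn R `` {z}" "C \<noteq> ?P" "C \<noteq> ?X"
          using C by (auto simp: quotient_def)
        then have "z \<notin> ?P \<union> ?X" using rest by blast
        then have "C = conn (insert (p, x) R) `` {z}" using z by (simp add: class_insert PX)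
        then show ?thesis using z(1) by (auto simp: quotient_def)
      qed
    qed
  qed
  moreover have fin: "finite (S // conn R)"
    unfolding quotient_def using assms(1) by auto
  moreover have "{?P, ?X} \<subseteq> S // conn R" using assms by (auto simp: quotient_def)
  moreover have "card {?P, ?X} = 2" using ne by simp
  moreover have "card {?P, ?X} \<le> card (S // conn R)" using calculation by (intro card_mono) auto
  ultimately show ?thesis unfolding num_classes_def
    using notin by (simp add: card_Diff_subset)
qed

text \<open>A saturated set is the disjoint union of its classes. Applied to a component of a map,
  and to a component without one of its faces.\<close>

lemma sum_classes_zero:
  fixes g :: "'a \<Rightarrow> int"
  assumes "finite Z" and "\<And>z. z \<in> Z \<Longrightarrow> conn R `` {z} \<subseteq> Z"
    and "\<And>z. z \<in> Z \<Longrightarrow> sum g (conn R `` {z}) = 0"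
  shows "sum g Z = 0"
proof -
  have "z \<in> conn R `` {z}" for z by simp
  then have "\<Union> (Z // conn R) = Z" using assms(2) unfolding quotient_def by blast
  then have "sum g Z = sum g (\<Union> (Z // conn R))" by simp
  also have "\<dots> = sum (sum g) (Z // conn R)"
  proof (rule sum.Union_disjoint[unfolded comp_def])
    show "\<forall>A\<in>Z // conn R. finite A"
      using assms(1,2) by (auto simp: quotient_def intro: finite_subset)
    show "\<forall>A\<in>Z // conn R. \<forall>B\<in>Z // conn R. A \<noteq> B \<longrightarrow> A \<inter> B = {}"
    proof (intro ballI impI)
      fix A B assume "A \<in> Z // conn R" "B \<in> Z // conn R" "A \<noteq> B"
      moreover have "Z // conn R \<subseteq> UNIV // conn R" by (auto simp: quotient_def)
      ultimately show "A \<inter> B = {}" using quotient_disj[OF equiv_conn[of R]] by blast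
    qed
  qed
  also have "\<dots> = 0" by (rule sum.neutral) (use assms(3) in \<open>auto simp: quotient_def\<close>)
  finally show ?thesis .
qed

section \<open>Cycles of permutations on a finite set\<close>

lemma graph_on_subset: "f permutes S \<Longrightarrow> graph_on S f \<subseteq> S \<times> S"
  by (auto simp: graph_on_def permutes_in_image)

lemma class_permutes:
  assumes "f permutes S" "z \<in> S" "graph_on S f \<subseteq> conn R"
  shows "d \<in> conn R `` {z} \<Longrightarrow> d \<in> S \<Longrightarrow> f d \<in> conn R `` {z}"
proof -
  assume "d \<in> conn R `` {z}" "d \<in> S"
  moreover from this have "(d, f d) \<in> conn R" using assms(3) by (auto simp: graph_on_def)
  ultimately show "f d \<in> conn R `` {z}" by (metis Image_singleton_iff conn_trans)
qed

lemma sum_closed_permutes: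
  assumes "f permutes S" "finite Z" "Z \<subseteq> S" "\<And>d. d \<in> Z \<Longrightarrow> f d \<in> Z"
  shows "(\<Sum>d\<in>Z. g (f d)) = sum g Z"
proof -
  have inj: "inj_on f Z" using assms(1,3) by (meson inj_on_subset permutes_inj subset_UNIV)
  then have "f ` Z = Z" using assms(2,4) by (intro endo_inj_surj) auto
  then show ?thesis using inj by (metis (no_types, lifting) sum.reindex_cong)
qed

text \<open>On a finite cycle a backward step is a forward power.\<close>

lemma conn_graph_funpow:
  assumes "f permutes S" "finite S" "(x, y) \<in> conn (graph_on S f)"
  shows "\<exists>n. y = (f ^^ n) x"
proof -
  have perm: "permutation f" using assms(1,2) by (auto simp: permutation_permutes)
  have "conn (graph_on S f) \<subseteq> {(x, y). y \<in> orbit f x}"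
  proof (rule conn_least)
    show "graph_on S f \<subseteq> {(x, y). y \<in> orbit f x}" by (auto simp: graph_on_def orbit.base)
    show "sym {(x, y). y \<in> orbit f x}"
      by (rule symI) (auto intro: orbit_swap permutation_self_in_orbit[OF perm])
    show "trans {(x, y). y \<in> orbit f x}" by (rule transI) (auto intro: orbit_trans)
  qed (auto simp: permutation_self_in_orbit[OF perm])
  then show ?thesis using assms(3) by (auto simp: orbit_altdef)
qed

lemma conn_funpow: "f permutes S \<Longrightarrow> x \<in> S \<Longrightarrow> (x, (f ^^ n) x) \<in> conn (graph_on S f)"
proof (induction n)
  case (Suc n)
  then have "(f ^^ n) x \<in> S" by (meson permutes_in_funpow_image)
  then have "((f ^^ n) x, f ((f ^^ n) x)) \<in> conn (graph_on S f)"
    by (intro conn_base) (auto simp: graph_on_def)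
  with Suc show ?case by (metis conn_trans funpow.simps(2) comp_apply)
qed simp

text \<open>Both cycles of \<open>x\<close> agree up to the first return to \<open>{p, x}\<close>; if one returns to \<open>x\<close> then the
  other one returns to \<open>p\<close>.\<close>

lemma transpose_conn_iff:
  assumes "f permutes S" "finite S" "p \<in> S" "x \<in> S" "p \<noteq> x"
  shows "(x, p) \<in> conn (graph_on S (transpose p x \<circ> f)) \<longleftrightarrow> (x, p) \<notin> conn (graph_on S f)"
proof -
  let ?f = "transpose p x \<circ> f"
  have perm': "?f permutes S"
    using assms by (intro permutes_compose) (auto simp: permutes_swap_id)
  have perm: "permutation f" using assms(1,2) by (auto simp: permutation_permutes)
  define k where "k = (LEAST k. 0 < k \<and> (f ^^ k) x \<in> {p, x})"
  have "x \<in> orbit f x" using permutation_self_in_orbit[OF perm] .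
  then have "\<exists>k. 0 < k \<and> (f ^^ k) x \<in> {p, x}" by (auto simp: orbit_altdef)
  then have k: "0 < k" "(f ^^ k) x \<in> {p, x}"
    unfolding k_def by (metis (no_types, lifting) LeastI_ex)+
  have less: "(f ^^ i) x \<notin> {p, x}" if "0 < i" "i < k" for i
    using that not_less_Least[of i "\<lambda>k. 0 < k \<and> (f ^^ k) x \<in> {p, x}"] unfolding k_def by auto
  have eq: "(?f ^^ i) x = (f ^^ i) x" if "i < k" for i
    using that
  proof (induction i)
    case (Suc i)
    then show ?case using less[of "Suc i"] by (simp add: transpose_def)
  qed simp
  have step: "(?f ^^ k) x = transpose p x ((f ^^ k) x)"
    using k(1) eq[of "k - 1"] by (cases k) auto
  \<comment> \<open>A map that agrees with \<open>f\<close> before time \<open>k\<close> and returns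
    to \<open>x\<close> at time \<open>k\<close> has just these \<open>k\<close> points as its cycle
    through \<open>x\<close>, and \<open>p\<close> is not among them.\<close>
  have ret: "(g ^^ n) x \<noteq> p" if "(g ^^ k) x = x" "\<And>i. i < k \<Longrightarrow> (g ^^ i) x = (f ^^ i) x" for g n
  proof -
    have "(g ^^ n) x = (g ^^ (n mod k)) x" using that(1) by (simp add: funpow_mod_eq)
    also have "\<dots> = (f ^^ (n mod k)) x" using k(1) that(2) by simp
    finally show ?thesis using less[of "n mod k"] k(1) assms(5) by (cases "n mod k = 0") auto
  qed
  show ?thesis
  proof (cases "(f ^^ k) x = x")
    case True
    then have "(?f ^^ k) x = p" using step by simp
    then have "(x, p) \<in> conn (graph_on S ?f)" using conn_funpow[OF perm' assms(4), of k] by simp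
    moreover have "(x, p) \<notin> conn (graph_on S f)"
      using ret[OF True] conn_graph_funpow[OF assms(1,2)] by metis
    ultimately show ?thesis by simp
  next
    case False
    then have "(f ^^ k) x = p" using k by auto
    then have "(?f ^^ k) x = x" "(x, p) \<in> conn (graph_on S f)"
      using step conn_funpow[OF assms(1,4), of k] by auto
    moreover have "(x, p) \<notin> conn (graph_on S ?f)"
      using ret[OF calculation(1) eq] conn_graph_funpow[OF perm' assms(2)] by metis
    ultimately show ?thesis by simp
  qed
qed

text \<open>A transposition applied after \<open>f\<close> is invisible once \<open>p\<close> and
  \<open>x\<close> are identified.\<close>

lemma conn_insert_transpose:
  assumes "p \<in> S" "x \<in> S"
  shows "conn (insert (p, x) (graph_on S (transpose p x \<circ> f) \<union> Q)) =
    conn (insert (p, x) (graph_on S f \<union> Q))"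
proof -
  have sub: "conn (insert (p, x) (graph_on S g \<union> Q)) \<subseteq> conn (insert (p, x) (graph_on S h \<union> Q))"
    if gh: "\<And>d. g d = transpose p x (h d)" for g h :: "'a \<Rightarrow> 'a"
  proof (rule conn_subset_conn)
    let ?c = "conn (insert (p, x) (graph_on S h \<union> Q))"
    have "(p, x) \<in> ?c" by (auto intro: conn_base)
    then have t: "(y, transpose p x y) \<in> ?c" for y by (auto simp: transpose_def intro: conn_sym)
    have "(d, h d) \<in> ?c" if "d \<in> S" for d using that by (auto simp: graph_on_def intro: conn_base)
    then have "(d, g d) \<in> ?c" if "d \<in> S" for d using that t gh by (metis conn_trans)
    then show "insert (p, x) (graph_on S g \<union> Q) \<subseteq> ?c"
      by (auto simp: graph_on_def intro: conn_base)
  qed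
  show ?thesis by (rule equalityI; rule sub) (simp_all)
qed

text \<open>Closedness: one turn around any cycle of \<open>f\<close> accumulates nothing.\<close>

definition cycles_sum_zero :: "'a set \<Rightarrow> ('a \<Rightarrow> 'a) \<Rightarrow> ('a \<Rightarrow> int) \<Rightarrow> bool" where
  "cycles_sum_zero S f g \<longleftrightarrow> (\<forall>z\<in>S. sum g (conn (graph_on S f) `` {z}) = 0)"

text \<open>The cycle ..., p, x, f x, ... is shortened to ..., p, f x, ... and \<open>x\<close>
  becomes a fixed point. The step from \<open>p\<close> now skips \<open>x\<close> and therefore
  carries both weights, while a fixed point can only carry weight 0. This is the reduction step of
  both exactness proofs.\<close>

lemma fixed_point_peel:
  assumes "finite S" "f permutes S" "p \<in> S" "f p = x" "p \<noteq> x"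
  defines "f' \<equiv> f \<circ> transpose p x"
  shows "f' permutes S"
    and "f' p = f x" and "f' x = x" and "\<And>d. d \<noteq> p \<Longrightarrow> d \<noteq> x \<Longrightarrow> f' d = f d"
    and "card {d \<in> S. f' d \<noteq> d} < card {d \<in> S. f d \<noteq> d}"
    and "conn (insert (p, x) (graph_on S f' \<union> Q)) = conn (graph_on S f \<union> Q)"
    and "(p, x) \<notin> conn (graph_on S f')"
    and "cycles_sum_zero S f s \<Longrightarrow> cycles_sum_zero S f' (s(p := s p + s x, x := 0))"
proof -
  have x: "x \<in> S" using assms(2-4) by (auto simp: permutes_in_image)
  have inj: "f a = f b \<Longrightarrow> a = b" for a b using permutes_inj[OF assms(2)] by (auto dest: injD)
  show perm: "f' permutes S"
    unfolding f'_def using assms x by (intro permutes_compose) (auto simp: permutes_swap_id)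
  show p': "f' p = f x" and x': "f' x = x" and d': "\<And>d. d \<noteq> p \<Longrightarrow> d \<noteq> x \<Longrightarrow> f' d = f d"
    unfolding f'_def using assms(4) by auto
  have fx: "f x \<noteq> x" using inj assms(4,5) by metis
  show "card {d \<in> S. f' d \<noteq> d} < card {d \<in> S. f d \<noteq> d}"
  proof (rule psubset_card_mono)
    show "finite {d \<in> S. f d \<noteq> d}" using assms(1) by simp
    have "{d \<in> S. f' d \<noteq> d} \<subseteq> {d \<in> S. f d \<noteq> d} - {x}"
    proof -
      have "f d \<noteq> d \<and> d \<noteq> x" if "f' d \<noteq> d" for d
        using that d'[of d] x' assms(4,5) by (cases "d = x"; cases "d = p") auto
      then show ?thesis by blast
    qed
    moreover have "x \<in> {d \<in> S. f d \<noteq> d}" using x fx by simp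
    ultimately show "{d \<in> S. f' d \<noteq> d} \<subset> {d \<in> S. f d \<noteq> d}" by blast
  qed
  show cc: "conn (insert (p, x) (graph_on S f' \<union> Q)) = conn (graph_on S f \<union> Q)" for Q
  proof (intro equalityI conn_subset_conn)
    let ?c = "conn (graph_on S f \<union> Q)"
    have px: "(p, x) \<in> ?c" using assms(3,4) by (auto simp: graph_on_def intro: conn_base)
    moreover have fc: "(d, f d) \<in> ?c" if "d \<in> S" for d
      using that by (auto simp: graph_on_def intro: conn_base)
    moreover have "(p, f x) \<in> ?c" using px fc[OF x] by (rule conn_trans)
    ultimately have "(d, f' d) \<in> ?c" if "d \<in> S" for d
      using that p' x' d' by (cases "d = p"; cases "d = x") auto
    then show "insert (p, x) (graph_on S f' \<union> Q) \<subseteq> ?c"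
      using px by (auto simp: graph_on_def intro: conn_base)
  next
    let ?c = "conn (insert (p, x) (graph_on S f' \<union> Q))"
    have px: "(p, x) \<in> ?c" by (auto intro: conn_base)
    moreover have fc: "(d, f' d) \<in> ?c" if "d \<in> S" for d
      using that by (auto simp: graph_on_def intro: conn_base)
    moreover have "(x, f x) \<in> ?c" using conn_trans[OF conn_sym[OF px] fc[OF assms(3)]] p' by simp
    ultimately have "(d, f d) \<in> ?c" if "d \<in> S" for d
      using that assms(4) d'[of d] fc[of d] by (cases "d = p"; cases "d = x") auto
    then show "graph_on S f \<union> Q \<subseteq> ?c" by (auto simp: graph_on_def intro: conn_base)
  qed
  have "conn (graph_on S f') \<subseteq> {(a, b). a = x \<longleftrightarrow> b = x}"
  proof (rule conn_least)
    have "f' d = x \<longleftrightarrow> d = x" for d using fx p' x' d' inj[of d p] assms(4,5) by (metis)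
    then show "graph_on S f' \<subseteq> {(a, b). a = x \<longleftrightarrow> b = x}" by (auto simp: graph_on_def)
  qed (auto intro: symI transI)
  then have iso: "conn (graph_on S f') `` {x} = {x}" and npx: "(p, x) \<notin> conn (graph_on S f')"
    using assms(5) by auto
  show "(p, x) \<notin> conn (graph_on S f')" by (rule npx)
  let ?C = "conn (graph_on S f)" and ?C' = "conn (graph_on S f')"
  let ?s = "s(p := s p + s x, x := 0)"
  have cls: "?C `` {z} = (if z \<in> ?C' `` {p, x} then ?C' `` {p, x} else ?C' `` {z})" for z
    using cc[of "{}"] class_insert[of p x "graph_on S f'" z] by simp
  have px: "?C' `` {p, x} = insert x (?C' `` {p})" using iso by blast
  show "cycles_sum_zero S f' ?s" if "cycles_sum_zero S f s"
    unfolding cycles_sum_zero_def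
  proof
    fix z assume z: "z \<in> S"
    have sz: "sum s (?C `` {z}) = 0" using that z by (simp add: cycles_sum_zero_def)
    consider "z = x" | "z \<in> ?C' `` {p}" | "z \<noteq> x" "z \<notin> ?C' `` {p}" by blast
    then show "sum ?s (?C' `` {z}) = 0"
    proof cases
      case 1 then show ?thesis using iso by simp
    next
      case 2
      have fin: "finite (?C' `` {p})"
        using class_subset[OF graph_on_subset[OF perm] assms(3)] assms(1) finite_subset by blast
      have eq: "?C' `` {z} = ?C' `` {p}" using 2 by (simp add: class_eq_iff conn_sym)
      have notin: "x \<notin> ?C' `` {p}" using npx by simp
      have "sum ?s (?C' `` {p}) = ?s p + sum ?s (?C' `` {p} - {p})"
        using fin by (subst sum.remove[of _ p]) auto
      also have "sum ?s (?C' `` {p} - {p}) = sum s (?C' `` {p} - {p})"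
        using notin by (intro sum.cong) auto
      also have "?s p + \<dots> = s x + (s p + sum s (?C' `` {p} - {p}))" using assms(5) by simp
      also have "s p + sum s (?C' `` {p} - {p}) = sum s (?C' `` {p})"
        using fin by (subst sum.remove[of _ p]) auto
      also have "s x + \<dots> = sum s (insert x (?C' `` {p}))" using fin notin by simp
      also have "\<dots> = 0" using sz cls[of z] 2 px by simp
      finally show ?thesis unfolding eq .
    next
      case 3
      then have "z \<notin> ?C' `` {p, x}" using px by simp
      then have "?C `` {z} = ?C' `` {z}" and "p \<notin> ?C' `` {z}" "x \<notin> ?C' `` {z}"
        using cls[of z] by (auto dest: conn_sym)
      then show ?thesis using sz by (metis (mono_tags, lifting) fun_upd_other sum.cong)
    qed
  qed
qed

text \<open>Exactness for one permutation; it is the base case of the theorem below, where \<sigma>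
  is the identity and only \<alpha> acts.\<close>

lemma cyclic_primitive:
  assumes "finite S" "f permutes S" "cycles_sum_zero S f a"
  shows "\<exists>\<Theta>. \<forall>d\<in>S. \<Theta> (f d) = \<Theta> d + a d"
  using assms
proof (induction "card {d \<in> S. f d \<noteq> d}" arbitrary: f a rule: less_induct)
  case less
  show ?case
  proof (cases "\<exists>p\<in>S. f p \<noteq> p")
    case True
    then obtain p x where p: "p \<in> S" "f p = x" "p \<noteq> x" by metis
    note peel = fixed_point_peel[OF less.prems(1,2) p]
    obtain \<Theta> where \<Theta>: "\<And>d. d \<in> S \<Longrightarrow> \<Theta> ((f \<circ> transpose p x) d) = \<Theta> d + (a(p := a p + a x, x := 0)) d"
      using less.hyps[OF peel(5) less.prems(1) peel(1) peel(8)[OF less.prems(3)]] by blast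
    have "f x \<noteq> x" using p permutes_inj[OF less.prems(2)] by (metis injD)
    \<comment> \<open>The value at \<open>x\<close> is forced by the step from \<open>p\<close> to
      \<open>x\<close>; the old value belonged to a fixed point and was arbitrary.\<close>
    have "(\<Theta>(x := \<Theta> p + a p)) (f d) = (\<Theta>(x := \<Theta> p + a p)) d + a d" if d: "d \<in> S" for d
    proof -
      have "f d = x \<Longrightarrow> d = p" using p permutes_inj[OF less.prems(2)] by (metis injD)
      then consider "d = p" | "d = x" | "d \<noteq> p" "d \<noteq> x" "f d \<noteq> x" by blast
      then show ?thesis
      proof cases
        case 1 then show ?thesis using p by simp
      next
        case 2 then show ?thesis using p \<Theta>[of p] peel(2) \<open>f x \<noteq> x\<close> by simp
      next
        case 3 then show ?thesis using \<Theta>[OF d] peel(4)[of d] by simp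
      qed
    qed
    then show ?thesis by blast
  next
    case False
    have "a d = 0" if "d \<in> S" for d
    proof -
      have "conn (graph_on S f) \<subseteq> Id"
        by (rule conn_least) (use False in \<open>auto simp: graph_on_def intro: symI transI\<close>)
      then have "conn (graph_on S f) `` {d} = {d}" by auto
      then show ?thesis using less.prems(3) that by (auto simp: cycles_sum_zero_def)
    qed
    then show ?thesis using False by auto
  qed
qed

section \<open>Closed forms on planar maps are exact\<close>

text \<open>The three cycle counts are those of vertices, edges and faces of a hypermap, in which an
  edge may have any number of darts; equality means genus 0. Write \<phi> for the face permutation.
  Since \<sigma> (\<phi> d) = \<alpha> d, passing from d to \<phi> d gains a d and loses s (\<phi>
  d); over a cycle the index shift is harmless, which gives the form \<open>a d - s d\<close>.
  Making x = \<sigma> p a fixed point of \<sigma> adds one vertex, while the faces change by one up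
  or down and the components stay or increase by one. Three combinations are possible.\<close>

theorem euler_inequality_and_exactness:
  assumes "finite S" "\<sigma> permutes S" "\<alpha> permutes S"
  shows "num_classes S (graph_on S \<sigma>) + num_classes S (graph_on S \<alpha>)
      + num_classes S (graph_on S (inv \<sigma> \<circ> \<alpha>))
      \<le> card S + 2 * num_classes S (graph_on S \<sigma> \<union> graph_on S \<alpha>)" (is ?euler)
    and "num_classes S (graph_on S \<sigma>) + num_classes S (graph_on S \<alpha>)
      + num_classes S (graph_on S (inv \<sigma> \<circ> \<alpha>))
      = card S + 2 * num_classes S (graph_on S \<sigma> \<union> graph_on S \<alpha>) \<Longrightarrow>
      cycles_sum_zero S \<sigma> s \<Longrightarrow> cycles_sum_zero S \<alpha> a \<Longrightarrow>
      cycles_sum_zero S (inv \<sigma> \<circ> \<alpha>) (\<lambda>d. a d - s d) \<Longrightarrow>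
      \<exists>\<Theta>. \<forall>d\<in>S. \<Theta> (\<sigma> d) = \<Theta> d + s d \<and> \<Theta> (\<alpha> d) = \<Theta> d + a d"
    (is "?planar \<Longrightarrow> _ \<Longrightarrow> _ \<Longrightarrow> _ \<Longrightarrow> _")
proof -
  have "?euler \<and> (?planar \<longrightarrow> (\<forall>s a. cycles_sum_zero S \<sigma> s \<longrightarrow> cycles_sum_zero S \<alpha> a \<longrightarrow>
      cycles_sum_zero S (inv \<sigma> \<circ> \<alpha>) (\<lambda>d. a d - s d) \<longrightarrow>
      (\<exists>\<Theta>. \<forall>d\<in>S. \<Theta> (\<sigma> d) = \<Theta> d + s d \<and> \<Theta> (\<alpha> d) = \<Theta> d + a d)))"
    using assms
  proof (induction "card {d \<in> S. \<sigma> d \<noteq> d}" arbitrary: \<sigma> rule: less_induct)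
    case less
    show ?case
    proof (cases "\<exists>p\<in>S. \<sigma> p \<noteq> p")
      case False
      have "\<sigma> = id"
      proof
        show "\<sigma> d = id d" for d using False less.prems(2) by (cases "d \<in> S") (auto simp: permutes_def)
      qed
      moreover have "conn (graph_on S id) = Id"
        using conn_least[of "graph_on S id" Id] by (auto simp: graph_on_def intro: symI transI)
      moreover have "conn (graph_on S id \<union> graph_on S \<alpha>) = conn (graph_on S \<alpha>)"
        by (intro equalityI conn_subset_conn conn_mono) (auto simp: graph_on_def intro: conn_base)
      moreover have "card (S // Id) = card S"
        by (subst card_image[of "\<lambda>x. {x}" S, symmetric])
           (auto simp: quotient_def intro: arg_cong[where f = card])
      ultimately show ?thesis
        using cyclic_primitive[OF less.prems(1,3)]
        by (auto simp: num_classes_def cycles_sum_zero_def)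
    next
      case True
      then obtain p x where p: "p \<in> S" "\<sigma> p = x" "p \<noteq> x" by metis
      have x: "x \<in> S" using p less.prems(2) by (auto simp: permutes_in_image)
      define \<sigma>' where "\<sigma>' = \<sigma> \<circ> transpose p x"
      define \<phi> where "\<phi> = inv \<sigma> \<circ> \<alpha>"
      define \<phi>' where "\<phi>' = transpose p x \<circ> \<phi>"
      note peel = fixed_point_peel[OF less.prems(1,2) p, folded \<sigma>'_def]
      have bij: "bij \<sigma>" using less.prems(2) by (rule permutes_bij)
      have "inv \<sigma>' = transpose p x \<circ> inv \<sigma>"
        unfolding \<sigma>'_def using bij by (simp add: o_inv_distrib)
      then have \<phi>': "inv \<sigma>' \<circ> \<alpha> = \<phi>'" unfolding \<phi>'_def \<phi>_def by (simp add: comp_assoc)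
      have perm: "\<phi> permutes S"
        unfolding \<phi>_def using less.prems by (intro permutes_compose permutes_inv)
      have perm': "\<phi>' permutes S"
        unfolding \<phi>'_def using perm p x by (intro permutes_compose) (auto simp: permutes_swap_id)
      let ?V = "num_classes S (graph_on S \<sigma>)" and ?V' = "num_classes S (graph_on S \<sigma>')"
      let ?E = "num_classes S (graph_on S \<alpha>)"
      let ?F = "num_classes S (graph_on S \<phi>)" and ?F' = "num_classes S (graph_on S \<phi>')"
      let ?R = "graph_on S \<sigma> \<union> graph_on S \<alpha>" and ?R' = "graph_on S \<sigma>' \<union> graph_on S \<alpha>"
      let ?c = "num_classes S ?R" and ?c' = "num_classes S ?R'"
      note IH = less.hyps[OF peel(5) less.prems(1) peel(1) less.prems(3), unfolded \<phi>']
      have subs: "graph_on S \<sigma>' \<subseteq> S \<times> S" "graph_on S \<phi> \<subseteq> S \<times> S" "graph_on S \<phi>' \<subseteq> S \<times> S" "?R' \<subseteq> S \<times> S"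
        using graph_on_subset[OF peel(1)] graph_on_subset[OF less.prems(3)]
          graph_on_subset[OF perm] graph_on_subset[OF perm'] by auto
      have V: "?V' = ?V + 1"
        using num_classes_insert[OF less.prems(1) subs(1) p(1) x peel(7)] peel(6)[of "{}"]
        by (simp add: num_classes_def)
      have cR: "conn (insert (p, x) ?R') = conn ?R" using peel(6)[of "graph_on S \<alpha>"] by simp
      have cF: "conn (insert (p, x) (graph_on S \<phi>')) = conn (insert (p, x) (graph_on S \<phi>))"
        using conn_insert_transpose[OF p(1) x, of \<phi> "{}"] by (simp add: \<phi>'_def)
      have par: "(p, x) \<in> conn (graph_on S \<phi>') \<longleftrightarrow> (p, x) \<notin> conn (graph_on S \<phi>)"
        using transpose_conn_iff[OF perm less.prems(1) p(1) x p(3)] conn_sym[of p x] conn_sym[of x p]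
        unfolding \<phi>'_def by blast
      \<comment> \<open>A face never leaves its component.\<close>
      have \<phi>R: "(d, \<phi>' d) \<in> conn ?R'" if "d \<in> S" for d
      proof -
        have "\<sigma>' (\<phi>' d) = \<alpha> d"
          unfolding \<phi>'[symmetric] using permutes_inverses(1)[OF peel(1)] by simp
        moreover have "\<phi>' d \<in> S" using perm' that by (simp add: permutes_in_image)
        ultimately have "(\<phi>' d, \<alpha> d) \<in> ?R'" "(d, \<alpha> d) \<in> ?R'"
          using that by (auto simp: graph_on_def)
        then show ?thesis by (meson conn_base conn_sym conn_trans)
      qed
      then have sub\<phi>: "conn (graph_on S \<phi>') \<subseteq> conn ?R'"
        by (intro conn_subset_conn) (auto simp: graph_on_def)
      have sumI: "sum (s(p := s p + s x, x := 0)) Z = sum s Z"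
        if "finite Z" "p \<in> Z" "x \<in> Z" for s :: "'a \<Rightarrow> int" and Z
      proof -
        have "sum (s(p := s p + s x, x := 0)) Z - sum s Z
            = (\<Sum>z\<in>Z. (if z = p then s x else 0) - (if z = x then s x else 0))"
          unfolding sum_subtractf[symmetric] using p(3) by (intro sum.cong) auto
        also have "\<dots> = 0" using that by (simp add: sum_subtractf)
        finally show ?thesis by simp
      qed
      have fin: "finite (conn (graph_on S \<phi>) `` {z})" if "z \<in> S" for z
        using class_subset[OF subs(2) that] less.prems(1) finite_subset by blast
      have fin': "finite (conn (graph_on S \<phi>') `` {z})" if "z \<in> S" for z
        using class_subset[OF subs(3) that] less.prems(1) finite_subset by blast
      show ?thesis
      proof (cases "(p, x) \<in> conn ?R'")
        case same: True
        then have c: "?c' = ?c" using conn_insert_redundant[OF same] cR by (simp add: num_classes_def)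
        show ?thesis
        proof (cases "(p, x) \<in> conn (graph_on S \<phi>)")
          case True
          then have "?F' = ?F + 1"
            using num_classes_insert[OF less.prems(1) subs(3) p(1) x] par cF conn_insert_redundant[OF True]
            by (simp add: num_classes_def)
          \<comment> \<open>A vertex and a face are gained within one component: the genus drops, so
            the original map satisfies the inequality strictly and the claim on exactness is
            vacuous.\<close>
          then show ?thesis using IH V c unfolding \<phi>_def[symmetric] by linarith
        next
          case diff: False
          then have F: "?F = ?F' + 1"
            using num_classes_insert[OF less.prems(1) subs(2) p(1) x] par cF
              conn_insert_redundant[of p x "graph_on S \<phi>'"]
            by (simp add: num_classes_def)
          have cls: "conn (graph_on S \<phi>') `` {z} = (if z \<in> conn (graph_on S \<phi>) `` {p, x}
              then conn (graph_on S \<phi>) `` {p, x} else conn (graph_on S \<phi>) `` {z})" for z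
            using conn_insert_redundant[of p x "graph_on S \<phi>'"] par diff cF class_insert[of p x "graph_on S \<phi>" z]
            by simp
          have "\<exists>\<Theta>. \<forall>d\<in>S. \<Theta> (\<sigma> d) = \<Theta> d + s d \<and> \<Theta> (\<alpha> d) = \<Theta> d + a d"
            if pl: "?V + ?E + ?F = card S + 2 * ?c" and s: "cycles_sum_zero S \<sigma> s"
              and a: "cycles_sum_zero S \<alpha> a" and as: "cycles_sum_zero S \<phi> (\<lambda>d. a d - s d)" for s a
          proof -
            let ?s = "s(p := s p + s x, x := 0)"
            \<comment> \<open>Two faces have merged into one that contains both \<open>p\<close> and
              \<open>x\<close>, so moving weight from \<open>x\<close> to \<open>p\<close> does not
              affect its sum.\<close>
            have "cycles_sum_zero S \<phi>' (\<lambda>d. a d - ?s d)"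
              unfolding cycles_sum_zero_def
            proof
              fix z assume z: "z \<in> S"
              show "(\<Sum>d\<in>conn (graph_on S \<phi>') `` {z}. a d - ?s d) = 0"
              proof (cases "z \<in> conn (graph_on S \<phi>) `` {p, x}")
                case True
                let ?Z = "conn (graph_on S \<phi>) `` {p, x}"
                have Z: "?Z = conn (graph_on S \<phi>) `` {p} \<union> conn (graph_on S \<phi>) `` {x}" by auto
                have disj: "conn (graph_on S \<phi>) `` {p} \<inter> conn (graph_on S \<phi>) `` {x} = {}"
                  using diff by (auto dest: conn_sym conn_trans)
                have "(\<Sum>d\<in>?Z. a d - ?s d) = (\<Sum>d\<in>?Z. a d - s d)"
                  using sumI[of ?Z s] fin[OF p(1)] fin[OF x] unfolding Z by (simp add: sum_subtractf)
                also have "\<dots> = 0"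
                  unfolding Z using as p(1) x fin disj
                  by (subst sum.union_disjoint) (auto simp: cycles_sum_zero_def)
                finally show ?thesis using True cls by simp
              next
                case False
                then have "p \<notin> conn (graph_on S \<phi>) `` {z}" "x \<notin> conn (graph_on S \<phi>) `` {z}"
                  by (auto dest: conn_sym)
                then have "(\<Sum>d\<in>conn (graph_on S \<phi>) `` {z}. a d - ?s d)
                    = (\<Sum>d\<in>conn (graph_on S \<phi>) `` {z}. a d - s d)"
                  by (intro sum.cong) auto
                then show ?thesis using as z False cls by (simp add: cycles_sum_zero_def)
              qed
            qed
            moreover have "?V' + ?E + ?F' = card S + 2 * ?c'" using pl V F c by simp
            ultimately obtain \<Theta> where \<Theta>: "\<And>d. d \<in> S \<Longrightarrow> \<Theta> (\<sigma>' d) = \<Theta> d + ?s d"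
              "\<And>d. d \<in> S \<Longrightarrow> \<Theta> (\<alpha> d) = \<Theta> d + a d"
              using IH peel(8)[OF s] a by blast
            \<comment> \<open>Only the step from \<open>p\<close> to \<open>x\<close> is in doubt.
              Sum \<Theta> over the images under \<alpha>, which are the images under \<sigma> after
              \<phi>, along the old face of \<open>x\<close>; that face avoids \<open>p\<close>.
              Every dart except \<open>x\<close> satisfies the equation for \<sigma>, so the defect
              is \<Theta> p + s p - \<Theta> x, and closedness on this face makes it vanish.\<close>
            let ?X = "conn (graph_on S \<phi>) `` {x}"
            have X: "?X \<subseteq> S" "p \<notin> ?X" "x \<in> ?X"
              using class_subset[OF subs(2) x] diff by (auto dest: conn_sym)
            have \<sigma>\<phi>: "\<sigma> (\<phi> d) = \<alpha> d" for d
              unfolding \<phi>_def using permutes_inverses(1)[OF less.prems(2)] by simp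
            have "sum \<Theta> ?X + sum a ?X = (\<Sum>d\<in>?X. \<Theta> (\<alpha> d))"
              unfolding sum.distrib[symmetric] using X \<Theta>(2) by (intro sum.cong) auto
            also have "\<dots> = (\<Sum>d\<in>?X. \<Theta> (\<sigma> (\<phi> d)))" using \<sigma>\<phi> by simp
            also have "\<dots> = (\<Sum>d\<in>?X. \<Theta> (\<sigma> d))"
            proof (rule sum_closed_permutes[OF perm fin[OF x] X(1)])
              have "graph_on S \<phi> \<subseteq> conn (graph_on S \<phi>)" by (rule subrelI) (rule conn_base)
              then show "\<phi> d \<in> ?X" if "d \<in> ?X" for d
                using class_permutes[OF perm x _ that] that X(1) by (simp add: subsetD)
            qed
            also have "\<dots> = (\<Sum>d\<in>?X. \<Theta> d + s d + (if d = x then \<Theta> p + s p - \<Theta> x else 0))"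
            proof (rule sum.cong)
              fix d assume d: "d \<in> ?X"
              show "\<Theta> (\<sigma> d) = \<Theta> d + s d + (if d = x then \<Theta> p + s p - \<Theta> x else 0)"
              proof (cases "d = x")
                case True
                then show ?thesis using \<Theta>(1)[OF p(1)] peel(2) p(3) by simp
              next
                case False
                moreover have "d \<noteq> p" using d X by auto
                ultimately show ?thesis using \<Theta>(1)[of d] peel(4)[of d] d X by auto
              qed
            qed simp
            also have "\<dots> = sum \<Theta> ?X + sum s ?X + (\<Theta> p + s p - \<Theta> x)"
              using fin[OF x] X(3) by (simp add: sum.distrib)
            finally have "sum a ?X - sum s ?X = \<Theta> p + s p - \<Theta> x" by simp
            moreover have "sum a ?X - sum s ?X = 0"
              using as x by (simp add: cycles_sum_zero_def sum_subtractf)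
            ultimately have \<Theta>x: "\<Theta> x = \<Theta> p + s p" by simp
            have "\<Theta> (\<sigma> d) = \<Theta> d + s d" if "d \<in> S" for d
              using \<Theta>(1)[OF that] \<Theta>(1)[OF p(1)] \<Theta>x p peel(2) peel(4)[of d]
              by (cases "d = p"; cases "d = x") auto
            then show ?thesis using \<Theta>(2) by blast
          qed
          then show ?thesis using IH V F c unfolding \<phi>_def[symmetric] by force
        qed
      next
        case split: False
        then have diff': "(p, x) \<notin> conn (graph_on S \<phi>')" using sub\<phi> by blast
        have c: "?c' = ?c + 1"
          using num_classes_insert[OF less.prems(1) subs(4) p(1) x split] cR by (simp add: num_classes_def)
        have cF': "conn (insert (p, x) (graph_on S \<phi>')) = conn (graph_on S \<phi>)"
          using cF par diff' conn_insert_redundant[of p x "graph_on S \<phi>"] by simp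
        have F: "?F' = ?F + 1"
          using num_classes_insert[OF less.prems(1) subs(3) p(1) x diff'] cF'
          by (simp add: num_classes_def)
        have "\<exists>\<Theta>. \<forall>d\<in>S. \<Theta> (\<sigma> d) = \<Theta> d + s d \<and> \<Theta> (\<alpha> d) = \<Theta> d + a d"
          if pl: "?V + ?E + ?F = card S + 2 * ?c" and s: "cycles_sum_zero S \<sigma> s"
            and a: "cycles_sum_zero S \<alpha> a" and as: "cycles_sum_zero S \<phi> (\<lambda>d. a d - s d)" for s a
        proof -
          let ?s = "s(p := s p + s x, x := 0)"
          let ?g = "\<lambda>d. a d - ?s d"
          have s': "cycles_sum_zero S \<sigma>' ?s" by (rule peel(8)[OF s])
          have generic: "sum ?g (conn (graph_on S \<phi>') `` {z}) = 0"
            if z: "z \<in> S" "(p, z) \<notin> conn (graph_on S \<phi>')" "(x, z) \<notin> conn (graph_on S \<phi>')" for z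
          proof -
            have "z \<notin> conn (graph_on S \<phi>') `` {p, x}" using z(2,3) by blast
            then have "conn (graph_on S \<phi>) `` {z} = conn (graph_on S \<phi>') `` {z}"
              using class_insert[of p x "graph_on S \<phi>'" z] cF' by simp
            moreover have "sum ?g (conn (graph_on S \<phi>') `` {z})
                = (\<Sum>d\<in>conn (graph_on S \<phi>') `` {z}. a d - s d)"
              by (intro sum.cong) (use z(2,3) in \<open>auto dest: conn_sym\<close>)
            ultimately show ?thesis using as z(1) unfolding cycles_sum_zero_def by metis
          qed
          \<comment> \<open>Over a whole component the vertex and edge conditions alone give
            0.\<close>
          have comp: "sum ?g (conn ?R' `` {y}) = 0" if y: "y \<in> S" for y
          proof -
            let ?K = "conn ?R' `` {y}"
            have K: "?K \<subseteq> S" "finite ?K"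
              using class_subset[OF subs(4) y] less.prems(1) by (auto intro: finite_subset)
            have sat: "conn Q `` {z} \<subseteq> ?K" if "z \<in> ?K" "Q \<subseteq> ?R'" for z Q
            proof
              fix w assume "w \<in> conn Q `` {z}"
              then have "(z, w) \<in> conn ?R'" using conn_mono[OF that(2)] by auto
              then show "w \<in> ?K" using that(1) conn_trans[of y z ?R' w] by simp
            qed
            have "sum a ?K = 0"
              by (rule sum_classes_zero[OF K(2), of "graph_on S \<alpha>"])
                 (use sat a K(1) in \<open>auto simp: cycles_sum_zero_def\<close>)
            moreover have "sum ?s ?K = 0"
              by (rule sum_classes_zero[OF K(2), of "graph_on S \<sigma>'"])
                 (use sat s' K(1) in \<open>auto simp: cycles_sum_zero_def simp del: fun_upd_apply\<close>)
            ultimately show ?thesis unfolding sum_subtractf by (simp del: fun_upd_apply)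
          qed
          \<comment> \<open>The face through \<open>p\<close> and \<open>x\<close> falls apart into
            one face per component. Each part is closed because the whole component sums to 0 and
            all its other faces are old ones.\<close>
          have special: "sum ?g (conn (graph_on S \<phi>') `` {y}) = 0"
            if y: "y \<in> S" "y = p \<or> y = x" for y
          proof -
            let ?K = "conn ?R' `` {y}" and ?Y = "conn (graph_on S \<phi>') `` {y}"
            have K: "?K \<subseteq> S" "finite ?K"
              using class_subset[OF subs(4) y(1)] less.prems(1) by (auto intro: finite_subset)
            have YK: "?Y \<subseteq> ?K" using sub\<phi> by auto
            have "sum ?g (?K - ?Y) = 0"
            proof (rule sum_classes_zero[of _ "graph_on S \<phi>'"])
              show "finite (?K - ?Y)" using K by simp
              fix z assume z: "z \<in> ?K - ?Y"
              show "conn (graph_on S \<phi>') `` {z} \<subseteq> ?K - ?Y"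
              proof
                fix w assume w: "w \<in> conn (graph_on S \<phi>') `` {z}"
                then have "(z, w) \<in> conn ?R'" using sub\<phi> by auto
                then have "w \<in> ?K" using z conn_trans[of y z ?R' w] by simp
                moreover have "w \<notin> ?Y"
                  using w z conn_trans[of y w "graph_on S \<phi>'" z] conn_sym[of z w] by auto
                ultimately show "w \<in> ?K - ?Y" by simp
              qed
              have yz: "(y, z) \<in> conn ?R'" "(y, z) \<notin> conn (graph_on S \<phi>')" using z by auto
              have "(p, z) \<notin> conn (graph_on S \<phi>')" "(x, z) \<notin> conn (graph_on S \<phi>')"
                using y(2) yz split sub\<phi>
                by (metis conn_sym conn_trans subsetD)+
              moreover have "z \<in> S" using z K by auto
              ultimately show "sum ?g (conn (graph_on S \<phi>') `` {z}) = 0" by (intro generic)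
            qed
            then show ?thesis using comp[OF y(1)] sum.subset_diff[OF YK K(2), of ?g] by simp
          qed
          have "cycles_sum_zero S \<phi>' ?g"
            unfolding cycles_sum_zero_def
          proof
            fix z assume z: "z \<in> S"
            show "sum ?g (conn (graph_on S \<phi>') `` {z}) = 0"
            proof (cases "(p, z) \<in> conn (graph_on S \<phi>') \<or> (x, z) \<in> conn (graph_on S \<phi>')")
              case True
              then show ?thesis using special[OF p(1)] special[OF x] class_eq_iff by metis
            next
              case False
              then show ?thesis using generic z by blast
            qed
          qed
          moreover have "?V' + ?E + ?F' = card S + 2 * ?c'" using pl V F c by simp
          ultimately obtain \<Theta>0 where \<Theta>0: "\<And>d. d \<in> S \<Longrightarrow> \<Theta>0 (\<sigma>' d) = \<Theta>0 d + ?s d"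
            "\<And>d. d \<in> S \<Longrightarrow> \<Theta>0 (\<alpha> d) = \<Theta>0 d + a d"
            using IH s' a by blast
          \<comment> \<open>\<open>p\<close> and \<open>x\<close> lie in different components of the
            reduced map, so the primitive may be shifted on the component of \<open>x\<close> until
            the step from \<open>p\<close> to \<open>x\<close> is right.\<close>
          define \<Theta> where "\<Theta> d = (if (x, d) \<in> conn ?R' then \<Theta>0 d + (\<Theta>0 p + s p - \<Theta>0 x) else \<Theta>0 d)" for d
          have "(d, \<sigma>' d) \<in> conn ?R'" "(d, \<alpha> d) \<in> conn ?R'" if "d \<in> S" for d
            using that by (auto simp: graph_on_def intro!: conn_base)
          then have "(x, \<sigma>' d) \<in> conn ?R' \<longleftrightarrow> (x, d) \<in> conn ?R'" "(x, \<alpha> d) \<in> conn ?R' \<longleftrightarrow> (x, d) \<in> conn ?R'"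
            if "d \<in> S" for d
            using that by (meson conn_sym conn_trans)+
          then have \<Theta>: "\<Theta> (\<sigma>' d) = \<Theta> d + ?s d" "\<Theta> (\<alpha> d) = \<Theta> d + a d" if "d \<in> S" for d
            using \<Theta>0 that unfolding \<Theta>_def by auto
          have \<Theta>x: "\<Theta> x = \<Theta> p + s p" unfolding \<Theta>_def using split conn_sym[of x p] by auto
          have "\<Theta> (\<sigma> d) = \<Theta> d + s d" if "d \<in> S" for d
            using \<Theta>(1)[OF that] \<Theta>(1)[OF p(1)] \<Theta>x p peel(2) peel(4)[of d]
            by (cases "d = p"; cases "d = x") auto
          then show ?thesis using \<Theta>(2) by blast
        qed
        then show ?thesis using IH V F c unfolding \<phi>_def[symmetric] by force
      qed
    qed
  qed
  then show ?euler
    and "?planar \<Longrightarrow> cycles_sum_zero S \<sigma> s \<Longrightarrow> cycles_sum_zero S \<alpha> a \<Longrightarrow>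
      cycles_sum_zero S (inv \<sigma> \<circ> \<alpha>) (\<lambda>d. a d - s d) \<Longrightarrow>
      \<exists>\<Theta>. \<forall>d\<in>S. \<Theta> (\<sigma> d) = \<Theta> d + s d \<and> \<Theta> (\<alpha> d) = \<Theta> d + a d"
    by blast+
qed

section \<open>Biconnected plane graphs\<close>

lemma class_eq_orbit:
  assumes "f permutes S" "finite S" "z \<in> S"
  shows "conn (graph_on S f) `` {z} = orbit f z"
proof
  have perm: "permutation f" using assms(1,2) by (auto simp: permutation_permutes)
  show "conn (graph_on S f) `` {z} \<subseteq> orbit f z"
    using conn_graph_funpow[OF assms(1,2)] by (auto simp: orbit_altdef_permutation[OF perm])
  show "orbit f z \<subseteq> conn (graph_on S f) `` {z}"
    using conn_funpow[OF assms(1,3)] by (auto simp: orbit_altdef)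
qed

lemma num_classes_orbits:
  "f permutes S \<Longrightarrow> finite S \<Longrightarrow> num_classes S (graph_on S f) = card (orbit f ` S)"
  unfolding num_classes_def quotient_def by (rule arg_cong[where f = card]) (auto simp: class_eq_orbit)

text \<open>In the separation arguments below, \<open>X\<close> collects vertices around which a
  primitive has one fixed value.\<close>

lemma connected_closed_set:
  assumes "connected G" "u \<in> verts G" "u \<in> X"
    and "\<And>a. a \<in> arcs G \<Longrightarrow> tail G a \<in> X \<longleftrightarrow> head G a \<in> X"
  shows "verts G \<subseteq> X"
proof
  fix v assume "v \<in> verts G"
  then have "u \<rightarrow>\<^sup>*\<^bsub>mk_symmetric G\<^esub> v"
    using assms(1,2) by (auto simp: connected_def strongly_connected_def)
  then have "(u, v) \<in> rtrancl_on (verts G) (parcs (mk_symmetric G))" by (simp add: reachable_def)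
  then show "v \<in> X"
  proof (induction rule: rtrancl_on_induct)
    case (step w v)
    then show ?case using assms(4) by (auto simp: parcs_mk_symmetric)
  qed (rule assms(3))
qed

text \<open>The last two assumptions will follow from the decomposition tree. They make the cycles
  of \<open>ccw M\<close> correspond to the vertices and ensure that the far end of a dart survives
  the deletion of its tail.\<close>

locale biconnected_plane =
  fixes M :: "('v, 'd) plane_map"
  assumes plane: "plane_graph M" and biconn: "biconnected M"
    and no_loop: "\<And>d. d \<in> arcs (skel M) \<Longrightarrow> tail (skel M) d \<noteq> head (skel M) d"
    and not_isolated: "\<And>v. v \<in> verts (skel M) \<Longrightarrow> out_arcs (skel M) v \<noteq> {}"
begin

abbreviation "darts \<equiv> arcs (skel M)"
abbreviation "src \<equiv> tail (skel M)"
abbreviation "dst \<equiv> head (skel M)"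

sublocale fin_digraph "skel M" using plane by (simp add: plane_graph_def)
sublocale bidirected_digraph "skel M" "opp M" using plane by (simp add: plane_graph_def)

section \<open>Rotations at vertices and boundary walks of faces\<close>

lemma ccw_permutes: "ccw M permutes darts"
  using plane by (simp add: plane_graph_def)

lemma ccw_orbit: "d \<in> darts \<Longrightarrow> orbit (ccw M) d = out_arcs (skel M) (src d)"
proof -
  assume d: "d \<in> darts"
  then have "cyclic_on (ccw M) (out_arcs (skel M) (src d))"
    using plane d unfolding plane_graph_def by (metis empty_iff in_out_arcs_conv tail_in_verts)
  then show ?thesis using d by (intro orbit_cyclic_eq3) auto
qed

lemma ccw_in [simp]: "ccw M d \<in> darts \<longleftrightarrow> d \<in> darts"
  using permutes_in_image[OF ccw_permutes] .

lemma tail_ccw [simp]: "d \<in> darts \<Longrightarrow> src (ccw M d) = src d"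
  using ccw_orbit[of d] orbit.base[of "ccw M" d] by auto

lemma face_next_eq: "face_next M = inv (ccw M) \<circ> opp M"
  by (auto simp: face_next_def)

lemma face_next_permutes: "face_next M permutes darts"
  unfolding face_next_eq by (intro permutes_compose arev_permutes_arcs permutes_inv ccw_permutes)

lemma ccw_face_next [simp]: "ccw M (face_next M d) = opp M d"
  unfolding face_next_def using permutes_inverses(1)[OF ccw_permutes] by simp

lemma face_next_in [simp]: "face_next M d \<in> darts \<longleftrightarrow> d \<in> darts"
  using permutes_in_image[OF face_next_permutes] .

lemma tail_face_next [simp]: "d \<in> darts \<Longrightarrow> src (face_next M d) = dst d"
  using tail_ccw[of "face_next M d"] by simp

lemma face_subset: "f \<in> map_faces M \<Longrightarrow> f \<subseteq> darts"
  using permutes_orbit_subset[OF face_next_permutes] by (auto simp: map_faces_def)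

lemma face_finite: "f \<in> map_faces M \<Longrightarrow> finite f"
  using finite_subset[OF face_subset finite_arcs] .

lemma face_next_permutation: "permutation (face_next M)"
  using face_next_permutes finite_arcs unfolding permutation_permutes by blast

lemma self_in_face: "d \<in> orbit (face_next M) d"
  using permutation_self_in_orbit[OF face_next_permutation] .

lemma face_orbit: "f \<in> map_faces M \<Longrightarrow> d \<in> f \<Longrightarrow> orbit (face_next M) d = f"
  unfolding map_faces_def
  using cyclic_on_orbit[OF face_next_permutes finite_arcs] orbit_cyclic_eq3 by fastforce

lemma face_next_face: "f \<in> map_faces M \<Longrightarrow> d \<in> f \<Longrightarrow> face_next M d \<in> f"
  using face_orbit[of f d] orbit.base[of "face_next M" d] by auto

lemma face_next_face_iff: "f \<in> map_faces M \<Longrightarrow> face_next M d \<in> f \<longleftrightarrow> d \<in> f"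
proof
  assume f: "f \<in> map_faces M" "face_next M d \<in> f"
  then have "face_next M d \<in> darts" using face_subset by blast
  then have "orbit (face_next M) (face_next M d) = orbit (face_next M) d"
    using permutation_orbit_step[OF face_next_permutation] by simp
  then show "d \<in> f" using face_orbit[OF f] self_in_face by metis
qed (rule face_next_face)

text \<open>Used contrapositively: a face boundary with darts of two kinds switches from one kind to
  the other somewhere.\<close>

lemma face_closed_eq:
  assumes "f \<in> map_faces M" "X \<subseteq> f" "X \<noteq> {}" "\<And>d. d \<in> X \<Longrightarrow> face_next M d \<in> X"
  shows "X = f"
proof -
  obtain d where d: "d \<in> X" using assms(3) by blast
  have "y \<in> X" if "y \<in> orbit (face_next M) d" for y
    using that by induction (use d assms(4) in auto)
  then show ?thesis using face_orbit[OF assms(1), of d] d assms(2) by blast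
qed

lemma rotation_closed_eq:
  assumes "X \<subseteq> out_arcs (skel M) w" "X \<noteq> {}" "\<And>d. d \<in> X \<Longrightarrow> ccw M d \<in> X"
  shows "X = out_arcs (skel M) w"
proof -
  obtain d where d: "d \<in> X" using assms(2) by blast
  have "y \<in> X" if "y \<in> orbit (ccw M) d" for y
    using that by induction (use d assms(3) in auto)
  moreover have "d \<in> darts" "src d = w" using d assms(1) by auto
  ultimately show ?thesis using ccw_orbit[of d] assms(1) by blast
qed

lemma rotation_const:
  fixes \<Theta> :: "'d \<Rightarrow> int"
  assumes "\<And>d. d \<in> out_arcs (skel M) w \<Longrightarrow> \<Theta> (ccw M d) = \<Theta> d"
    and "d \<in> out_arcs (skel M) w" "d' \<in> out_arcs (skel M) w"
  shows "\<Theta> d' = \<Theta> d"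
proof -
  have "{e \<in> out_arcs (skel M) w. \<Theta> e = \<Theta> d} = out_arcs (skel M) w"
    by (rule rotation_closed_eq) (use assms in auto)
  then show ?thesis using assms(3) by blast
qed

section \<open>Euler's formula in terms of cycle counts\<close>

lemma ccw_classes: "num_classes darts (graph_on darts (ccw M)) = card (verts (skel M))"
proof -
  have "orbit (ccw M) ` darts = out_arcs (skel M) ` verts (skel M)"
  proof
    show "orbit (ccw M) ` darts \<subseteq> out_arcs (skel M) ` verts (skel M)" using ccw_orbit by auto
    show "out_arcs (skel M) ` verts (skel M) \<subseteq> orbit (ccw M) ` darts"
    proof
      fix X assume "X \<in> out_arcs (skel M) ` verts (skel M)"
      then obtain v d where "X = out_arcs (skel M) v" "d \<in> out_arcs (skel M) v"
        using not_isolated by blast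
      then show "X \<in> orbit (ccw M) ` darts" using ccw_orbit[of d] by auto
    qed
  qed
  moreover have "inj_on (out_arcs (skel M)) (verts (skel M))"
  proof (rule inj_onI)
    fix v w assume "v \<in> verts (skel M)" "out_arcs (skel M) v = out_arcs (skel M) w"
    then show "v = w" using not_isolated by (metis all_not_in_conv in_out_arcs_conv)
  qed
  ultimately show ?thesis
    using num_classes_orbits[OF ccw_permutes finite_arcs] by (simp add: card_image)
qed

lemma opp_class: "d \<in> darts \<Longrightarrow> conn (graph_on darts (opp M)) `` {d} = {d, opp M d}"
proof
  show "conn (graph_on darts (opp M)) `` {d} \<subseteq> {d, opp M d}"
  proof -
    have "conn (graph_on darts (opp M)) \<subseteq> {(x, y). y = x \<or> y = opp M x}"
      by (rule conn_least) (auto simp: graph_on_def intro: symI transI)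
    then show ?thesis by auto
  qed
  show "d \<in> darts \<Longrightarrow> {d, opp M d} \<subseteq> conn (graph_on darts (opp M)) `` {d}"
    by (auto simp: graph_on_def intro: conn_base)
qed

lemma opp_classes: "2 * num_classes darts (graph_on darts (opp M)) = card darts"
proof -
  let ?C = "darts // conn (graph_on darts (opp M))"
  have C: "X \<in> ?C \<Longrightarrow> \<exists>d\<in>darts. X = {d, opp M d}" for X
    using opp_class by (auto simp: quotient_def)
  have U: "\<Union> ?C = darts" using opp_class by (auto simp: quotient_def)
  have "2 * card ?C = card (\<Union> ?C)"
  proof (rule card_partition)
    show "finite ?C" unfolding quotient_def by simp
    show "finite (\<Union> ?C)" using U by simp
    show "card X = 2" if "X \<in> ?C" for X
      using C[OF that] arev_neq by (metis card_2_iff)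
    show "X \<inter> Y = {}" if "X \<in> ?C" "Y \<in> ?C" "X \<noteq> Y" for X Y
      using C[OF that(1)] C[OF that(2)] that(3) by (auto simp: arev_eq_iff)
  qed
  then show ?thesis using U by (simp add: num_classes_def)
qed

lemma one_class: "num_classes darts (graph_on darts (ccw M) \<union> graph_on darts (opp M)) = 1"
proof -
  let ?R = "graph_on darts (ccw M) \<union> graph_on darts (opp M)"
  have con: "connected (skel M)" using plane by (simp add: plane_graph_def)
  then obtain v where "v \<in> verts (skel M)" by (auto simp: connected_def strongly_connected_def)
  then obtain d0 where d0: "d0 \<in> darts"
    using not_isolated by (meson ex_in_conv in_out_arcs_conv)
  have same_tail: "(d, d') \<in> conn ?R" if "d \<in> darts" "d' \<in> darts" "src d = src d'" for d d'
  proof -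
    have "d' \<in> orbit (ccw M) d" using that ccw_orbit[of d] by simp
    then have "(d, d') \<in> conn (graph_on darts (ccw M))"
      using class_eq_orbit[OF ccw_permutes finite_arcs that(1)] by blast
    then show ?thesis using conn_mono[of "graph_on darts (ccw M)" ?R] by blast
  qed
  have opp: "(d, opp M d) \<in> conn ?R" if "d \<in> darts" for d
    using that by (auto simp: graph_on_def intro!: conn_base)
  \<comment> \<open>Rotation joins the darts at one vertex, and reversal carries the property along
    an edge.\<close>
  let ?X = "{w. \<forall>d\<in>out_arcs (skel M) w. (d0, d) \<in> conn ?R}"
  have step: "dst a \<in> ?X" if "a \<in> darts" "src a \<in> ?X" for a
  proof -
    have "(d0, a) \<in> conn ?R" using that by simp
    then have "(d0, opp M a) \<in> conn ?R" using opp[OF that(1)] by (rule conn_trans)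
    moreover have "(opp M a, d) \<in> conn ?R" if "d \<in> out_arcs (skel M) (dst a)" for d
      using that \<open>a \<in> darts\<close> by (intro same_tail) auto
    ultimately show ?thesis using conn_trans[of d0 "opp M a" ?R] by blast
  qed
  have "verts (skel M) \<subseteq> ?X"
  proof (rule connected_closed_set[OF con])
    show "src d0 \<in> verts (skel M)" using d0 by simp
    show "src d0 \<in> ?X" using d0 same_tail by simp
    show "src a \<in> ?X \<longleftrightarrow> dst a \<in> ?X" if "a \<in> darts" for a
    proof -
      have "src a \<in> ?X" if "dst a \<in> ?X" using step[of "opp M a"] \<open>a \<in> darts\<close> that by simp
      then show ?thesis using step[OF that] by blast
    qed
  qed
  have all: "(d0, d) \<in> conn ?R" if "d \<in> darts" for d
  proof -
    have "src d \<in> ?X" using \<open>verts (skel M) \<subseteq> ?X\<close> tail_in_verts[OF that] by (rule subsetD)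
    then show ?thesis using that by simp
  qed
  have "darts // conn ?R = {conn ?R `` {d0}}"
  proof
    show "darts // conn ?R \<subseteq> {conn ?R `` {d0}}"
      using all class_eq_iff[of ?R d0] by (auto simp: quotient_def)
    show "{conn ?R `` {d0}} \<subseteq> darts // conn ?R" using d0 by (auto simp: quotient_def)
  qed
  then show ?thesis by (simp add: num_classes_def)
qed

text \<open>\<open>s\<close> lives on corners and \<open>a\<close> on edges. A boundary walk passes
  corners clockwise, since \<open>ccw M (face_next M d) = opp M d\<close>; hence the minus sign in
  the face condition.\<close>

theorem closed_imp_exact:
  fixes s a :: "'d \<Rightarrow> int"
  assumes "\<And>v. v \<in> verts (skel M) \<Longrightarrow> sum s (out_arcs (skel M) v) = 0"
    and "\<And>d. d \<in> darts \<Longrightarrow> a (opp M d) = - a d"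
    and "\<And>f. f \<in> map_faces M \<Longrightarrow> (\<Sum>d\<in>f. a d - s d) = 0"
  obtains \<Theta> where "\<And>d. d \<in> darts \<Longrightarrow> \<Theta> (ccw M d) = \<Theta> d + s d"
    and "\<And>d. d \<in> darts \<Longrightarrow> \<Theta> (opp M d) = \<Theta> d + a d"
proof -
  have "num_classes darts (graph_on darts (ccw M)) + num_classes darts (graph_on darts (opp M))
      + num_classes darts (graph_on darts (inv (ccw M) \<circ> opp M))
      = card darts + 2 * num_classes darts (graph_on darts (ccw M) \<union> graph_on darts (opp M))"
  proof -
    have "num_classes darts (graph_on darts (inv (ccw M) \<circ> opp M)) = card (map_faces M)"
      using num_classes_orbits[OF face_next_permutes finite_arcs]
      by (simp add: map_faces_def face_next_eq)
    moreover have "2 * card (verts (skel M)) + 2 * card (map_faces M) = card darts + 4"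
      using plane by (simp add: plane_graph_def)
    ultimately show ?thesis using ccw_classes opp_classes one_class by linarith
  qed
  moreover have "cycles_sum_zero darts (ccw M) s"
    unfolding cycles_sum_zero_def
    using assms(1) by (simp add: class_eq_orbit[OF ccw_permutes] ccw_orbit)
  moreover have "cycles_sum_zero darts (opp M) a"
    unfolding cycles_sum_zero_def
  proof
    fix d assume "d \<in> darts"
    then show "sum a (conn (graph_on darts (opp M)) `` {d}) = 0"
      using arev_neq[of d] assms(2)[of d] by (simp add: opp_class)
  qed
  moreover have "cycles_sum_zero darts (inv (ccw M) \<circ> opp M) (\<lambda>d. a d - s d)"
    unfolding cycles_sum_zero_def face_next_eq[symmetric]
    using assms(3) by (simp add: class_eq_orbit[OF face_next_permutes] map_faces_def)
  ultimately show thesis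
    using euler_inequality_and_exactness(2)[OF finite_arcs ccw_permutes arev_permutes_arcs] that
    by blast
qed

section \<open>Faces of a biconnected plane graph are simple\<close>

lemma sum_marks:
  assumes "finite X" "d \<noteq> d'"
  shows "(\<Sum>e\<in>X. (if e = d then 1 else if e = d' then - 1 else 0 :: int)) =
    (if d \<in> X then 1 else 0) - (if d' \<in> X then 1 else 0)"
proof -
  have "(\<Sum>e\<in>X. (if e = d then 1 else if e = d' then - 1 else 0 :: int)) =
      (\<Sum>e\<in>X. (if e = d then 1 else 0) - (if e = d' then 1 else 0))"
    using assms(2) by (intro sum.cong) auto
  then show ?thesis using assms(1) by (simp add: sum_subtractf)
qed

lemma del_vert_connected:
  "p \<in> verts (skel M) \<Longrightarrow> connected (pre_digraph.del_vert (skel M) p)"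
  using biconn by (simp add: biconnected_def)

text \<open>Otherwise a closed curve through the vertex and the face separates the darts at the vertex;
  its intersection form is closed, and a primitive would be constant on the rest of the graph.\<close>

lemma face_simple:
  assumes "f \<in> map_faces M" "d \<in> f" "d' \<in> f" "src d = src d'"
  shows "d = d'"
proof (rule ccontr)
  assume ne: "d \<noteq> d'"
  have dS: "d \<in> darts" "d' \<in> darts" using assms face_subset by auto
  \<comment> \<open>The curve runs inside \<open>f\<close> between the corners at \<open>d\<close>
    and \<open>d'\<close> and closes up through their common vertex. \<open>?s\<close> counts with
    sign how the rotation crosses it; the curve crosses no edge, hence the second form is 0.\<close>
  let ?s = "\<lambda>e. if e = d then 1 else if e = d' then - 1 else 0 :: int"
  obtain \<Theta> where ccw: "\<And>e. e \<in> darts \<Longrightarrow> \<Theta> (ccw M e) = \<Theta> e + ?s e"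
    and opp: "\<And>e. e \<in> darts \<Longrightarrow> \<Theta> (opp M e) = \<Theta> e + 0"
  proof (rule closed_imp_exact[of ?s "\<lambda>_. 0"])
    show "sum ?s (out_arcs (skel M) v) = 0" if "v \<in> verts (skel M)" for v
      using sum_marks[OF _ ne, of "out_arcs (skel M) v"] dS assms(4)
      by (cases "v = src d") auto
    show "(\<Sum>d\<in>g. 0 - ?s d) = 0" if "g \<in> map_faces M" for g
    proof -
      have "d \<in> g \<longleftrightarrow> d' \<in> g" using face_orbit that assms(1-3) by metis
      then show ?thesis using sum_marks[OF face_finite[OF that] ne] by (simp add: sum_negf)
    qed
  qed auto
  let ?v = "src d"
  \<comment> \<open>\<open>d\<close> and \<open>?e\<close> are separated by the curve, with values
    differing by 1, yet both lead into the graph without \<open>?v\<close>, where \<Theta> has only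
    one value.\<close>
  let ?e = "ccw M d"
  let ?G = "pre_digraph.del_vert (skel M) ?v"
  let ?X = "{w. \<forall>a\<in>out_arcs (skel M) w. \<Theta> a = \<Theta> ?e}"
  have around: "dst a \<in> ?X" if "a \<in> darts" "dst a \<noteq> ?v" "\<Theta> a = \<Theta> ?e" for a
  proof -
    have "\<Theta> b = \<Theta> (opp M a)" if b: "b \<in> out_arcs (skel M) (dst a)" for b
    proof (rule rotation_const[OF _ _ b])
      show "\<Theta> (ccw M c) = \<Theta> c" if c: "c \<in> out_arcs (skel M) (dst a)" for c
        using c \<open>dst a \<noteq> ?v\<close> assms(4) ccw[of c] by auto
    qed (use \<open>a \<in> darts\<close> in auto)
    then show ?thesis using opp[OF \<open>a \<in> darts\<close>] that(3) by simp
  qed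
  have "verts ?G \<subseteq> ?X"
  proof (rule connected_closed_set[of _ "dst ?e"])
    show "connected ?G" using dS by (intro del_vert_connected) simp
    show "dst ?e \<in> verts ?G" using dS no_loop[of ?e] by (auto simp: verts_del_vert)
    show "dst ?e \<in> ?X" using dS no_loop[of ?e] by (intro around) auto
    show "tail ?G a \<in> ?X \<longleftrightarrow> head ?G a \<in> ?X" if "a \<in> arcs ?G" for a
    proof -
      have a: "a \<in> darts" "src a \<noteq> ?v" "dst a \<noteq> ?v" using that by (auto simp: arcs_del_vert)
      have "dst a \<in> ?X" if "src a \<in> ?X" using that a by (intro around) simp_all
      moreover have "src a \<in> ?X" if "dst a \<in> ?X"
      proof -
        have "\<Theta> (opp M a) = \<Theta> ?e" using that a(1) by simp
        then show ?thesis using around[of "opp M a"] a by simp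
      qed
      ultimately show ?thesis unfolding tail_del_vert head_del_vert by blast
    qed
  qed
  moreover have "dst d \<in> verts ?G" using dS no_loop[of d] by (auto simp: verts_del_vert)
  ultimately have "\<Theta> (opp M d) = \<Theta> ?e" using dS by auto
  then show False using opp[of d] ccw[of d] dS by simp
qed

end

section \<open>Subgraphs attached at two poles\<close>

context biconnected_plane
begin

text \<open>A separation at two vertices, expressed by darts and symmetric in \<open>D\<close> and
  its complement. The last condition makes the rotation at each pole switch between the two.\<close>

definition two_pole :: "'d set \<Rightarrow> 'v \<Rightarrow> 'v \<Rightarrow> bool" where
  "two_pole D u v \<longleftrightarrow> D \<subseteq> darts \<and> (\<forall>d\<in>D. opp M d \<in> D) \<and> u \<noteq> v \<and>
    (\<forall>d\<in>D. \<forall>d'\<in>darts - D. src d = src d' \<longrightarrow> src d \<in> {u, v}) \<and>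
    (\<forall>w\<in>{u, v}. (\<exists>d\<in>D. src d = w) \<and> (\<exists>d\<in>darts - D. src d = w))"

text \<open>Any two darts of \<open>X\<close> at \<open>w\<close> can be joined through the graph without rotating around a
  vertex of \<open>Z\<close>.\<close>

definition linked :: "'d set \<Rightarrow> 'v \<Rightarrow> 'v set \<Rightarrow> bool" where
  "linked X w Z \<longleftrightarrow> (\<forall>\<Theta> :: 'd \<Rightarrow> int. (\<forall>d\<in>darts. \<Theta> (opp M d) = \<Theta> d) \<longrightarrow>
    (\<forall>d\<in>darts. src d \<notin> Z \<longrightarrow> \<Theta> (ccw M d) = \<Theta> d) \<longrightarrow>
    (\<forall>d\<in>X. \<forall>d'\<in>X. src d = w \<longrightarrow> src d' = w \<longrightarrow> \<Theta> d = \<Theta> d'))"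

text \<open>With \<open>entries\<close> below, this describes the corners between \<open>D\<close>
  and the rest at \<open>w\<close>. If both kinds of darts occur at \<open>w\<close>, then
  \<open>D\<close> is consecutive there iff there is just one exit.\<close>

definition exits :: "'d set \<Rightarrow> 'v \<Rightarrow> 'd set" where
  "exits D w = {d \<in> D. src d = w \<and> ccw M d \<notin> D}"

definition entries :: "'d set \<Rightarrow> 'v \<Rightarrow> 'd set" where
  "entries D w = {d \<in> darts - D. src d = w \<and> ccw M d \<in> D}"

lemma two_pole_commute: "two_pole D u v \<Longrightarrow> two_pole D v u"
  unfolding two_pole_def by blast

text \<open>Followed once around \<open>w\<close>, the indicator function of \<open>D\<close> falls
  as often as it rises.\<close>

lemma card_exits_entries:
  assumes "D \<subseteq> darts"
  shows "card (exits D w) = card (entries D w)"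
proof -
  let ?A = "out_arcs (skel M) w"
  let ?i = "\<lambda>d. if d \<in> D then 1 else 0 :: int"
  have eq: "?i d - ?i (ccw M d) = (if d \<in> exits D w then 1 else 0) - (if d \<in> entries D w then 1 else 0)"
    if "d \<in> ?A" for d
    using that by (auto simp: exits_def entries_def)
  have "(\<Sum>d\<in>?A. ?i (ccw M d)) = sum ?i ?A"
    by (rule sum_closed_permutes[OF ccw_permutes]) auto
  then have "(\<Sum>d\<in>?A. ?i d - ?i (ccw M d)) = 0" by (simp add: sum_subtractf)
  then have "(\<Sum>d\<in>?A. (if d \<in> exits D w then 1 else 0 :: int) - (if d \<in> entries D w then 1 else 0)) = 0"
    using sum.cong[OF refl eq, of ?A] by simp
  moreover have "exits D w \<subseteq> ?A" "entries D w \<subseteq> ?A"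
    using assms by (auto simp: exits_def entries_def)
  moreover have "(\<Sum>d\<in>?A. if d \<in> X then 1 else 0 :: int) = int (card X)" if "X \<subseteq> ?A" for X
    using that by (subst sum.inter_restrict[symmetric]) (auto simp: Int_absorb1)
  ultimately show ?thesis by (simp add: sum_subtractf)
qed

lemma exits_nonempty:
  assumes "D \<subseteq> darts" "d \<in> D" "src d = w" "d' \<in> darts - D" "src d' = w"
  shows "exits D w \<noteq> {}"
proof
  assume none: "exits D w = {}"
  have "{d \<in> D. src d = w} = out_arcs (skel M) w"
  proof (rule rotation_closed_eq)
    show "ccw M e \<in> {d \<in> D. src d = w}" if "e \<in> {d \<in> D. src d = w}" for e
      using that none assms(1) by (auto simp: exits_def)
  qed (use assms in auto)
  then show False using assms(4,5) by auto
qed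

text \<open>The face of an exit comes from outside, because \<open>ccw M d\<close> is the reverse of
  the dart before \<open>d\<close>. Its boundary must leave \<open>D\<close> again, which is
  possible only at a pole, and not at \<open>u\<close>, since a simple face has only one dart
  starting there. The dart with which it leaves is followed in the rotation by the reverse of the
  last inside dart, so it is an entry.\<close>

lemma face_traverses:
  assumes D: "two_pole D u v" and d: "d \<in> exits D u"
  shows "\<exists>x\<in>entries D v. x \<in> orbit (face_next M) d"
proof -
  let ?f = "orbit (face_next M) d"
  have dS: "d \<in> D" "d \<in> darts" "src d = u" "ccw M d \<notin> D" and opp: "\<And>d. d \<in> D \<Longrightarrow> opp M d \<in> D"
    using D d by (auto simp: two_pole_def exits_def)
  have f: "?f \<in> map_faces M" using dS by (auto simp: map_faces_def)
  obtain y where y: "face_next M y = d"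
    using permutes_surj[OF face_next_permutes] by (metis surjD)
  have yf: "y \<in> ?f" using face_next_face_iff[OF f] y self_in_face by metis
  have "y \<notin> D" using opp[of y] ccw_face_next[of y] y dS by metis
  have "\<exists>e\<in>?f \<inter> D. face_next M e \<notin> D"
  proof (rule ccontr)
    assume "\<not> (\<exists>e\<in>?f \<inter> D. face_next M e \<notin> D)"
    then have "?f \<inter> D = ?f"
      using dS self_in_face face_next_face[OF f] by (intro face_closed_eq[OF f]) auto
    then show False using yf \<open>y \<notin> D\<close> by blast
  qed
  then obtain e where e: "e \<in> ?f" "e \<in> D" "face_next M e \<notin> D" by blast
  let ?x = "face_next M e"
  have x: "?x \<in> ?f" "?x \<in> darts" using e face_next_face[OF f] face_subset[OF f] by auto
  have "e \<in> darts" using x by simp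
  then have "src (opp M e) = src ?x" by simp
  then have "src ?x \<in> {u, v}" using D opp[OF e(2)] x e(3) unfolding two_pole_def by (metis DiffI)
  moreover have "src ?x \<noteq> u"
    using face_simple[OF f x(1) self_in_face] dS e(3) by metis
  ultimately have "?x \<in> entries D v" using x e opp[OF e(2)] by (simp add: entries_def)
  then show ?thesis using x by blast
qed

text \<open>An entry determines its face, and a simple face has only one dart starting at
  \<open>u\<close>; so different exits reach different entries.\<close>

lemma face_entry_choice:
  assumes "two_pole D u v"
  obtains g where "\<And>d. d \<in> exits D u \<Longrightarrow> g d \<in> entries D v"
    and "\<And>d. d \<in> exits D u \<Longrightarrow> g d \<in> orbit (face_next M) d"
    and "inj_on g (exits D u)"
proof -
  define g where "g d = (SOME x. x \<in> entries D v \<and> x \<in> orbit (face_next M) d)" for d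
  have g: "g d \<in> entries D v" "g d \<in> orbit (face_next M) d" if "d \<in> exits D u" for d
    using someI_ex[of "\<lambda>x. x \<in> entries D v \<and> x \<in> orbit (face_next M) d"]
      face_traverses[OF assms that] unfolding g_def by blast+
  have "inj_on g (exits D u)"
  proof (rule inj_onI)
    fix d d' assume d: "d \<in> exits D u" "d' \<in> exits D u" "g d = g d'"
    have S: "d \<in> darts" "d' \<in> darts" "src d = src d'"
      using d assms by (auto simp: exits_def two_pole_def)
    then have f: "orbit (face_next M) d \<in> map_faces M" "orbit (face_next M) d' \<in> map_faces M"
      by (auto simp: map_faces_def)
    have "orbit (face_next M) d = orbit (face_next M) d'"
      using face_orbit[OF f(1) g(2)[OF d(1)]] face_orbit[OF f(2) g(2)[OF d(2)]] d(3) by simp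
    then show "d = d'" using face_simple[OF f(1) self_in_face _ S(3)] self_in_face by metis
  qed
  then show thesis using that g by blast
qed

lemma finite_entries: "finite (entries D w)"
  by (auto simp: entries_def intro: finite_subset[OF _ finite_arcs])

lemma card_exits_le:
  assumes "two_pole D u v"
  shows "card (exits D u) \<le> card (exits D v)"
proof -
  obtain g where "\<And>d. d \<in> exits D u \<Longrightarrow> g d \<in> entries D v" "inj_on g (exits D u)"
    using face_entry_choice[OF assms] by metis
  then have "card (exits D u) \<le> card (entries D v)"
    by (intro card_inj_on_le[of g] finite_entries) auto
  then show ?thesis using card_exits_entries[of D v] assms by (simp add: two_pole_def)
qed

text \<open>Two exits at the same pole would yield a closed curve through the two faces and the two
  poles; the primitive of its intersection form distinguishes the two exits, and likewise the two
  darts following them.\<close>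

lemma exit_unique:
  assumes D: "two_pole D u v"
    and lk: "linked D u {u, v} \<or> linked (darts - D) u {u, v}"
    and d: "d1 \<in> exits D u" "d3 \<in> exits D u"
  shows "d1 = d3"
proof (rule ccontr)
  assume ne: "d1 \<noteq> d3"
  obtain g where g: "\<And>d. d \<in> exits D u \<Longrightarrow> g d \<in> entries D v"
    "\<And>d. d \<in> exits D u \<Longrightarrow> g d \<in> orbit (face_next M) d" "inj_on g (exits D u)"
    using face_entry_choice[OF D] by metis
  define x1 x3 where "x1 = g d1" and "x3 = g d3"
  have xne: "x3 \<noteq> x1" using g(3) d ne by (auto simp: x1_def x3_def dest: inj_onD)
  have uv: "u \<noteq> v" using D by (simp add: two_pole_def)
  have S: "d1 \<in> darts" "d3 \<in> darts" "src d1 = u" "src d3 = u" "d1 \<in> D" "d3 \<in> D"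
    "ccw M d1 \<in> darts - D" "ccw M d3 \<in> darts - D"
    using d D by (auto simp: exits_def two_pole_def)
  have X: "x1 \<in> darts" "x3 \<in> darts" "src x1 = v" "src x3 = v"
    using g(1)[OF d(1)] g(1)[OF d(2)] by (auto simp: entries_def x1_def x3_def)
  let ?m = "\<lambda>d d' e. if e = d then 1 else if e = d' then - 1 else 0 :: int"
  \<comment> \<open>The signs at \<open>v\<close> are reversed so that the marks cancel on the face
    shared by \<open>d1\<close> and \<open>x1\<close> and on the face shared by \<open>d3\<close>
    and \<open>x3\<close>.\<close>
  let ?s = "\<lambda>e. ?m d1 d3 e + ?m x3 x1 e"
  obtain \<Theta> where ccw: "\<And>e. e \<in> darts \<Longrightarrow> \<Theta> (ccw M e) = \<Theta> e + ?s e"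
    and opp: "\<And>e. e \<in> darts \<Longrightarrow> \<Theta> (opp M e) = \<Theta> e + 0"
  proof (rule closed_imp_exact[of ?s "\<lambda>_. 0"])
    show "sum ?s (out_arcs (skel M) w) = 0" for w
      using S X sum_marks[OF finite_out_arcs ne, of w] sum_marks[OF finite_out_arcs xne, of w]
      by (simp add: sum.distrib)
    show "(\<Sum>e\<in>f. 0 - ?s e) = 0" if f: "f \<in> map_faces M" for f
    proof -
      have iff: "e \<in> f \<longleftrightarrow> g e \<in> f" if "e \<in> exits D u" for e
      proof -
        have "orbit (face_next M) e \<in> map_faces M"
          using that D by (auto simp: exits_def two_pole_def map_faces_def)
        then have "orbit (face_next M) (g e) = orbit (face_next M) e"
          using g(2)[OF that] by (rule face_orbit)
        then show ?thesis using face_orbit[OF f] self_in_face by metis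
      qed
      have "(\<Sum>e\<in>f. 0 - ?s e) = - (sum (?m d1 d3) f + sum (?m x3 x1) f)"
        by (simp only: diff_0 sum_negf sum.distrib)
      then show ?thesis
        using sum_marks[OF face_finite[OF f] ne] sum_marks[OF face_finite[OF f] xne]
          iff[OF d(1)] iff[OF d(2)] by (simp add: x1_def x3_def)
    qed
  qed auto
  have notx: "e \<noteq> x1 \<and> e \<noteq> x3" if "src e = u" for e using that X uv by auto
  have t1: "\<Theta> (ccw M d1) = \<Theta> d1 + 1" using ccw[OF S(1)] ne notx[OF S(3)] by simp
  have t3: "\<Theta> (ccw M d3) = \<Theta> d3 - 1" using ccw[OF S(2)] ne notx[OF S(4)] by simp
  \<comment> \<open>Rotating from \<open>ccw M d1\<close>, the value \<Theta> d1 + 1 can change only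
    at \<open>d1\<close>, which does not have it, or at \<open>d3\<close>. If \<open>d3\<close> did
    not have it either, it would persist all the way round to \<open>d1\<close>.\<close>
  have d3: "\<Theta> d3 = \<Theta> d1 + 1"
  proof (rule ccontr)
    assume no: "\<Theta> d3 \<noteq> \<Theta> d1 + 1"
    let ?P = "{e \<in> out_arcs (skel M) u. \<Theta> e = \<Theta> d1 + 1}"
    have "?P = out_arcs (skel M) u"
    proof (rule rotation_closed_eq)
      have "src (ccw M d1) = u" using S by simp
      then have "ccw M d1 \<in> ?P" using t1 S by simp
      then show "?P \<noteq> {}" by blast
      show "ccw M e \<in> ?P" if e: "e \<in> ?P" for e
      proof -
        have "e \<noteq> d1" "e \<noteq> d3" using e no by auto
        then show ?thesis using e ccw[of e] notx[of e] by simp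
      qed
    qed auto
    then have "d1 \<in> ?P" using S by simp
    then show False by simp
  qed
  have inv: "\<forall>d\<in>darts. \<Theta> (opp M d) = \<Theta> d" "\<forall>d\<in>darts. src d \<notin> {u, v} \<longrightarrow> \<Theta> (ccw M d) = \<Theta> d"
    using opp ccw S X by auto
  \<comment> \<open>The two exits differ in \<Theta>, and so do the darts following them: a link on
    either side is contradictory.\<close>
  show False
    using lk
  proof
    assume "linked D u {u, v}"
    then have "\<Theta> d1 = \<Theta> d3" using inv S unfolding linked_def by blast
    then show False using d3 by simp
  next
    assume "linked (darts - D) u {u, v}"
    moreover have "src (ccw M d1) = u" "src (ccw M d3) = u" using S by auto
    ultimately have "\<Theta> (ccw M d1) = \<Theta> (ccw M d3)" using inv S unfolding linked_def by blast
    then show False using d3 t1 t3 by simp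
  qed
qed

text \<open>One of the four combinations of a side and a pole suffices: by
  \<open>card_exits_le\<close> in both directions, the poles have equally many exits.\<close>

definition weakly_linked :: "'d set \<Rightarrow> 'v \<Rightarrow> 'v \<Rightarrow> bool" where
  "weakly_linked D u v \<longleftrightarrow> (\<exists>X\<in>{D, darts - D}. \<exists>w\<in>{u, v}. linked X w {u, v})"

lemma contiguous:
  assumes D: "two_pole D u v" and lk: "weakly_linked D u v"
  obtains du xu dv xv where "exits D u = {du}" "entries D u = {xu}" "exits D v = {dv}" "entries D v = {xv}"
    "xv \<in> orbit (face_next M) du" "xu \<in> orbit (face_next M) dv"
proof -
  have sub: "D \<subseteq> darts" using D by (simp add: two_pole_def)
  have ne: "exits D w \<noteq> {}" if "w \<in> {u, v}" for w
    using D that exits_nonempty[OF sub] unfolding two_pole_def by metis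
  have D': "two_pole D v u" using D by (rule two_pole_commute)
  have one: "card (exits D w) = 1"
    if "two_pole D w w'" "linked D w {w, w'} \<or> linked (darts - D) w {w, w'}" "w \<in> {u, v}" for w w'
    using exit_unique[OF that(1,2)] ne[OF that(3)] by (metis is_singletonI' is_singleton_altdef)
  have "card (exits D u) = 1 \<or> card (exits D v) = 1"
    using lk one[OF D] one[OF D'] insert_commute[of u v "{}"] unfolding weakly_linked_def by auto
  then have u: "card (exits D u) = 1" and v: "card (exits D v) = 1"
    using card_exits_le[OF D] card_exits_le[OF D'] by auto
  then have "card (entries D u) = 1" "card (entries D v) = 1" using card_exits_entries[OF sub] by auto
  with u v obtain du xu dv xv where "exits D u = {du}" "entries D u = {xu}" "exits D v = {dv}" "entries D v = {xv}"
    by (auto simp: card_1_singleton_iff)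
  then show thesis using that face_traverses[OF D, of du] face_traverses[OF D', of dv] by auto
qed

text \<open>Where the boundary passes into \<open>D\<close>, the first inside dart is followed in
  the rotation by the reverse of the outside dart just traversed. With one exit per pole, at most
  two faces are therefore mixed.\<close>

lemma mixed_face_exit:
  assumes D: "two_pole D u v" and f: "f \<in> map_faces M" "f \<inter> D \<noteq> {}" "\<not> f \<subseteq> D"
  shows "\<exists>d\<in>f. d \<in> exits D u \<union> exits D v"
proof -
  have opp: "\<And>d. d \<in> D \<Longrightarrow> opp M d \<in> D" using D by (auto simp: two_pole_def)
  have "\<exists>e\<in>f - D. face_next M e \<in> D"
  proof (rule ccontr)
    assume "\<not> (\<exists>e\<in>f - D. face_next M e \<in> D)"
    then have "f - D = f"
      using f face_next_face[OF f(1)] by (intro face_closed_eq[OF f(1)]) auto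
    then show False using f by blast
  qed
  then obtain e where e: "e \<in> f" "e \<notin> D" "face_next M e \<in> D" by blast
  have eS: "e \<in> darts" using e face_subset[OF f(1)] by blast
  have o: "opp M e \<notin> D" using opp[of "opp M e"] e by auto
  have "src (opp M e) = src (face_next M e)" using eS by simp
  then have "src (face_next M e) \<in> {u, v}"
    using D e o eS unfolding two_pole_def by (metis DiffI arev_in_arcs)
  then have "face_next M e \<in> exits D u \<union> exits D v" using e o by (auto simp: exits_def)
  then show ?thesis using face_next_face[OF f(1) e(1)] by blast
qed

text \<open>From every dart of \<open>D\<close> at \<open>p\<close> one reaches \<open>q\<close>
  inside \<open>D\<close> without returning to \<open>p\<close>; otherwise \<open>p\<close> would
  separate \<open>q\<close> from the vertices reached. So all these darts are joined via
  \<open>q\<close>, and \<open>z\<close> is never met.\<close>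

lemma two_pole_linked:
  assumes D: "two_pole D p q" and z: "\<And>d. d \<in> D \<Longrightarrow> src d \<noteq> z"
  shows "linked D p {p, z}"
  unfolding linked_def
proof (intro allI impI ballI)
  fix \<Theta> :: "'d \<Rightarrow> int" and d d'
  assume opp: "\<forall>d\<in>darts. \<Theta> (opp M d) = \<Theta> d"
    and ccw: "\<forall>d\<in>darts. src d \<notin> {p, z} \<longrightarrow> \<Theta> (ccw M d) = \<Theta> d"
    and dd: "d \<in> D" "d' \<in> D" "src d = p" "src d' = p"
  have sub: "D \<subseteq> darts" and opD: "\<And>d. d \<in> D \<Longrightarrow> opp M d \<in> D" and pq: "p \<noteq> q"
    using D by (auto simp: two_pole_def)
  obtain r where r: "r \<in> D" "src r = q" using D unfolding two_pole_def by blast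
  have qz: "q \<noteq> z" using z r by auto
  let ?G = "pre_digraph.del_vert (skel M) p"
  have "\<Theta> d = \<Theta> r" if d: "d \<in> D" "src d = p" for d
  proof (rule ccontr)
    assume ne: "\<Theta> d \<noteq> \<Theta> r"
    have dS: "d \<in> darts" using d sub by blast
    \<comment> \<open>These are vertices of \<open>D\<close> reached while \<Theta> keeps its value
      at \<open>d\<close>. Not being poles, they have no outside darts, so the set is closed in the
      graph without \<open>p\<close> although it misses \<open>q\<close>.\<close>
    let ?X = "{w. w \<noteq> p \<and> w \<noteq> q \<and> (\<exists>e\<in>D. src e = w) \<and> (\<forall>e\<in>out_arcs (skel M) w. \<Theta> e = \<Theta> d)}"
    have around: "dst a \<in> ?X" if a: "a \<in> D" "dst a \<noteq> p" "\<Theta> a = \<Theta> d" for a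
    proof -
      have aS: "a \<in> darts" using a sub by blast
      have oD: "opp M a \<in> D" "src (opp M a) = dst a" using opD a aS by auto
      have c: "\<Theta> b = \<Theta> d" if b: "b \<in> out_arcs (skel M) (dst a)" for b
      proof -
        have "\<Theta> b = \<Theta> (opp M a)"
        proof (rule rotation_const[OF _ _ b])
          have "dst a \<noteq> z" using z oD by metis
          then show "\<Theta> (ccw M c) = \<Theta> c" if "c \<in> out_arcs (skel M) (dst a)" for c
            using that ccw a(2) by auto
        qed (use aS in auto)
        then show ?thesis using opp aS a(3) by simp
      qed
      have "dst a \<noteq> q" using c[of r] r sub ne by auto
      then show ?thesis using a(2) oD c by blast
    qed
    have XD: "a \<in> D \<and> \<Theta> a = \<Theta> d" if a: "a \<in> darts" "src a \<in> ?X" for a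
    proof -
      obtain e where e: "e \<in> D" "src e = src a" using a(2) by blast
      have "src e \<notin> {p, q}" using a(2) e(2) by auto
      then have "a \<in> D" using D a(1) e unfolding two_pole_def by blast
      moreover have "a \<in> out_arcs (skel M) (src a)" using a(1) by simp
      ultimately show ?thesis using a(2) by blast
    qed
    have "verts ?G \<subseteq> ?X"
    proof (rule connected_closed_set[of _ "dst d"])
      show "connected ?G" using dS d by (intro del_vert_connected) auto
      have "dst d \<noteq> p" using no_loop[OF dS] d by auto
      then show "dst d \<in> verts ?G" "dst d \<in> ?X"
        using around[OF d(1)] dS by (simp_all add: verts_del_vert)
      show "tail ?G a \<in> ?X \<longleftrightarrow> head ?G a \<in> ?X" if "a \<in> arcs ?G" for a
      proof -
        have a: "a \<in> darts" "src a \<noteq> p" "dst a \<noteq> p" using that by (auto simp: arcs_del_vert)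
        have "dst a \<in> ?X" if "src a \<in> ?X" using XD[OF a(1) that] a(3) around by blast
        moreover have "src a \<in> ?X" if "dst a \<in> ?X"
          using XD[of "opp M a"] that a around[of "opp M a"] by simp
        ultimately show ?thesis unfolding tail_del_vert head_del_vert by blast
      qed
    qed
    moreover have "q \<in> verts ?G" using r sub pq by (auto simp: verts_del_vert)
    ultimately show False by blast
  qed
  then show "\<Theta> d = \<Theta> d'" using dd by metis
qed

end

section \<open>Nodes of SPQ*-trees\<close>

lemma node_edges_simps [simp]:
  "node_edges M (SNode ts) = (\<Union>t\<in>set ts. node_edges M t)"
  "node_edges M (PNode ts) = (\<Union>t\<in>set ts. node_edges M t)"
  by (auto simp: node_edges_def sym_darts_def)

lemma (in wf_digraph) apath_unique_at_source:
  assumes "apath u p v" "p \<noteq> []"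
  shows "d \<in> set p \<Longrightarrow> tail G d = u \<Longrightarrow> d = hd p" and "d \<in> set p \<Longrightarrow> head G d \<noteq> u"
proof -
  obtain h p' where p: "p = h # p'" using assms(2) by (cases p) auto
  then have h: "tail G h = u" "apath (head G h) p' v" "u \<notin> set (awalk_verts (head G h) p')"
    using assms(1) by (auto simp: apath_Cons_iff)
  then have "set (awalk_verts (head G h) p') = {head G h} \<union> set (map (tail G) p') \<union> set (map (head G) p')"
    using set_awalk_verts unfolding apath_def by blast
  then have notin: "u \<noteq> head G h" "\<And>d. d \<in> set p' \<Longrightarrow> tail G d \<noteq> u \<and> head G d \<noteq> u" using h(3) by auto
  show "d \<in> set p \<Longrightarrow> tail G d = u \<Longrightarrow> d = hd p" using p notin by auto
  show "d \<in> set p \<Longrightarrow> head G d \<noteq> u" using p notin by auto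
qed

lemma (in wf_digraph) represents_darts:
  assumes "skel M = G" "represents M t" "d \<in> node_darts t"
  shows "d \<in> arcs G \<and> tail G d \<noteq> head G d"
  using assms(2,3)
proof (induction t)
  case (QStar p)
  then have p: "apath (tail G (hd p)) p (head G (last p))" using assms(1) by auto
  then have "set p \<subseteq> arcs G" by (auto simp: apath_def awalk_def)
  then show ?case using no_loops_in_apath[OF p, of d] QStar.prems by auto
qed auto

lemma spq_tree_biconnected_plane:
  assumes "plane_graph M" "biconnected M" "spq_tree M e T"
  shows "biconnected_plane M"
proof -
  interpret fin_digraph "skel M" using assms(1) by (simp add: plane_graph_def)
  interpret bidirected_digraph "skel M" "opp M" using assms(1) by (simp add: plane_graph_def)
  have T: "represents M T" "arcs (skel M) = node_edges M T" "verts (skel M) = node_verts M T"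
    using assms(3) by (auto simp: spq_tree_def)
  have darts: "d \<in> arcs (skel M) \<and> tail (skel M) d \<noteq> head (skel M) d" if "d \<in> node_darts T" for d
    using represents_darts[OF refl T(1) that] .
  show ?thesis
  proof
    show "tail (skel M) d \<noteq> head (skel M) d" if "d \<in> arcs (skel M)" for d
    proof -
      have "d \<in> node_darts T \<or> (\<exists>b\<in>node_darts T. d = opp M b)"
        using that unfolding T(2) node_edges_def sym_darts_def by blast
      then show ?thesis using darts head_arev tail_arev by metis
    qed
    show "out_arcs (skel M) v \<noteq> {}" if v: "v \<in> verts (skel M)" for v
    proof -
      obtain d where d: "d \<in> node_darts T" "v = tail (skel M) d \<or> v = head (skel M) d"
        using v unfolding T(3) node_verts_def dart_verts_def by auto
      then have "d \<in> out_arcs (skel M) v \<or> opp M d \<in> out_arcs (skel M) v" using darts by auto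
      then show ?thesis by blast
    qed
  qed (use assms in auto)
qed

context biconnected_plane
begin

section \<open>Vertices, poles and paths of a node\<close>

lemma node_edges_subset: "represents M t \<Longrightarrow> node_edges M t \<subseteq> darts"
  using represents_darts[OF refl] by (auto simp: node_edges_def sym_darts_def)

lemma opp_node_edges: "d \<in> node_edges M t \<Longrightarrow> opp M d \<in> node_edges M t"
  by (auto simp: node_edges_def sym_darts_def)

lemma node_verts_eq: "represents M t \<Longrightarrow> node_verts M t = src ` node_edges M t"
proof -
  assume "represents M t"
  then have "d \<in> darts" if "d \<in> node_darts t" for d using that represents_darts[OF refl] by blast
  then have "dst ` node_darts t = src ` opp M ` node_darts t" by (force simp: image_image)
  then show ?thesis
    by (simp add: node_verts_def dart_verts_def node_edges_def sym_darts_def image_Un)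
qed

text \<open>If the poles of a series node coincided, this vertex would lie in the first and in the
  last child, hence be the sink of the first child as well as its source.\<close>

lemma represents_poles:
  "represents M t \<Longrightarrow> source M t \<in> node_verts M t \<and> sink M t \<in> node_verts M t \<and> source M t \<noteq> sink M t"
proof (induction t)
  case (QStar p)
  then show ?case using apath_nonempty_ends by (auto simp: node_verts_def dart_verts_def)
next
  case (SNode ts)
  let ?n = "length ts"
  have r: "2 \<le> ?n" "\<And>t. t \<in> set ts \<Longrightarrow> represents M t"
    and dis: "\<And>i j. i < j \<Longrightarrow> j < ?n \<Longrightarrow> node_verts M (ts ! i) \<inter> node_verts M (ts ! j) =
          (if j = Suc i then {sink M (ts ! i)} else {})"
    using SNode.prems by auto
  have ne: "ts \<noteq> []" using r(1) by auto
  have eq: "source M (SNode ts) = source M (ts ! 0)" "sink M (SNode ts) = sink M (ts ! (?n - 1))"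
    using ne by (simp_all add: hd_map last_map hd_conv_nth last_conv_nth)
  have IH: "source M (ts ! i) \<in> node_verts M (ts ! i)" "sink M (ts ! i) \<in> node_verts M (ts ! i)"
    "source M (ts ! i) \<noteq> sink M (ts ! i)" if "i < ?n" for i
    using SNode.IH[of "ts ! i"] r(2) that by auto
  have sub: "node_verts M (ts ! i) \<subseteq> node_verts M (SNode ts)" if "i < ?n" for i
    using that by (force simp: node_verts_def dart_verts_def)
  have l: "0 < ?n" "?n - 1 < ?n" "0 < ?n - 1" using r(1) by auto
  have "source M (ts ! 0) \<noteq> sink M (ts ! (?n - 1))"
  proof
    assume "source M (ts ! 0) = sink M (ts ! (?n - 1))"
    then have "source M (ts ! 0) \<in> node_verts M (ts ! 0) \<inter> node_verts M (ts ! (?n - 1))"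
      using IH(1)[OF l(1)] IH(2)[OF l(2)] by simp
    then have "source M (ts ! 0) = sink M (ts ! 0)"
      unfolding dis[OF l(3,2)] by (simp split: if_splits)
    then show False using IH(3)[OF l(1)] by simp
  qed
  then show ?case using IH(1)[OF l(1)] IH(2)[OF l(2)] sub[OF l(1)] sub[OF l(2)] eq by auto
next
  case (PNode ts)
  have ne: "ts \<noteq> []" and r: "2 \<le> length ts" using PNode.prems by auto
  then have eq: "source M (PNode ts) = source M (ts ! 0)" "sink M (PNode ts) = sink M (ts ! (length ts - 1))"
    by (simp_all add: hd_map last_map hd_conv_nth last_conv_nth)
  moreover have "sink M (ts ! 0) = sink M (ts ! (length ts - 1))"
    using PNode.prems r by auto
  moreover have "represents M (ts ! 0)" "ts ! 0 \<in> set ts" using PNode.prems ne by auto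
  moreover have "node_verts M (ts ! 0) \<subseteq> node_verts M (PNode ts)"
    using ne by (force simp: node_verts_def dart_verts_def)
  ultimately show ?case using PNode.IH[of "ts ! 0"] by auto
qed

text \<open>Ensures that the \<open>SOME\<close> in \<open>spirality\<close> denotes a path. In the
  series case walks are concatenated and shortened afterwards, which spares an argument on
  disjointness.\<close>

lemma represents_path:
  "represents M t \<Longrightarrow> \<exists>p. apath (source M t) p (sink M t) \<and> set p \<subseteq> node_edges M t"
proof (induction t)
  case (QStar p)
  then show ?case by (auto simp: node_edges_def sym_darts_def)
next
  case (SNode ts)
  have r: "2 \<le> length ts" "\<And>t. t \<in> set ts \<Longrightarrow> represents M t"
    and link: "\<And>i. Suc i < length ts \<Longrightarrow> sink M (ts ! i) = source M (ts ! Suc i)"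
    using SNode.prems by auto
  have "\<exists>p. awalk (source M (ts ! 0)) p (sink M (ts ! i)) \<and> set p \<subseteq> node_edges M (SNode ts)"
    if "i < length ts" for i
    using that
  proof (induction i)
    case 0
    then show ?case using SNode.IH[of "ts ! 0"] r(2)[of "ts ! 0"] by (force simp: apath_def)
  next
    case (Suc i)
    then obtain p where p: "awalk (source M (ts ! 0)) p (sink M (ts ! i))" "set p \<subseteq> node_edges M (SNode ts)"
      by auto
    have "ts ! Suc i \<in> set ts" using Suc.prems by simp
    then obtain q where q: "awalk (source M (ts ! Suc i)) q (sink M (ts ! Suc i))"
      "set q \<subseteq> node_edges M (ts ! Suc i)"
      using SNode.IH[of "ts ! Suc i"] r(2)[of "ts ! Suc i"] by (auto simp: apath_def)
    have "awalk (source M (ts ! 0)) (p @ q) (sink M (ts ! Suc i))"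
      using awalk_appendI[OF p(1)] q(1) link[of i] Suc.prems by simp
    moreover have "set (p @ q) \<subseteq> node_edges M (SNode ts)"
      using p(2) q(2) \<open>ts ! Suc i \<in> set ts\<close> by auto
    ultimately show ?case by blast
  qed
  moreover have "length ts - 1 < length ts" using r(1) by simp
  ultimately obtain p where
    p: "awalk (source M (ts ! 0)) p (sink M (ts ! (length ts - 1)))" "set p \<subseteq> node_edges M (SNode ts)"
    by blast
  have "ts \<noteq> []" using r(1) by auto
  then have "source M (SNode ts) = source M (ts ! 0)" "sink M (SNode ts) = sink M (ts ! (length ts - 1))"
    by (simp_all add: hd_map last_map hd_conv_nth last_conv_nth)
  then show ?case using apath_awalk_to_apath[OF p(1)] awalk_to_apath_subset[OF p(1)] p(2)
    by (metis subset_trans)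
next
  case (PNode ts)
  have ne: "ts \<noteq> []" and r: "2 \<le> length ts" using PNode.prems by auto
  then have eq: "source M (PNode ts) = source M (ts ! 0)" "sink M (PNode ts) = sink M (ts ! (length ts - 1))"
    by (simp_all add: hd_map last_map hd_conv_nth last_conv_nth)
  moreover have "sink M (ts ! 0) = sink M (ts ! (length ts - 1))"
    using PNode.prems r by auto
  moreover have t0: "represents M (ts ! 0)" "ts ! 0 \<in> set ts" using PNode.prems ne by auto
  moreover obtain p where "apath (source M (ts ! 0)) p (sink M (ts ! 0))" "set p \<subseteq> node_edges M (ts ! 0)"
    using PNode.IH[of "ts ! 0"] t0 by blast
  ultimately have "apath (source M (PNode ts)) p (sink M (PNode ts)) \<and> set p \<subseteq> node_edges M (PNode ts)"
    by auto
  then show ?case by blast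
qed

section \<open>Attachment and linking of the nodes of the tree\<close>

abbreviation attached :: "'d spq \<Rightarrow> bool" where
  "attached t \<equiv> two_pole (node_edges M t) (source M t) (sink M t)"

abbreviation node_linked :: "'d spq \<Rightarrow> bool" where
  "node_linked t \<equiv> weakly_linked (node_edges M t) (source M t) (sink M t)"

lemma attachedI:
  assumes t: "represents M t"
    and "\<And>d. d \<in> darts \<Longrightarrow> d \<notin> node_edges M t \<Longrightarrow> src d \<in> node_verts M t \<Longrightarrow>
      src d = source M t \<or> src d = sink M t"
    and "\<exists>d\<in>darts - node_edges M t. src d = source M t"
    and "\<exists>d\<in>darts - node_edges M t. src d = sink M t"
  shows "attached t"
proof -
  have "source M t \<in> src ` node_edges M t" "sink M t \<in> src ` node_edges M t" "source M t \<noteq> sink M t"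
    using represents_poles[OF t] node_verts_eq[OF t] by auto
  then have "\<exists>d\<in>node_edges M t. src d = source M t" "\<exists>d\<in>node_edges M t. src d = sink M t"
    and ne: "source M t \<noteq> sink M t" by (auto simp: image_iff)
  moreover have "src d \<in> {source M t, sink M t}"
    if "d \<in> node_edges M t" "d' \<in> darts - node_edges M t" "src d = src d'" for d d'
  proof -
    have "src d' \<in> node_verts M t" unfolding node_verts_eq[OF t] using that(1,3) by (metis imageI)
    then show ?thesis using that assms(2)[of d'] by auto
  qed
  ultimately show ?thesis
    unfolding two_pole_def using assms(3,4) node_edges_subset[OF t] opp_node_edges by blast
qed

lemma attached_pole:
  assumes "attached t" "represents M t" "d \<in> darts" "d \<notin> node_edges M t" "src d \<in> node_verts M t"
  shows "src d = source M t \<or> src d = sink M t"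
proof -
  obtain x where "x \<in> node_edges M t" "src x = src d"
    using assms(5) by (auto simp: node_verts_eq[OF assms(2)])
  then show ?thesis using assms(1,3,4) unfolding two_pole_def by (metis DiffI empty_iff insertE)
qed

lemma attached_outside:
  assumes "attached t"
  shows "\<exists>d\<in>darts - node_edges M t. src d = source M t"
    and "\<exists>d\<in>darts - node_edges M t. src d = sink M t"
  using assms unfolding two_pole_def by auto

text \<open>A simple path has just one dart at its source, so there is nothing to join.\<close>

lemma qstar_linked_source:
  assumes "represents M (QStar p)"
  shows "linked (node_edges M (QStar p)) (source M (QStar p)) Z"
proof -
  have p: "apath (src (hd p)) p (dst (last p))" "p \<noteq> []" using assms by auto
  have "d = hd p" if d: "d \<in> node_edges M (QStar p)" "src d = src (hd p)" for d
  proof (cases "d \<in> set p")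
    case True
    then show ?thesis using apath_unique_at_source(1)[OF p] d by blast
  next
    case False
    then obtain b where b: "b \<in> set p" "d = opp M b" using d by (auto simp: node_edges_def sym_darts_def)
    then have "b \<in> darts" using p(1) by (auto simp: apath_def)
    then show ?thesis using apath_unique_at_source(2)[OF p b(1)] b d by simp
  qed
  then show ?thesis unfolding linked_def by auto
qed

lemma qstar_linked: "represents M (QStar p) \<Longrightarrow> node_linked (QStar p)"
  unfolding weakly_linked_def using qstar_linked_source by blast

lemma series_facts:
  assumes "represents M (SNode ts)"
  shows "2 \<le> length ts"
    and "\<And>i. i < length ts \<Longrightarrow> represents M (ts ! i)"
    and "\<And>i. Suc i < length ts \<Longrightarrow> sink M (ts ! i) = source M (ts ! Suc i)"
    and "\<And>i j w. i < j \<Longrightarrow> j < length ts \<Longrightarrow> w \<in> node_verts M (ts ! i) \<Longrightarrow> w \<in> node_verts M (ts ! j) \<Longrightarrow>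
      j = Suc i \<and> w = sink M (ts ! i)"
    and "source M (SNode ts) = source M (ts ! 0)"
    and "sink M (SNode ts) = sink M (ts ! (length ts - 1))"
proof -
  show "2 \<le> length ts" and "\<And>i. i < length ts \<Longrightarrow> represents M (ts ! i)"
    and "\<And>i. Suc i < length ts \<Longrightarrow> sink M (ts ! i) = source M (ts ! Suc i)"
    using assms by auto
  show "j = Suc i \<and> w = sink M (ts ! i)"
    if "i < j" "j < length ts" "w \<in> node_verts M (ts ! i)" "w \<in> node_verts M (ts ! j)" for i j w
  proof -
    have "node_verts M (ts ! i) \<inter> node_verts M (ts ! j) = (if j = Suc i then {sink M (ts ! i)} else {})"
      using assms that(1,2) unfolding represents.simps by blast
    then have "w \<in> (if j = Suc i then {sink M (ts ! i)} else {})" using that by blast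
    then show ?thesis by (auto split: if_splits)
  qed
  have "ts \<noteq> []" using assms by auto
  then show "source M (SNode ts) = source M (ts ! 0)" "sink M (SNode ts) = sink M (ts ! (length ts - 1))"
    by (simp_all add: hd_map last_map hd_conv_nth last_conv_nth)
qed

lemma series_source_only_first:
  assumes S: "represents M (SNode ts)" and i: "i < length ts" "source M (SNode ts) \<in> node_verts M (ts ! i)"
  shows "i = 0"
proof (rule ccontr)
  assume "i \<noteq> 0"
  note f = series_facts[OF S]
  have "0 < length ts" using f(1) by linarith
  note p = represents_poles[OF f(2)[OF this]]
  show False using f(4)[of 0 i "source M (SNode ts)"] i \<open>i \<noteq> 0\<close> p f(5) by auto
qed

lemma series_sink_only_last:
  assumes S: "represents M (SNode ts)" and i: "i < length ts" "sink M (SNode ts) \<in> node_verts M (ts ! i)"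
  shows "Suc i = length ts"
proof (rule ccontr)
  let ?l = "length ts - 1"
  assume "Suc i \<noteq> length ts"
  then have il: "i < ?l" "?l < length ts" using i by auto
  note f = series_facts[OF S]
  note p = represents_poles[OF f(2)[OF il(2)]]
  have *: "?l = Suc i \<and> sink M (SNode ts) = sink M (ts ! i)"
    using f(4)[OF il, of "sink M (SNode ts)"] i p f(6) by auto
  then have "sink M (ts ! i) = source M (ts ! ?l)" using f(3)[of i] il by auto
  then show False using * p f(6) by auto
qed

lemma series_dart_cases:
  assumes S: "represents M (SNode ts)" and "i < length ts"
    and d: "d \<in> darts" "src d \<in> node_verts M (ts ! i)"
  obtains (inside) j where "j < length ts" "d \<in> node_edges M (ts ! j)" "src d \<in> node_verts M (ts ! j)"
    | (outside) "d \<notin> node_edges M (SNode ts)" "src d \<in> node_verts M (SNode ts)"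
proof (cases "d \<in> node_edges M (SNode ts)")
  case True
  then obtain j where "j < length ts" "d \<in> node_edges M (ts ! j)" by (auto simp: in_set_conv_nth)
  moreover from this have "src d \<in> node_verts M (ts ! j)"
    using node_verts_eq[OF series_facts(2)[OF S]] by auto
  ultimately show thesis by (rule inside)
next
  case False
  have "node_verts M (ts ! i) \<subseteq> node_verts M (SNode ts)"
    using assms(2) by (force simp: node_verts_def dart_verts_def)
  then show thesis using outside False d by auto
qed

lemma series_edges_disjoint:
  assumes S: "represents M (SNode ts)" and ij: "i < j" "j < length ts"
  shows "node_edges M (ts ! i) \<inter> node_edges M (ts ! j) = {}"
proof (rule ccontr)
  assume "node_edges M (ts ! i) \<inter> node_edges M (ts ! j) \<noteq> {}"
  then obtain d where d: "d \<in> node_edges M (ts ! i)" "d \<in> node_edges M (ts ! j)" by blast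
  note f = series_facts[OF S]
  have i: "i < length ts" using ij by simp
  note ri = f(2)[OF i] and rj = f(2)[OF ij(2)]
  have dS: "d \<in> darts" using d node_edges_subset[OF ri] by blast
  have "src d \<in> node_verts M (ts ! i)" "src d \<in> node_verts M (ts ! j)"
    "src (opp M d) \<in> node_verts M (ts ! i)" "src (opp M d) \<in> node_verts M (ts ! j)"
    using d opp_node_edges by (auto simp: node_verts_eq[OF ri] node_verts_eq[OF rj])
  then have "src d = src (opp M d)" using f(4)[OF ij] by metis
  then show False using no_loop[OF dS] dS by simp
qed

text \<open>A foreign dart at a vertex of the child belongs to an adjacent sibling, and then the
  vertex is the shared pole; or it lies outside the series node and starts at a pole of that node,
  which only the first or the last child contains.\<close>

lemma attached_series_child:
  assumes S: "represents M (SNode ts)" and att: "attached (SNode ts)" and i: "i < length ts"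
  shows "attached (ts ! i)"
proof (rule attachedI)
  note f = series_facts[OF S]
  show ri: "represents M (ts ! i)" using f(2)[OF i] .
  note p = represents_poles[OF ri]
  show "src d = source M (ts ! i) \<or> src d = sink M (ts ! i)"
    if d: "d \<in> darts" "d \<notin> node_edges M (ts ! i)" "src d \<in> node_verts M (ts ! i)" for d
    using S i d(1,3)
  proof (cases rule: series_dart_cases)
    case (inside j)
    then have "j \<noteq> i" using d by auto
    then show ?thesis using f(4)[of i j "src d"] f(4)[of j i "src d"] f(3)[of j] inside i d(3)
      by (cases "i < j") auto
  next
    case outside
    then have "src d = source M (SNode ts) \<or> src d = sink M (SNode ts)"
      using attached_pole[OF att S d(1)] by blast
    then show ?thesis
    proof
      assume "src d = source M (SNode ts)"
      then have "i = 0" using series_source_only_first[OF S i] d(3) by simp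
      then show ?thesis using f(5) \<open>src d = source M (SNode ts)\<close> by simp
    next
      assume "src d = sink M (SNode ts)"
      then have "i = length ts - 1" using series_sink_only_last[OF S i] d(3) by simp
      then show ?thesis using f(6) \<open>src d = sink M (SNode ts)\<close> by simp
    qed
  qed
  have out: "\<exists>d\<in>darts - node_edges M (ts ! i). src d = w"
    if j: "j < length ts" "j \<noteq> i" "w \<in> node_verts M (ts ! j)" for j w
  proof -
    obtain d where d: "d \<in> node_edges M (ts ! j)" "src d = w"
      using j(3) node_verts_eq[OF f(2)[OF j(1)]] by auto
    then have "d \<in> darts" using node_edges_subset[OF f(2)[OF j(1)]] by blast
    moreover have "d \<notin> node_edges M (ts ! i)"
      using series_edges_disjoint[OF S, of i j] series_edges_disjoint[OF S, of j i] i j(1,2) d(1)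
      by (cases "i < j") auto
    ultimately show ?thesis using d(2) by blast
  qed
  have sub: "node_edges M (ts ! i) \<subseteq> node_edges M (SNode ts)" using nth_mem[OF i] by auto
  show "\<exists>d\<in>darts - node_edges M (ts ! i). src d = source M (ts ! i)"
  proof (cases i)
    case 0
    then show ?thesis using attached_outside(1)[OF att] f(5) sub by auto
  next
    case (Suc k)
    then have "source M (ts ! i) \<in> node_verts M (ts ! k)"
      using f(3)[of k] i represents_poles[OF f(2)[of k]] by simp
    then show ?thesis using out[of k] Suc i by simp
  qed
  show "\<exists>d\<in>darts - node_edges M (ts ! i). src d = sink M (ts ! i)"
  proof (cases "Suc i = length ts")
    case True
    then have "i = length ts - 1" by simp
    then show ?thesis using attached_outside(2)[OF att] f(6) sub by auto
  next
    case False
    then have si: "Suc i < length ts" using i by simp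
    then have "sink M (ts ! i) \<in> node_verts M (ts ! Suc i)"
      using f(3)[of i] represents_poles[OF f(2)[OF si]] by simp
    then show ?thesis using out[of "Suc i"] si by simp
  qed
qed

lemma attached_parallel_child:
  assumes P: "represents M (PNode ts)" and att: "attached (PNode ts)" and i: "i < length ts"
  shows "attached (ts ! i)"
proof (rule attachedI)
  have rep: "represents M (ts ! j)" if "j < length ts" for j using P that by auto
  have pr: "source M (ts ! j) = source M (ts ! k) \<and> sink M (ts ! j) = sink M (ts ! k) \<and>
        node_verts M (ts ! j) \<inter> node_verts M (ts ! k) = {source M (ts ! j), sink M (ts ! j)} \<and>
        node_edges M (ts ! j) \<inter> node_edges M (ts ! k) = {}"
    if "j < length ts" "k < length ts" "j \<noteq> k" for j k
  proof (cases "j < k")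
    case True
    then show ?thesis using P that by auto
  next
    case False
    then have kj: "k < j" using that by simp
    then have *: "source M (ts ! k) = source M (ts ! j) \<and> sink M (ts ! k) = sink M (ts ! j) \<and>
        node_verts M (ts ! k) \<inter> node_verts M (ts ! j) = {source M (ts ! k), sink M (ts ! k)} \<and>
        node_edges M (ts ! k) \<inter> node_edges M (ts ! j) = {}"
      using P that by auto
    then show ?thesis by (simp add: Int_commute)
  qed
  have ne: "ts \<noteq> []" "2 \<le> length ts" using P by auto
  have poles: "source M (PNode ts) = source M (ts ! i)" "sink M (PNode ts) = sink M (ts ! i)"
  proof -
    have l: "0 < length ts" "length ts - 1 < length ts" using ne(2) by linarith+
    have "source M (PNode ts) = source M (ts ! 0)" "sink M (PNode ts) = sink M (ts ! (length ts - 1))"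
      using ne(1) by (simp_all add: hd_map last_map hd_conv_nth last_conv_nth)
    then show "source M (PNode ts) = source M (ts ! i)" "sink M (PNode ts) = sink M (ts ! i)"
      using pr[OF l(1) i] pr[OF l(2) i] by metis+
  qed
  show "represents M (ts ! i)" using rep[OF i] .
  show "src d = source M (ts ! i) \<or> src d = sink M (ts ! i)"
    if d: "d \<in> darts" "d \<notin> node_edges M (ts ! i)" "src d \<in> node_verts M (ts ! i)" for d
  proof (cases "d \<in> node_edges M (PNode ts)")
    case True
    then obtain j where j: "j < length ts" "d \<in> node_edges M (ts ! j)" by (auto simp: in_set_conv_nth)
    then have "j \<noteq> i" using d by auto
    moreover have "src d \<in> node_verts M (ts ! j)" using node_verts_eq[OF rep[OF j(1)]] j by auto
    ultimately show ?thesis using pr[OF i j(1)] d(3) by blast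
  next
    case False
    have "node_verts M (ts ! i) \<subseteq> node_verts M (PNode ts)"
      using i by (force simp: node_verts_def dart_verts_def)
    then show ?thesis using attached_pole[OF att P d(1) False] d(3) poles by auto
  qed
  have sub: "node_edges M (ts ! i) \<subseteq> node_edges M (PNode ts)" using nth_mem[OF i] by auto
  show "\<exists>d\<in>darts - node_edges M (ts ! i). src d = source M (ts ! i)"
    "\<exists>d\<in>darts - node_edges M (ts ! i). src d = sink M (ts ! i)"
    using attached_outside[OF att] poles sub by auto
qed

lemma linked_subset:
  "linked X w Z \<Longrightarrow> (\<And>d. d \<in> Y \<Longrightarrow> src d = w \<Longrightarrow> d \<in> X) \<Longrightarrow> linked Y w Z"
  unfolding linked_def by meson

text \<open>All darts of the node at its source lie in the first child, which does not contain the
  sink of the node since there are at least two children. So that sink may serve as \<open>z\<close>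
  in \<open>two_pole_linked\<close>.\<close>

lemma series_linked:
  assumes S: "represents M (SNode ts)" and att: "attached (SNode ts)"
  shows "node_linked (SNode ts)"
proof -
  note f = series_facts[OF S]
  let ?l = "length ts - 1"
  have l: "0 < length ts" "?l < length ts" "0 < ?l" using f(1) by linarith+
  note r = f(2)[OF l(1)]
  have "linked (node_edges M (ts ! 0)) (source M (ts ! 0)) {source M (ts ! 0), sink M (SNode ts)}"
  proof (rule two_pole_linked[OF attached_series_child[OF S att l(1)]])
    fix d assume d: "d \<in> node_edges M (ts ! 0)"
    show "src d \<noteq> sink M (SNode ts)"
    proof
      assume "src d = sink M (SNode ts)"
      then have "sink M (SNode ts) \<in> node_verts M (ts ! 0)"
        using d unfolding node_verts_eq[OF r] by (metis imageI)
      then have "Suc 0 = length ts" by (rule series_sink_only_last[OF S l(1)])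
      then show False using f(1) by simp
    qed
  qed
  then have "linked (node_edges M (SNode ts)) (source M (ts ! 0)) {source M (ts ! 0), sink M (SNode ts)}"
  proof (rule linked_subset)
    fix d assume d: "d \<in> node_edges M (SNode ts)" "src d = source M (ts ! 0)"
    then obtain j where j: "j < length ts" "d \<in> node_edges M (ts ! j)" by (auto simp: in_set_conv_nth)
    then have "source M (SNode ts) \<in> node_verts M (ts ! j)"
      using d f(5) unfolding node_verts_eq[OF f(2)[OF j(1)]] by (metis imageI)
    then show "d \<in> node_edges M (ts ! 0)" using series_source_only_first[OF S j(1)] j(2) by simp
  qed
  then show ?thesis unfolding weakly_linked_def f(5) by blast
qed

text \<open>The outside of a child of a series node is again a series composition, whose first part at
  the shared pole is a sibling.\<close>

lemma series_sibling_linked: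
  assumes S: "represents M (SNode ts)" and att: "attached (SNode ts)"
    and ij: "i < length ts" "j < length ts" "i \<noteq> j"
    and w: "w \<in> node_verts M (ts ! i)" "w \<in> node_verts M (ts ! j)"
    and z: "z \<notin> node_verts M (ts ! j)"
  shows "linked (darts - node_edges M (ts ! i)) w {w, z}"
proof -
  note f = series_facts[OF S]
  have adj: "k = Suc m \<and> w = sink M (ts ! m) \<and> w = source M (ts ! k)"
    if "m < k" "k < length ts" "w \<in> node_verts M (ts ! m)" "w \<in> node_verts M (ts ! k)" for m k
    using f(4)[OF that] f(3)[of m] that(2) by simp
  have wp: "w = source M (ts ! j) \<or> w = sink M (ts ! j)"
    using adj[of i j] adj[of j i] ij w by (metis nat_neq_iff)
  have two: "two_pole (node_edges M (ts ! j)) w (if w = source M (ts ! j) then sink M (ts ! j) else source M (ts ! j))"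
    using attached_series_child[OF S att ij(2)] two_pole_commute wp by auto
  have "linked (node_edges M (ts ! j)) w {w, z}"
  proof (rule two_pole_linked[OF two])
    show "src d \<noteq> z" if "d \<in> node_edges M (ts ! j)" for d
      using that z unfolding node_verts_eq[OF f(2)[OF ij(2)]] by blast
  qed
  then show ?thesis
  proof (rule linked_subset)
    fix d assume d: "d \<in> darts - node_edges M (ts ! i)" "src d = w"
    have ns: "w \<noteq> source M (SNode ts)" "w \<noteq> sink M (SNode ts)"
      using series_source_only_first[OF S ij(1)] series_source_only_first[OF S ij(2)]
        series_sink_only_last[OF S ij(1)] series_sink_only_last[OF S ij(2)] w ij(3) by auto
    have "d \<in> darts" "src d \<in> node_verts M (ts ! i)" using d w by auto
    with S ij(1) show "d \<in> node_edges M (ts ! j)"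
    proof (cases rule: series_dart_cases)
      case (inside k)
      have ki: "k \<noteq> i" using inside(2) d by auto
      have wk: "w \<in> node_verts M (ts ! k)" using inside(3) d by simp
      have near: "n = Suc m \<or> m = Suc n"
        if "m \<noteq> n" "m < length ts" "n < length ts" "w \<in> node_verts M (ts ! m)" "w \<in> node_verts M (ts ! n)" for m n
        using adj[of m n] adj[of n m] that by (cases "m < n") auto
      have "k = j"
      proof (rule ccontr)
        assume "k \<noteq> j"
        then show False
          using near[OF _ inside(1) ij(2) wk w(2)] near[OF ki inside(1) ij(1) wk w(1)] near[OF ij(3,1,2) w]
          by linarith
      qed
      then show ?thesis using inside(2) by simp
    next
      case outside
      then show ?thesis using attached_pole[OF att S \<open>d \<in> darts\<close>] ns d by auto
    qed
  qed
qed

text \<open>The next sibling joins the outside darts at the sink; the last child uses the preceding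
  sibling and its own source.\<close>

lemma series_child_linked:
  assumes S: "represents M (SNode ts)" and att: "attached (SNode ts)" and i: "i < length ts"
  shows "node_linked (ts ! i)"
proof -
  note f = series_facts[OF S]
  note p = represents_poles[OF f(2)[OF i]]
  show ?thesis
  proof (cases "Suc i < length ts")
    case True
    have "source M (ts ! i) \<notin> node_verts M (ts ! Suc i)"
      using f(4)[of i "Suc i" "source M (ts ! i)"] True p by auto
    then have "linked (darts - node_edges M (ts ! i)) (sink M (ts ! i)) {sink M (ts ! i), source M (ts ! i)}"
      using series_sibling_linked[OF S att i True] p f(3)[OF True] represents_poles[OF f(2)[OF True]]
      by simp
    then show ?thesis unfolding weakly_linked_def by (auto simp: insert_commute)
  next
    case False
    then obtain k where k: "i = Suc k" using f(1) i by (cases i) auto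
    then have kl: "k < length ts" using i by simp
    have sk: "source M (ts ! i) = sink M (ts ! k)" using f(3)[of k] k i by simp
    have "sink M (ts ! i) \<notin> node_verts M (ts ! k)"
      using f(4)[of k i "sink M (ts ! i)"] k i p sk by auto
    then have "linked (darts - node_edges M (ts ! i)) (source M (ts ! i)) {source M (ts ! i), sink M (ts ! i)}"
      using series_sibling_linked[OF S att i kl] p sk represents_poles[OF f(2)[OF kl]] k by simp
    then show ?thesis unfolding weakly_linked_def by auto
  qed
qed

text \<open>Children of S-nodes are linked from outside. Children of P-nodes are linked from inside,
  being Q*-nodes or S-nodes by canonicity. For \<open>t\<close> itself linking is assumed, because
  \<open>t\<close> may be a P-node.\<close>

lemma descendant_facts:
  assumes "represents M t" "attached t" "canonical t" "node_linked t" "\<nu> \<in> nodes t"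
  shows "represents M \<nu> \<and> attached \<nu> \<and> node_linked \<nu>"
  using assms
proof (induction t)
  case (SNode ts)
  show ?case
  proof (cases "\<nu> = SNode ts")
    case False
    then obtain i where i: "i < length ts" "\<nu> \<in> nodes (ts ! i)"
      using SNode.prems(5) by (auto simp: in_set_conv_nth)
    have "canonical (ts ! i)" using SNode.prems(3) i(1) by simp
    then show ?thesis
      using SNode.IH[of "ts ! i"] i series_facts(2)[OF SNode.prems(1) i(1)]
        attached_series_child[OF SNode.prems(1,2) i(1)] series_child_linked[OF SNode.prems(1,2) i(1)]
      by simp
  qed (use SNode.prems in blast)
next
  case (PNode ts)
  show ?case
  proof (cases "\<nu> = PNode ts")
    case False
    then obtain i where i: "i < length ts" "\<nu> \<in> nodes (ts ! i)"
      using PNode.prems(5) by (auto simp: in_set_conv_nth)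
    have c: "canonical (ts ! i)" "\<not> is_P (ts ! i)" "represents M (ts ! i)"
      using PNode.prems(1,3) i(1) by auto
    have a: "attached (ts ! i)" using attached_parallel_child[OF PNode.prems(1,2) i(1)] .
    have "node_linked (ts ! i)"
      using c a qstar_linked series_linked by (cases "ts ! i") auto
    then show ?thesis using PNode.IH[of "ts ! i"] i c a by simp
  qed (use PNode.prems in blast)
qed auto

lemma root_child_attached:
  assumes c: "represents M c" "represents M c'"
    and poles: "source M c = source M c'" "sink M c = sink M c'"
    and vs: "node_verts M c \<inter> node_verts M c' = {source M c, sink M c}"
    and es: "node_edges M c \<inter> node_edges M c' = {}" "darts = node_edges M c \<union> node_edges M c'"
  shows "attached c"
proof (rule attachedI[OF c(1)])
  have p: "source M c \<in> src ` node_edges M c'" "sink M c \<in> src ` node_edges M c'"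
    using represents_poles[OF c(2)] poles node_verts_eq[OF c(2)] by auto
  then show "\<exists>d\<in>darts - node_edges M c. src d = source M c" "\<exists>d\<in>darts - node_edges M c. src d = sink M c"
    using es by (auto simp: image_iff)
  show "src d = source M c \<or> src d = sink M c"
    if "d \<in> darts" "d \<notin> node_edges M c" "src d \<in> node_verts M c" for d
  proof -
    have "src d \<in> node_verts M c'" using that es(2) unfolding node_verts_eq[OF c(2)] by auto
    then show ?thesis using that(3) vs by blast
  qed
qed

lemma spq_node_facts:
  assumes T: "spq_tree M e T" and \<nu>: "\<nu> \<in> nodes T" "\<nu> \<noteq> T"
  shows "represents M \<nu> \<and> attached \<nu> \<and> node_linked \<nu>"
proof -
  let ?q = "QStar [e]"
  obtain t where t: "canonical t" "T = PNode [?q, t] \<or> T = PNode [t, ?q]" and rT: "represents M T"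
    and dT: "darts = node_edges M T"
    using T by (auto simp: spq_tree_def)
  have r: "represents M ?q" "represents M t" using rT t(2) by auto
  have pair: "source M a = source M b \<and> sink M a = sink M b \<and>
      node_verts M a \<inter> node_verts M b = {source M a, sink M a} \<and> node_edges M a \<inter> node_edges M b = {}"
    if "represents M (PNode [a, b])" for a b
  proof -
    have "\<forall>i j. i < j \<and> j < length [a, b] \<longrightarrow>
        source M ([a, b] ! i) = source M ([a, b] ! j) \<and> sink M ([a, b] ! i) = sink M ([a, b] ! j) \<and>
        node_verts M ([a, b] ! i) \<inter> node_verts M ([a, b] ! j) = {source M ([a, b] ! i), sink M ([a, b] ! i)} \<and>
        node_edges M ([a, b] ! i) \<inter> node_edges M ([a, b] ! j) = {}"
      using that unfolding represents.simps by blast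
    from this[rule_format, of 0 1] show ?thesis by simp
  qed
  have "source M ?q = source M t \<and> sink M ?q = sink M t \<and>
    node_verts M ?q \<inter> node_verts M t = {source M ?q, sink M ?q} \<and> node_edges M ?q \<inter> node_edges M t = {}"
    using t(2)
  proof
    assume "T = PNode [?q, t]"
    then show ?thesis using rT pair by blast
  next
    assume "T = PNode [t, ?q]"
    then have "represents M (PNode [t, ?q])" using rT by simp
    from pair[OF this] show ?thesis by (metis Int_commute)
  qed
  then have q: "source M ?q = source M t" "sink M ?q = sink M t"
    "node_verts M ?q \<inter> node_verts M t = {source M ?q, sink M ?q}" "node_edges M ?q \<inter> node_edges M t = {}"
    by blast+
  have "node_edges M T = node_edges M ?q \<union> node_edges M t"
    using t(2) by (elim disjE) (simp_all only: node_edges_simps list.set UN_insert UN_empty Un_empty_left Un_empty_right Un_commute)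
  then have d: "darts = node_edges M ?q \<union> node_edges M t" using dT by (rule trans[rotated])
  have aq: "attached ?q" using root_child_attached[OF r q d] .
  have at: "attached t"
  proof (rule root_child_attached[OF r(2,1) q(1,2)[symmetric]])
    show "node_verts M t \<inter> node_verts M ?q = {source M t, sink M t}"
      using q(3) by (simp only: q(1,2) Int_commute[of "node_verts M t" "node_verts M ?q"])
    show "node_edges M t \<inter> node_edges M ?q = {}"
      by (rule trans[OF Int_commute q(4)])
    show "darts = node_edges M t \<union> node_edges M ?q"
      by (rule trans[OF d Un_commute])
  qed
  \<comment> \<open>The child \<open>t\<close> of the root may be a P-node, so its link comes from
    outside, where the reference edge has only one dart at the source.\<close>
  have "darts - node_edges M t = node_edges M ?q"
    unfolding d Un_Diff using q(4) by (simp only: Diff_triv Diff_cancel Un_empty_right)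
  then have lt: "node_linked t"
    unfolding weakly_linked_def using qstar_linked_source[OF r(1)] q(1) by auto
  have "\<nu> = ?q \<or> \<nu> \<in> nodes t" using \<nu> t(2) by auto
  then show ?thesis
    using descendant_facts[OF r(2) at t(1) lt] r(1) aq qstar_linked[OF r(1)] by blast
qed

end

section \<open>Turns and rotations\<close>

text \<open>Degrees turned to the right while traversing \<open>d\<close>.\<close>

definition bend_turn :: "'d angled \<Rightarrow> 'd \<Rightarrow> int" where
  "bend_turn H d = (\<Sum>b\<leftarrow>bends H d. int b - 180)"

text \<open>Degrees turned to the left by the boundary walk, at corners and bends: one full turn for
  an internal face.\<close>

definition face_turn :: "'d angled \<Rightarrow> 'd set \<Rightarrow> int" where
  "face_turn H f = (\<Sum>d\<in>f. 180 - int (angle H d) - bend_turn H d)"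

text \<open>An angle a has weight (180 - a)/90, that is 1, 0, -1, -2 for the four admissible
  values.\<close>

lemma num_angles_face_turn:
  assumes "finite f" and "\<And>d. d \<in> f \<Longrightarrow> angle H d \<in> {90, 180, 270, 360}"
    and "\<And>d. d \<in> f \<Longrightarrow> set (bends H d) \<subseteq> {90, 270}"
  shows "90 * (num_angles H 90 f - num_angles H 270 f - 2 * num_angles H 360 f) = face_turn H f"
proof -
  let ?c = "\<lambda>a d. if angle H d = a then 1 else 0 :: int"
  let ?b = "\<lambda>a d. int (count_list (bends H d) a)"
  have count: "int (card {d \<in> f. angle H d = a}) = sum (?c a) f" for a
    using assms(1) by (simp add: sum.If_cases Int_def)
  have bends: "90 * (int (count_list bs 90) - int (count_list bs 270) - 2 * int (count_list bs 360))
      = - (\<Sum>b\<leftarrow>bs. int b - 180)" if "set bs \<subseteq> {90, 270}" for bs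
    using that by (induction bs) (auto simp: algebra_simps)
  have "90 * (num_angles H 90 f - num_angles H 270 f - 2 * num_angles H 360 f)
      = (\<Sum>d\<in>f. 90 * (?c 90 d - ?c 270 d - 2 * ?c 360 d) + 90 * (?b 90 d - ?b 270 d - 2 * ?b 360 d))"
    unfolding num_angles_def count
    by (simp add: sum.distrib sum_subtractf sum_distrib_left[symmetric] algebra_simps)
  also have "\<dots> = face_turn H f"
    unfolding face_turn_def
  proof (rule sum.cong)
    fix d assume d: "d \<in> f"
    have "90 * (?c 90 d - ?c 270 d - 2 * ?c 360 d) = 180 - int (angle H d)" using assms(2)[OF d] by auto
    then show "90 * (?c 90 d - ?c 270 d - 2 * ?c 360 d) + 90 * (?b 90 d - ?b 270 d - 2 * ?b 360 d)
        = 180 - int (angle H d) - bend_turn H d"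
      using bends[OF assms(3)[OF d]] by (simp add: bend_turn_def)
  qed simp
  finally show ?thesis .
qed

text \<open>360 must be excluded: \<open>turns\<close> ignores it, whereas it would add 180 to the
  sum.\<close>

lemma turns_eq:
  assumes "set as \<subseteq> {90, 180, 270}"
  shows "90 * turns as = (\<Sum>a\<leftarrow>as. int a - 180)"
  using assms by (induction as) (auto simp: turns_def algebra_simps)

lemma turns_append: "turns (as @ bs) = turns as + turns bs"
  by (simp add: turns_def)

context biconnected_plane
begin

lemma orthogonal_repD:
  assumes "orthogonal_rep M H"
  shows "faces H = map_faces M" "outer H = ext_face M"
    and "\<And>d. d \<in> darts \<Longrightarrow> angle H d \<in> {90, 180, 270, 360}"
    and "\<And>d. d \<in> darts \<Longrightarrow> set (bends H d) \<subseteq> {90, 270}"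
    and "\<And>d. d \<in> darts \<Longrightarrow> bends H (opp M d) = map (\<lambda>a. 360 - a) (rev (bends H d))"
    and "\<And>v. v \<in> verts (skel M) \<Longrightarrow> (\<Sum>d\<in>out_arcs (skel M) v. angle H d) = 360"
    and "\<And>f. f \<in> map_faces M \<Longrightarrow> face_turn H f = (if f = ext_face M then - 360 else 360)"
proof -
  show F: "faces H = map_faces M" "outer H = ext_face M"
    and A: "\<And>d. d \<in> darts \<Longrightarrow> angle H d \<in> {90, 180, 270, 360}"
    and B: "\<And>d. d \<in> darts \<Longrightarrow> set (bends H d) \<subseteq> {90, 270}"
    and "\<And>d. d \<in> darts \<Longrightarrow> bends H (opp M d) = map (\<lambda>a. 360 - a) (rev (bends H d))"
    and "\<And>v. v \<in> verts (skel M) \<Longrightarrow> (\<Sum>d\<in>out_arcs (skel M) v. angle H d) = 360"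
    using assms unfolding orthogonal_rep_def by blast+
  fix f assume f: "f \<in> map_faces M"
  have "num_angles H 90 f - num_angles H 270 f - 2 * num_angles H 360 f = (if f = outer H then - 4 else 4)"
    using assms f F(1) unfolding orthogonal_rep_def by blast
  then show "face_turn H f = (if f = ext_face M then - 360 else 360)"
  proof -
    have "90 * (num_angles H 90 f - num_angles H 270 f - 2 * num_angles H 360 f) = face_turn H f"
      using num_angles_face_turn[OF face_finite[OF f], of H] A B face_subset[OF f] by blast
    then show ?thesis using \<open>_ = (if f = outer H then - 4 else 4)\<close> F(2) by (simp split: if_splits)
  qed
qed

lemma orthogonal_repI:
  assumes "faces H = map_faces M" "outer H = ext_face M"
    and A: "\<And>d. d \<in> darts \<Longrightarrow> angle H d \<in> {90, 180, 270, 360}"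
    and "\<And>d. d \<in> darts \<Longrightarrow> angle H d = 360 \<Longrightarrow> out_degree (skel M) (src d) = 1"
    and B: "\<And>d. d \<in> darts \<Longrightarrow> set (bends H d) \<subseteq> {90, 270}"
    and "\<And>d. d \<in> darts \<Longrightarrow> bends H (opp M d) = map (\<lambda>a. 360 - a) (rev (bends H d))"
    and "\<And>v. v \<in> verts (skel M) \<Longrightarrow> (\<Sum>d\<in>out_arcs (skel M) v. angle H d) = 360"
    and F: "\<And>f. f \<in> map_faces M \<Longrightarrow> face_turn H f = (if f = ext_face M then - 360 else 360)"
  shows "orthogonal_rep M H"
proof -
  have "num_angles H 90 f - num_angles H 270 f - 2 * num_angles H 360 f = (if f = outer H then - 4 else 4)"
    if f: "f \<in> map_faces M" for f
  proof -
    have "90 * (num_angles H 90 f - num_angles H 270 f - 2 * num_angles H 360 f) = face_turn H f"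
      using num_angles_face_turn[OF face_finite[OF f], of H] A B face_subset[OF f] by blast
    then show ?thesis using F[OF f] assms(2) by (simp split: if_splits)
  qed
  then show ?thesis unfolding orthogonal_rep_def using assms by blast
qed

lemma bend_turn_opp:
  assumes "orthogonal_rep M H" "d \<in> darts"
  shows "bend_turn H (opp M d) = - bend_turn H d"
proof -
  have "(\<Sum>b\<leftarrow>map (\<lambda>a. 360 - a) (rev bs). int b - 180) = - (\<Sum>b\<leftarrow>bs. int b - 180)"
    if "set bs \<subseteq> {90, 270}" for bs :: "nat list"
    using that by (induction bs) auto
  then show ?thesis
    using orthogonal_repD(4,5)[OF assms(1) assms(2)] by (simp add: bend_turn_def)
qed

text \<open>The difference of two orthogonal representations is a closed form. Its primitive measures by
  how much the direction of each dart is rotated from one drawing to the other.\<close>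

definition rotation_between :: "'d angled \<Rightarrow> 'd angled \<Rightarrow> ('d \<Rightarrow> int) \<Rightarrow> bool" where
  "rotation_between H H' \<Theta> \<longleftrightarrow>
    (\<forall>d\<in>darts. \<Theta> (ccw M d) = \<Theta> d + (int (angle H' d) - int (angle H d)) \<and>
      \<Theta> (opp M d) = \<Theta> d - (bend_turn H' d - bend_turn H d))"

lemma rotation_exists:
  assumes H: "orthogonal_rep M H" and H': "orthogonal_rep M H'"
  obtains \<Theta> where "rotation_between H H' \<Theta>"
proof -
  let ?s = "\<lambda>d. int (angle H' d) - int (angle H d)"
  let ?a = "\<lambda>d. - (bend_turn H' d - bend_turn H d)"
  obtain \<Theta> where "\<And>d. d \<in> darts \<Longrightarrow> \<Theta> (ccw M d) = \<Theta> d + ?s d"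
    and "\<And>d. d \<in> darts \<Longrightarrow> \<Theta> (opp M d) = \<Theta> d + ?a d"
  proof (rule closed_imp_exact[of ?s ?a])
    show "sum ?s (out_arcs (skel M) v) = 0" if v: "v \<in> verts (skel M)" for v
    proof -
      have "(\<Sum>d\<in>out_arcs (skel M) v. int (angle K d)) = 360" if "orthogonal_rep M K" for K
        using orthogonal_repD(6)[OF that v] by (metis of_nat_numeral of_nat_sum)
      then show ?thesis using H H' by (simp add: sum_subtractf)
    qed
    show "?a (opp M d) = - ?a d" if "d \<in> darts" for d
      using bend_turn_opp[OF H that] bend_turn_opp[OF H' that] by simp
    show "(\<Sum>d\<in>f. ?a d - ?s d) = 0" if f: "f \<in> map_faces M" for f
    proof -
      \<comment> \<open>The sign of \<open>?a\<close> is chosen for this identity. Both face turns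
        agree because both representations have the same external face.\<close>
      have "(\<Sum>d\<in>f. ?a d - ?s d) = face_turn H' f - face_turn H f"
        unfolding face_turn_def sum_subtractf[symmetric] by (rule sum.cong) auto
      then show ?thesis using orthogonal_repD(7)[OF H f] orthogonal_repD(7)[OF H' f] by simp
    qed
  qed blast
  then have "rotation_between H H' \<Theta>" unfolding rotation_between_def by simp
  then show thesis by (rule that)
qed

text \<open>A repetition before the first arrival at \<open>d'\<close> would give an earlier
  arrival. For equal darts the positive exponent would make the range a full turn.\<close>

lemma corner_range:
  assumes "d \<in> darts" "d' \<in> darts" "src d = src d'" "d \<noteq> d'"
  defines "k \<equiv> LEAST k. 0 < k \<and> (ccw M ^^ k) d = d'"
  shows "0 < k" and "(ccw M ^^ k) d = d'" and "inj_on (\<lambda>i. (ccw M ^^ i) d) {..<k}"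
    and "(\<lambda>i. (ccw M ^^ i) d) ` {..<k} \<subseteq> out_arcs (skel M) (src d) - {d'}"
proof -
  have "d' \<in> orbit (ccw M) d" using ccw_orbit[OF assms(1)] assms by simp
  then have "\<exists>k. 0 < k \<and> (ccw M ^^ k) d = d'" by (auto simp: orbit_altdef)
  then have "0 < k \<and> (ccw M ^^ k) d = d'" unfolding k_def by (rule LeastI_ex)
  then show k: "0 < k" "(ccw M ^^ k) d = d'" by auto
  have least: "(ccw M ^^ i) d \<noteq> d'" if "0 < i" "i < k" for i
    using not_less_Least[of i "\<lambda>k. 0 < k \<and> (ccw M ^^ k) d = d'"] that unfolding k_def by blast
  have ne: "(ccw M ^^ i) d \<noteq> d'" if "i < k" for i
    using least[of i] that assms(4) by (cases i) auto
  show "inj_on (\<lambda>i. (ccw M ^^ i) d) {..<k}"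
  proof (rule linorder_inj_onI)
    fix i j assume ij: "i < j" "i \<in> {..<k}" "j \<in> {..<k}"
    show "(ccw M ^^ i) d \<noteq> (ccw M ^^ j) d"
    proof
      assume eq: "(ccw M ^^ i) d = (ccw M ^^ j) d"
      have "(ccw M ^^ (k - j + i)) d = (ccw M ^^ (k - j)) ((ccw M ^^ i) d)" by (simp add: funpow_add)
      also have "\<dots> = (ccw M ^^ (k - j + j)) d" unfolding eq by (simp add: funpow_add)
      also have "\<dots> = d'" using ij k(2) by simp
      finally have "(ccw M ^^ (k - j + i)) d = d'" .
      moreover have "k - j + i < k" using ij by auto
      ultimately show False using ne by blast
    qed
  qed auto
  have "(ccw M ^^ i) d \<in> out_arcs (skel M) (src d)" for i
    using assms(1) by (induction i) auto
  then show "(\<lambda>i. (ccw M ^^ i) d) ` {..<k} \<subseteq> out_arcs (skel M) (src d) - {d'}"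
    using ne by blast
qed

text \<open>The range contains the corner at \<open>d'\<close> but not the one at
  \<open>opp M d\<close>; each has at least 90 of the 360 degrees. This provides the bound that
  \<open>turns_eq\<close> asks for.\<close>

lemma left_angle_range:
  assumes H: "orthogonal_rep M H" and d: "d \<in> darts" "d' \<in> darts" "dst d = src d'" "d' \<noteq> opp M d"
  shows "left_angle M H d d' \<in> {90, 180, 270}"
proof -
  let ?A = "out_arcs (skel M) (src d')"
  have o: "opp M d \<in> darts" "src d' = src (opp M d)" using d by auto
  note c = corner_range[OF d(2) o d(4)]
  define k where "k = (LEAST k. 0 < k \<and> (ccw M ^^ k) d' = opp M d)"
  let ?P = "(\<lambda>i. (ccw M ^^ i) d') ` {..<k}"
  have L: "left_angle M H d d' = sum (angle H) ?P"
    unfolding left_angle_def k_def by (rule sum.reindex_cong[symmetric]) (use c(3) in auto)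
  have P: "?P \<subseteq> ?A - {opp M d}" "finite ?P" using c(4) unfolding k_def by auto
  have ang: "angle H e \<in> {90, 180, 270, 360}" if "e \<in> ?A" for e
    using orthogonal_repD(3)[OF H] that by auto
  have oA: "opp M d \<in> ?A" using o(1) o(2)[symmetric] unfolding in_out_arcs_conv by blast
  have dvd: "90 dvd left_angle M H d d'"
    unfolding L by (rule dvd_sum) (use ang P(1) in force)
  have "d' = (ccw M ^^ 0) d'" by simp
  then have d'P: "d' \<in> ?P" using c(1) unfolding k_def by blast
  have "angle H d' \<le> left_angle M H d d'"
    unfolding L using d'P P(2) by (intro member_le_sum) auto
  then have low: "90 \<le> left_angle M H d d'" using ang[of d'] d(2) by auto
  have "left_angle M H d d' + angle H (opp M d) = sum (angle H) (insert (opp M d) ?P)"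
    unfolding L using P by (subst sum.insert) auto
  also have "\<dots> \<le> sum (angle H) ?A"
  proof (rule sum_mono2)
    show "finite ?A" by (rule finite_out_arcs)
    show "insert (opp M d) ?P \<subseteq> ?A" using P(1) oA by blast
  qed simp_all
  also have "\<dots> = 360" using orthogonal_repD(6)[OF H tail_in_verts[OF d(2)]] .
  finally have "left_angle M H d d' + angle H (opp M d) \<le> 360" .
  moreover have "90 \<le> angle H (opp M d)"
    using ang[OF oA] by auto
  ultimately have "left_angle M H d d' \<le> 270" by linarith
  moreover obtain m where "left_angle M H d d' = 90 * m" using dvd by (rule dvdE)
  ultimately have "m \<in> {1, 2, 3}" using low by auto
  then show ?thesis using \<open>left_angle M H d d' = 90 * m\<close> by auto
qed

text \<open>Each corner changes by the increment of \<Theta> across it, so the sum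
  telescopes.\<close>

lemma left_angle_rotation:
  assumes \<Theta>: "rotation_between H H' \<Theta>" and d: "d \<in> darts" "d' \<in> darts" "dst d = src d'" "d' \<noteq> opp M d"
  shows "int (left_angle M H' d d') - int (left_angle M H d d') = \<Theta> (opp M d) - \<Theta> d'"
proof -
  have o: "opp M d \<in> darts" "src d' = src (opp M d)" using d by auto
  note c = corner_range[OF d(2) o d(4)]
  define k where "k = (LEAST k. 0 < k \<and> (ccw M ^^ k) d' = opp M d)"
  have "(ccw M ^^ i) d' \<in> darts" for i using d(2) by (induction i) auto
  then have step: "int (angle H' ((ccw M ^^ i) d')) - int (angle H ((ccw M ^^ i) d'))
      = \<Theta> ((ccw M ^^ Suc i) d') - \<Theta> ((ccw M ^^ i) d')" for i
    using \<Theta> unfolding rotation_between_def by simp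
  have "(\<Sum>i<n. int (angle H' ((ccw M ^^ i) d')) - int (angle H ((ccw M ^^ i) d')))
      = \<Theta> ((ccw M ^^ n) d') - \<Theta> d'" for n
    unfolding step by (subst sum_lessThan_telescope) simp
  from this[of k] show ?thesis
    using c(2) unfolding left_angle_def k_def by (simp add: sum_subtractf)
qed

text \<open>The bends of a dart contribute \<Theta> d - \<Theta> (opp d), and the corner before the
  next dart d' contributes \<Theta> (opp d) - \<Theta> d'; only the ends of the path remain.\<close>

lemma path_angles_rotation:
  assumes H: "orthogonal_rep M H" and H': "orthogonal_rep M H'" and \<Theta>: "rotation_between H H' \<Theta>"
    and "apath u p v" "p \<noteq> []"
  shows "90 * (turns (path_angles M H' p) - turns (path_angles M H p)) = \<Theta> (hd p) - \<Theta> (opp M (last p))"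
proof -
  have bends: "set (bends K d) \<subseteq> {90, 180, 270}" if "orthogonal_rep M K" "d \<in> darts" for K d
    using orthogonal_repD(4)[OF that] by auto
  have bt: "90 * turns (bends K d) = bend_turn K d" if "orthogonal_rep M K" "d \<in> darts" for K d
    using turns_eq[OF bends[OF that]] by (simp add: bend_turn_def)
  show ?thesis
    using assms(4,5)
  proof (induction p arbitrary: u)
    case (Cons d p)
    have d: "d \<in> darts" and p: "apath (dst d) p v" "u = src d" "src d \<notin> set (awalk_verts (dst d) p)"
      using Cons.prems(1) by (auto simp: apath_Cons_iff)
    have b: "90 * turns (bends H' d) - 90 * turns (bends H d) = \<Theta> d - \<Theta> (opp M d)"
      using \<Theta> d unfolding bt[OF H d] bt[OF H' d] rotation_between_def by auto
    show ?case
    proof (cases p)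
      case Nil
      then show ?thesis using bends[OF H d] b by simp
    next
      case (Cons d' q)
      have d': "d' \<in> darts" "src d' = dst d" using p(1) Cons by (auto simp: apath_Cons_iff)
      have "dst d' \<in> set (awalk_verts (dst d) p)"
        using p(1) Cons awalk_verts_arc2[of "dst d" p v d'] by (simp add: apath_def)
      \<comment> \<open>A simple path does not turn back; a reversal would have left angle
        360.\<close>
      then have ne: "d' \<noteq> opp M d" using p(3) d by auto
      note la = left_angle_range[OF H d d'(1) d'(2)[symmetric] ne]
      note la' = left_angle_range[OF H' d d'(1) d'(2)[symmetric] ne]
      have l: "90 * turns [left_angle M H' d d'] - 90 * turns [left_angle M H d d'] = \<Theta> (opp M d) - \<Theta> d'"
        using turns_eq[of "[left_angle M H d d']"] turns_eq[of "[left_angle M H' d d']"] la la'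
          left_angle_rotation[OF \<Theta> d d'(1) d'(2)[symmetric] ne] by simp
      have IH: "90 * (turns (path_angles M H' p) - turns (path_angles M H p)) = \<Theta> (hd p) - \<Theta> (opp M (last p))"
        using Cons.IH[OF p(1)] Cons by auto
      have pa: "path_angles M K (d # p) = bends K d @ [left_angle M K d d'] @ path_angles M K p" for K
        using Cons by simp
      have "90 * (turns (path_angles M H' (d # p)) - turns (path_angles M H (d # p))) =
          \<Theta> d - \<Theta> (opp M (last p))"
        using b l IH Cons unfolding pa turns_append by (simp add: algebra_simps)
      then show ?thesis using Cons by simp
    qed
  qed simp
qed

end

section \<open>The substitution\<close>

locale node_substitution = biconnected_plane M for M :: "('v, 'd) plane_map" +
  fixes \<nu> :: "'d spq" and H H' :: "'d angled"
  assumes four: "four_graph M"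
    and rep: "represents M \<nu>" and att: "attached \<nu>" and lnk: "node_linked \<nu>"
    and H: "orthogonal_rep M H" and H': "orthogonal_rep M H'"
    and spir: "spirality M H \<nu> = spirality M H' \<nu>"
begin

abbreviation "D \<equiv> node_edges M \<nu>"

text \<open>Lets each lemma cover both sides: the pair of source and sink stands for the left face,
  the reversed pair for the right face.\<close>

definition poles :: "'v \<Rightarrow> 'v \<Rightarrow> bool" where
  "poles w w' \<longleftrightarrow> w = source M \<nu> \<and> w' = sink M \<nu> \<or> w = sink M \<nu> \<and> w' = source M \<nu>"

definition exit_dart :: "'v \<Rightarrow> 'd" where "exit_dart w = (THE d. d \<in> exits D w)"
definition entry_dart :: "'v \<Rightarrow> 'd" where "entry_dart w = (THE d. d \<in> entries D w)"

definition side :: "'v \<Rightarrow> 'd set" where "side w = orbit (face_next M) (exit_dart w)"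

lemma poles_sym: "poles w w' \<Longrightarrow> poles w' w"
  by (auto simp: poles_def)

lemma poles_ne: "poles w w' \<Longrightarrow> w \<noteq> w'"
  using represents_poles[OF rep] unfolding poles_def by metis

lemma two_pole_poles: "poles w w' \<Longrightarrow> two_pole D w w'"
  using att two_pole_commute[OF att] by (auto simp: poles_def)

lemma D_darts: "D \<subseteq> darts" and opp_D: "d \<in> D \<Longrightarrow> opp M d \<in> D"
  using node_edges_subset[OF rep] opp_node_edges by blast+

lemma boundary:
  assumes "poles w w'"
  shows "exits D w = {exit_dart w}" "entries D w = {entry_dart w}" "entry_dart w' \<in> side w"
proof -
  obtain du xu dv xv where *: "exits D (source M \<nu>) = {du}" "entries D (source M \<nu>) = {xu}"
    "exits D (sink M \<nu>) = {dv}" "entries D (sink M \<nu>) = {xv}"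
    "xv \<in> orbit (face_next M) du" "xu \<in> orbit (face_next M) dv"
    using contiguous[OF att lnk] by blast
  then have "exit_dart (source M \<nu>) = du" "entry_dart (source M \<nu>) = xu" "exit_dart (sink M \<nu>) = dv" "entry_dart (sink M \<nu>) = xv"
    by (simp_all add: exit_dart_def entry_dart_def)
  then show "exits D w = {exit_dart w}" "entries D w = {entry_dart w}" "entry_dart w' \<in> side w"
    using assms * by (auto simp: poles_def side_def)
qed

lemma exit_dart_props:
  assumes "poles w w'"
  shows "exit_dart w \<in> D" "exit_dart w \<in> darts" "src (exit_dart w) = w" "ccw M (exit_dart w) \<notin> D"
proof -
  have "exit_dart w \<in> exits D w" using boundary(1)[OF assms] by simp
  then show "exit_dart w \<in> D" "exit_dart w \<in> darts" "src (exit_dart w) = w" "ccw M (exit_dart w) \<notin> D"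
    using D_darts by (auto simp: exits_def)
qed

lemma entry_dart_props:
  assumes "poles w w'"
  shows "entry_dart w \<notin> D" "entry_dart w \<in> darts" "src (entry_dart w) = w" "ccw M (entry_dart w) \<in> D"
proof -
  have "entry_dart w \<in> entries D w" using boundary(2)[OF assms] by simp
  then show "entry_dart w \<notin> D" "entry_dart w \<in> darts" "src (entry_dart w) = w" "ccw M (entry_dart w) \<in> D"
    by (auto simp: entries_def)
qed

lemma side_face_map: "poles w w' \<Longrightarrow> side w \<in> map_faces M"
  using exit_dart_props(2) by (auto simp: side_def map_faces_def)

lemma exit_dart_in_side: "exit_dart w \<in> side w"
  unfolding side_def by (rule self_in_face)

lemma side_unique: "poles w w' \<Longrightarrow> f \<in> map_faces M \<Longrightarrow> exit_dart w \<in> f \<Longrightarrow> f = side w"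
  unfolding side_def using face_orbit[of f "exit_dart w"] by simp

text \<open>A simple face has at most one dart starting at each pole, and the exit and the entry are
  such darts.\<close>

lemma side_pole_dart:
  assumes "poles w w'" "d \<in> side w" "src d \<in> {w, w'}"
  shows "d = exit_dart w \<or> d = entry_dart w'"
proof -
  note f = face_simple[OF side_face_map[OF assms(1)] assms(2)]
  consider "src d = w" | "src d = w'" using assms(3) by blast
  then show ?thesis
  proof cases
    case 1
    then have "src d = src (exit_dart w)" using exit_dart_props(3)[OF assms(1)] by (rule trans[OF _ sym])
    then show ?thesis using f[OF exit_dart_in_side] by blast
  next
    case 2
    then have "src d = src (entry_dart w')"
      using entry_dart_props(3)[OF poles_sym[OF assms(1)]] by (rule trans[OF _ sym])
    then show ?thesis using f[OF boundary(3)[OF assms(1)]] by blast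
  qed
qed

lemma side_face_eq:
  assumes "poles w w'" "faces K = map_faces M"
  shows "side_face M K \<nu> w = side w"
  unfolding side_face_def
proof (rule the_equality)
  show "side w \<in> faces K \<and> (\<exists>d\<in>side w. src d = w \<and> d \<in> D \<and> ccw M d \<notin> D)"
    using side_face_map[OF assms(1)] exit_dart_in_side exit_dart_props[OF assms(1)] assms(2) by blast
  fix f assume f: "f \<in> faces K \<and> (\<exists>d\<in>f. src d = w \<and> d \<in> D \<and> ccw M d \<notin> D)"
  then obtain d where "d \<in> f" "d \<in> exits D w" by (auto simp: exits_def)
  then have "exit_dart w \<in> f" using boundary(1)[OF assms(1)] by simp
  then show "f = side w" using side_unique[OF assms(1)] f assms(2) by simp
qed

text \<open>Both representations have the faces of \<open>M\<close>, so the path removed is the path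
  inserted.\<close>

lemma new_side_face_eq:
  assumes "poles w w'"
  shows "new_side_face M \<nu> H H' w = side w"
  unfolding new_side_face_def side_path_def
    side_face_eq[OF assms orthogonal_repD(1)[OF H]] side_face_eq[OF assms orthogonal_repD(1)[OF H']]
  by blast

lemma face_cases:
  assumes "f \<in> map_faces M"
  obtains (inner) "f \<subseteq> D" | (outer) "f \<inter> D = {}" | (left) "f = side (source M \<nu>)" | (right) "f = side (sink M \<nu>)"
proof -
  have p: "poles (source M \<nu>) (sink M \<nu>)" "poles (sink M \<nu>) (source M \<nu>)" by (auto simp: poles_def)
  have "f = side (source M \<nu>) \<or> f = side (sink M \<nu>)" if "f \<inter> D \<noteq> {}" "\<not> f \<subseteq> D"
    using mixed_face_exit[OF att assms that] boundary(1)[OF p(1)] boundary(1)[OF p(2)]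
      side_unique[OF p(1) assms] side_unique[OF p(2) assms] by auto
  then show thesis using that by blast
qed

text \<open>On a side face, the darts of the subgraph form one run, from \<open>exit_dart w\<close> to just before \<open>entry_dart w'\<close>.\<close>

lemma side_run:
  assumes P: "poles w w'"
  shows "face_next M ` (side w \<inter> D) = insert (entry_dart w') (side w \<inter> D - {exit_dart w})"
proof
  note P' = poles_sym[OF P]
  note f = side_face_map[OF P]
  note two = two_pole_poles[OF P]
  show "face_next M ` (side w \<inter> D) \<subseteq> insert (entry_dart w') (side w \<inter> D - {exit_dart w})"
  proof
    fix y assume "y \<in> face_next M ` (side w \<inter> D)"
    then obtain e where e: "e \<in> side w" "e \<in> D" "y = face_next M e" by blast
    have y: "y \<in> side w" "ccw M y \<in> D" "y \<in> darts" "src y = src (opp M e)"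
      using face_next_face[OF f e(1)] e opp_D D_darts by auto
    show "y \<in> insert (entry_dart w') (side w \<inter> D - {exit_dart w})"
    proof (cases "y \<in> D")
      case True
      then show ?thesis using y exit_dart_props(4)[OF P] by auto
    next
      case False
      then have "src y \<in> {w, w'}"
        using two opp_D[OF e(2)] y(3,4) unfolding two_pole_def by (metis DiffI)
      then show ?thesis using side_pole_dart[OF P y(1)] False exit_dart_props(1)[OF P] by auto
    qed
  qed
  show "insert (entry_dart w') (side w \<inter> D - {exit_dart w}) \<subseteq> face_next M ` (side w \<inter> D)"
  proof
    fix y assume y: "y \<in> insert (entry_dart w') (side w \<inter> D - {exit_dart w})"
    then have yf: "y \<in> side w" using boundary(3)[OF P] by auto
    obtain e where e: "y = face_next M e" using permutes_surj[OF face_next_permutes] by (metis surjD)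
    have ef: "e \<in> side w" using face_next_face_iff[OF f] yf e by simp
    have eS: "e \<in> darts" using ef face_subset[OF f] by blast
    have ce: "ccw M y = opp M e" "src y = src (opp M e)" using e eS by auto
    have "e \<in> D"
    proof (rule ccontr)
      assume "e \<notin> D"
      then have ne: "opp M e \<notin> D" using opp_D[of "opp M e"] by auto
      then have "y \<noteq> entry_dart w'" using ce entry_dart_props(4)[OF P'] by auto
      then have yD: "y \<in> D" "y \<noteq> exit_dart w" using y by auto
      then have "src y \<in> {w, w'}" using two ne ce(2) eS unfolding two_pole_def by (metis DiffI arev_in_arcs)
      then show False using side_pole_dart[OF P yf] yD entry_dart_props(1)[OF P'] by auto
    qed
    then show "y \<in> face_next M ` (side w \<inter> D)" using e ef by blast
  qed
qed

section \<open>Darts, aliases and rotations at the poles\<close>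

abbreviation "ins w \<equiv> out_arcs (skel M) w \<inter> D"
abbreviation "outs w \<equiv> out_arcs (skel M) w - D"

lemma pole_darts:
  assumes "poles w w'"
  shows "exit_dart w \<in> ins w" "ccw M (entry_dart w) \<in> ins w" "entry_dart w \<in> outs w" "ccw M (exit_dart w) \<in> outs w"
  using exit_dart_props[OF assms] entry_dart_props[OF assms] by auto

text \<open>Four angles of at least 90 degrees leave no slack in a sum of 360.\<close>

lemma degree_four_right_angles:
  assumes K: "orthogonal_rep M K" and four: "card (out_arcs (skel M) w) = 4" and d: "d \<in> out_arcs (skel M) w"
  shows "angle K d = 90"
proof -
  let ?A = "out_arcs (skel M) w"
  have ge: "90 \<le> angle K e" if "e \<in> ?A" for e
    using orthogonal_repD(3)[OF K, of e] that by auto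
  have w: "w \<in> verts (skel M)" using d by auto
  have "(\<Sum>e\<in>?A. angle K e) = (\<Sum>e\<in>?A. 90 + (angle K e - 90))"
    using ge by (intro sum.cong) auto
  also have "\<dots> = 360 + (\<Sum>e\<in>?A. angle K e - 90)" using four by (simp add: sum.distrib)
  finally have "(\<Sum>e\<in>?A. angle K e - 90) = 0" using orthogonal_repD(6)[OF K w] by simp
  then have "angle K d - 90 = 0" using d by (simp only: sum_eq_0_iff finite_out_arcs)
  then show ?thesis using ge[OF d] by simp
qed

text \<open>There are at most four darts and at least one on either side. A side with a single dart
  ties the exit to the entry; two darts on both sides give degree four.\<close>

lemma pole_cases:
  assumes P: "poles w w'"
  obtains (in1) "indeg M \<nu> w = 1" "ins w = {exit_dart w}" "ccw M (entry_dart w) = exit_dart w" "\<not> two_aliases M \<nu> w"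
  | (out1) "indeg M \<nu> w \<noteq> 1" "outs w = {entry_dart w}" "ccw M (exit_dart w) = entry_dart w" "\<not> two_aliases M \<nu> w"
  | (two) "indeg M \<nu> w \<noteq> 1" "two_aliases M \<nu> w" "card (out_arcs (skel M) w) = 4" "card (outs w) = 2"
proof -
  note pd = pole_darts[OF P]
  have w: "w \<in> verts (skel M)" using tail_in_verts[OF exit_dart_props(2)[OF P]] exit_dart_props(3)[OF P] by simp
  have fin: "finite (ins w)" "finite (outs w)" by (auto intro: finite_out_arcs)
  have "card (out_arcs (skel M) w) = card (ins w \<union> outs w)" by (rule arg_cong[where f = card]) blast
  also have "\<dots> = card (ins w) + card (outs w)" using fin by (intro card_Un_disjoint) auto
  finally have sum: "card (out_arcs (skel M) w) = card (ins w) + card (outs w)" .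
  have "card (out_arcs (skel M) w) \<le> 4" using four w by (auto simp: four_graph_def out_degree_def)
  moreover have "card (ins w) \<noteq> 0" "card (outs w) \<noteq> 0" using pd fin by auto
  ultimately have "card (ins w) = 1 \<or> card (ins w) \<noteq> 1 \<and> card (outs w) = 1 \<or> card (ins w) = 2 \<and> card (outs w) = 2"
    using sum by linarith
  then consider (a) "card (ins w) = 1" | (b) "card (ins w) \<noteq> 1" "card (outs w) = 1"
    | (c) "card (ins w) = 2" "card (outs w) = 2" by blast
  then show thesis
  proof cases
    case a
    then obtain x where "ins w = {x}" by (rule card_1_singletonE)
    then show thesis using in1 a pd by (auto simp: indeg_def two_aliases_def)
  next
    case b
    from b(2) obtain x where "outs w = {x}" by (rule card_1_singletonE)
    then show thesis using out1 b pd by (auto simp: indeg_def outdeg_def two_aliases_def)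
  next
    case c
    then show thesis using two sum by (auto simp: indeg_def outdeg_def two_aliases_def)
  qed
qed

definition alias_ok :: "'v \<Rightarrow> 'd option \<Rightarrow> bool" where
  "alias_ok w a \<longleftrightarrow> (case a of None \<Rightarrow> indeg M \<nu> w = 1 | Some x \<Rightarrow> x \<in> outs w)"

text \<open>The dart at which \<Theta> is read off at the end of a route: for a dummy vertex the
  outside dart, and for a pole that is its own alias the only inside dart, which the route must
  use.\<close>

definition alias_dart :: "'v \<Rightarrow> 'd option \<Rightarrow> 'd" where
  "alias_dart w a = (case a of None \<Rightarrow> exit_dart w | Some x \<Rightarrow> x)"

text \<open>Corners at a pole come from \<open>H\<close> if the indegree is 1 and from
  \<open>H'\<close> otherwise. So the part of a side that turns as in \<open>H'\<close> begins at
  the exit dart in the first case and includes the corner before it in the second.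
  \<open>right_end\<close> is the counterpart where the side leaves the subgraph.\<close>

definition left_start :: "'v \<Rightarrow> 'd" where
  "left_start w = (if indeg M \<nu> w = 1 then exit_dart w else ccw M (exit_dart w))"

definition right_end :: "'v \<Rightarrow> 'd" where
  "right_end w = (if indeg M \<nu> w = 1 then ccw M (entry_dart w) else entry_dart w)"

context
  fixes \<Theta> assumes \<Theta>: "rotation_between H H' \<Theta>"
begin

text \<open>All angles at such a vertex are 90 in both representations, so no corner
  changes.\<close>

lemma rotation_degree_four:
  assumes "card (out_arcs (skel M) w) = 4" "d \<in> out_arcs (skel M) w" "d' \<in> out_arcs (skel M) w"
  shows "\<Theta> d' = \<Theta> d"
proof (rule rotation_const[OF _ assms(2,3)])
  show "\<Theta> (ccw M e) = \<Theta> e" if "e \<in> out_arcs (skel M) w" for e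
    using \<Theta> that degree_four_right_angles[OF H assms(1) that] degree_four_right_angles[OF H' assms(1) that]
    unfolding rotation_between_def by auto
qed

text \<open>With a single dart on one side the two darts coincide; otherwise the degree is
  four.\<close>

lemma right_end_rotation:
  assumes P: "poles w w'"
  shows "\<Theta> (right_end w) = \<Theta> (left_start w)"
  using P
proof (cases rule: pole_cases)
  case in1
  then show ?thesis by (simp add: right_end_def left_start_def)
next
  case out1
  then show ?thesis by (simp add: right_end_def left_start_def)
next
  case two
  have "left_start w \<in> out_arcs (skel M) w" "right_end w \<in> out_arcs (skel M) w"
    using pole_darts[OF P] by (simp_all add: left_start_def right_end_def)
  then show ?thesis by (rule rotation_degree_four[OF two(3)])
qed

lemma sole_alias_rotation:
  assumes P: "poles w w'" and "\<not> two_aliases M \<nu> w"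
  shows "alias_ok w (sole_alias M \<nu> w)" "\<Theta> (alias_dart w (sole_alias M \<nu> w)) = \<Theta> (left_start w)"
proof -
  have "alias_ok w (sole_alias M \<nu> w) \<and> \<Theta> (alias_dart w (sole_alias M \<nu> w)) = \<Theta> (left_start w)"
    using P
  proof (cases rule: pole_cases)
    case in1
    then show ?thesis by (simp add: sole_alias_def alias_ok_def alias_dart_def left_start_def)
  next
    case out1
    have "(THE d. d \<in> outs w) = entry_dart w" unfolding out1(2) by simp
    then have "sole_alias M \<nu> w = Some (entry_dart w)" using out1(1) by (simp add: sole_alias_def)
    then show ?thesis using out1 pole_darts(3)[OF P] by (simp add: alias_ok_def alias_dart_def left_start_def)
  next
    case two
    then show ?thesis using assms(2) by blast
  qed
  then show "alias_ok w (sole_alias M \<nu> w)" "\<Theta> (alias_dart w (sole_alias M \<nu> w)) = \<Theta> (left_start w)"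
    by auto
qed

lemma two_aliases_rotation:
  assumes P: "poles w w'" and two: "two_aliases M \<nu> w"
    and a: "a = ccw_first_alias M \<nu> w \<or> a = ccw_second_alias M \<nu> w"
  shows "alias_ok w (Some a)" "\<Theta> (alias_dart w (Some a)) = \<Theta> (left_start w)"
proof -
  have *: "card (out_arcs (skel M) w) = 4" "card (outs w) = 2"
    using P two by (cases rule: pole_cases; blast)+
  have "entry_dart w \<in> outs w" by (rule pole_darts(3)[OF P])
  then have "card (outs w - {entry_dart w}) = 1" using *(2) by (simp add: card_Diff_singleton)
  then obtain y where y: "outs w - {entry_dart w} = {y}" by (rule card_1_singletonE)
  have "{d \<in> outs w. ccw M d \<notin> D} = outs w - entries D w" by (auto simp: entries_def)
  \<comment> \<open>Of the two outside darts, the entry dart is followed by a dart of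
    \<open>D\<close>; hence the other one is the first alias.\<close>
  then have fa: "{d \<in> outs w. ccw M d \<notin> D} = {y}" using boundary(2)[OF P] y by simp
  have "ccw_first_alias M \<nu> w = y"
    unfolding ccw_first_alias_def using fa by (intro the_equality) blast+
  moreover have "y \<in> {d \<in> outs w. ccw M d \<notin> D}" unfolding fa by simp
  ultimately have aw: "a \<in> outs w" using a unfolding ccw_second_alias_def by auto
  have "left_start w \<in> out_arcs (skel M) w"
    using pole_darts(1,4)[OF P] by (simp add: left_start_def)
  then have "\<Theta> a = \<Theta> (left_start w)" using rotation_degree_four[OF *(1)] aw by blast
  then show "alias_ok w (Some a)" "\<Theta> (alias_dart w (Some a)) = \<Theta> (left_start w)"
    using aw by (simp_all add: alias_ok_def alias_dart_def)
qed

text \<open>The turns towards the aliases extend the telescoping of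
  \<open>path_angles_rotation\<close> by one corner at either end.\<close>

lemma n_turns_rotation:
  assumes p: "apath (source M \<nu>) p (sink M \<nu>)" "set p \<subseteq> D"
    and a: "alias_ok (source M \<nu>) a" and b: "alias_ok (sink M \<nu>) b"
  shows "90 * (n_turns M H' a p b - n_turns M H a p b) =
    \<Theta> (alias_dart (source M \<nu>) a) - \<Theta> (alias_dart (sink M \<nu>) b)"
proof -
  let ?u = "source M \<nu>" and ?v = "sink M \<nu>"
  have P: "poles ?u ?v" "poles ?v ?u" by (auto simp: poles_def)
  have ne: "p \<noteq> []" using p(1) poles_ne[OF P(1)] by (auto simp: apath_Nil_iff)
  have aw: "awalk ?u p ?v" using p(1) by (simp add: apath_def)
  have hD: "hd p \<in> D" using p(2) hd_in_set[OF ne] by (rule subsetD)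
  have hs: "src (hd p) = ?u"
  proof -
    obtain h q where pq: "p = h # q" using ne by (cases p) auto
    then show ?thesis using p(1) unfolding pq apath_Cons_iff by simp
  qed
  have hd: "hd p \<in> ins ?u" using hD hs D_darts by auto
  have lD: "last p \<in> D" using p(2) last_in_set[OF ne] by (rule subsetD)
  have ld: "dst (last p) = ?v"
  proof -
    have "awalk ?u (butlast p @ [last p]) ?v" using aw ne by simp
    then show ?thesis by (auto simp: awalk_Cons_iff awalk_Nil_iff)
  qed
  have lS: "last p \<in> darts" using lD D_darts by blast
  then have lo: "opp M (last p) \<in> ins ?v" using opp_D[OF lD] ld by auto
  have A: "90 * (turns (case a of None \<Rightarrow> [] | Some x \<Rightarrow> [left_angle M H' (opp M x) (hd p)])
      - turns (case a of None \<Rightarrow> [] | Some x \<Rightarrow> [left_angle M H (opp M x) (hd p)]))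
      = \<Theta> (alias_dart ?u a) - \<Theta> (hd p)"
  proof (cases a)
    case None
    then have "indeg M \<nu> ?u = 1" using a by (simp add: alias_ok_def)
    with P(1) have "ins ?u = {exit_dart ?u}" by (cases rule: pole_cases) auto
    then show ?thesis using None hd by (simp add: turns_def alias_dart_def)
  next
    case (Some x)
    then have x: "x \<in> darts" "src x = ?u" "x \<notin> D" using a by (auto simp: alias_ok_def)
    have d: "opp M x \<in> darts" "hd p \<in> darts" "dst (opp M x) = src (hd p)" "hd p \<noteq> opp M (opp M x)"
      using x hd by auto
    show ?thesis
      using turns_eq[of "[left_angle M H (opp M x) (hd p)]"] turns_eq[of "[left_angle M H' (opp M x) (hd p)]"]
        left_angle_range[OF H d] left_angle_range[OF H' d] left_angle_rotation[OF \<Theta> d] Some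
      by (simp add: alias_dart_def)
  qed
  have B: "90 * (turns (case b of None \<Rightarrow> [] | Some y \<Rightarrow> [left_angle M H' (last p) y])
      - turns (case b of None \<Rightarrow> [] | Some y \<Rightarrow> [left_angle M H (last p) y]))
      = \<Theta> (opp M (last p)) - \<Theta> (alias_dart ?v b)"
  proof (cases b)
    case None
    then have "indeg M \<nu> ?v = 1" using b by (simp add: alias_ok_def)
    with P(2) have "ins ?v = {exit_dart ?v}" by (cases rule: pole_cases) auto
    then show ?thesis using None lo by (simp add: turns_def alias_dart_def)
  next
    case (Some y)
    then have y: "y \<in> darts" "src y = ?v" "y \<notin> D" using b by (auto simp: alias_ok_def)
    have d: "last p \<in> darts" "y \<in> darts" "dst (last p) = src y" "y \<noteq> opp M (last p)"
      using y lS ld opp_D[OF lD] by auto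
    show ?thesis
      using turns_eq[of "[left_angle M H (last p) y]"] turns_eq[of "[left_angle M H' (last p) y]"]
        left_angle_range[OF H d] left_angle_range[OF H' d] left_angle_rotation[OF \<Theta> d] Some
      by (simp add: alias_dart_def)
  qed
  show ?thesis
    using A B path_angles_rotation[OF H H' \<Theta> p(1) ne]
    unfolding n_turns_def turns_append by (simp add: algebra_simps)
qed

text \<open>All aliases of a pole have the same value of \<Theta>, so every \<open>n_turns\<close>
  in the definition changes by the same \<open>?c\<close> / 90, and so does an average of two. Equal
  spiralities thus give \<open>?c = 0\<close> in all four cases.\<close>

lemma spirality_rotation: "\<Theta> (left_start (source M \<nu>)) = \<Theta> (left_start (sink M \<nu>))"
proof -
  let ?u = "source M \<nu>" and ?v = "sink M \<nu>"
  have P: "poles ?u ?v" "poles ?v ?u" by (auto simp: poles_def)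
  define p where "p = (SOME p. apath ?u p ?v \<and> set p \<subseteq> D)"
  have "apath ?u p ?v \<and> set p \<subseteq> D"
    unfolding p_def by (rule someI_ex[OF represents_path[OF rep]])
  then have p: "apath ?u p ?v" "set p \<subseteq> D" by auto
  let ?n = "\<lambda>K a b. n_turns M K a p b"
  let ?c = "\<Theta> (left_start ?u) - \<Theta> (left_start ?v)"
  have key: "90 * (?n H' a b - ?n H a b) = ?c"
    if "alias_ok ?u a" "\<Theta> (alias_dart ?u a) = \<Theta> (left_start ?u)"
      "alias_ok ?v b" "\<Theta> (alias_dart ?v b) = \<Theta> (left_start ?v)" for a b
    using n_turns_rotation[OF p that(1,3)] that(2,4) by simp
  note su = sole_alias_rotation[OF P(1)] and sv = sole_alias_rotation[OF P(2)]
  note tu = two_aliases_rotation[OF P(1)] and tv = two_aliases_rotation[OF P(2)]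
  have half: "x + y = x' + y'" if "(of_int x + of_int y) / 2 = (of_int x' + of_int y' :: rat) / 2" for x y x' y' :: int
  proof -
    have "of_int (x + y) = (of_int (x' + y') :: rat)" using that by simp
    then show ?thesis by (simp only: of_int_eq_iff)
  qed
  note sp = spir[unfolded spirality_def Let_def, folded p_def]
  have "?c = 0"
  proof (cases "two_aliases M \<nu> ?u"; cases "two_aliases M \<nu> ?v")
    assume t: "two_aliases M \<nu> ?u" "two_aliases M \<nu> ?v"
    let ?a = "Some (ccw_first_alias M \<nu> ?u)" and ?a' = "Some (ccw_second_alias M \<nu> ?u)"
    let ?b = "Some (ccw_second_alias M \<nu> ?v)" and ?b' = "Some (ccw_first_alias M \<nu> ?v)"
    have "?n H ?a ?b + ?n H ?a' ?b' = ?n H' ?a ?b + ?n H' ?a' ?b'"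
      by (rule half) (use sp t in simp)
    then show ?thesis
      using key[of ?a ?b] key[of ?a' ?b'] tu[OF t(1)] tv[OF t(2)] by simp
  next
    assume t: "two_aliases M \<nu> ?u" "\<not> two_aliases M \<nu> ?v"
    let ?a = "Some (ccw_first_alias M \<nu> ?u)" and ?a' = "Some (ccw_second_alias M \<nu> ?u)"
    let ?b = "sole_alias M \<nu> ?v"
    have "?n H ?a ?b + ?n H ?a' ?b = ?n H' ?a ?b + ?n H' ?a' ?b"
      by (rule half) (use sp t in simp)
    then show ?thesis
      using key[of ?a ?b] key[of ?a' ?b] tu[OF t(1)] sv[OF t(2)] by simp
  next
    assume t: "\<not> two_aliases M \<nu> ?u" "two_aliases M \<nu> ?v"
    let ?a = "sole_alias M \<nu> ?u"
    let ?b = "Some (ccw_second_alias M \<nu> ?v)" and ?b' = "Some (ccw_first_alias M \<nu> ?v)"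
    have "?n H ?a ?b + ?n H ?a ?b' = ?n H' ?a ?b + ?n H' ?a ?b'"
      by (rule half) (use sp t in simp)
    then show ?thesis
      using key[of ?a ?b] key[of ?a ?b'] su[OF t(1)] tv[OF t(2)] by simp
  next
    assume t: "\<not> two_aliases M \<nu> ?u" "\<not> two_aliases M \<nu> ?v"
    let ?a = "sole_alias M \<nu> ?u" and ?b = "sole_alias M \<nu> ?v"
    have "?n H ?a ?b = ?n H' ?a ?b" using sp t by simp
    then show ?thesis using key[of ?a ?b] su[OF t(1)] sv[OF t(2)] by simp
  qed
  then show ?thesis by simp
qed

lemma sides_rotation:
  assumes P: "poles w w'"
  shows "\<Theta> (left_start w) = \<Theta> (right_end w')"
proof -
  have "\<Theta> (left_start w) = \<Theta> (left_start w')"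
    using P spirality_rotation unfolding poles_def by (elim disjE conjE) simp_all
  then show ?thesis unfolding right_end_rotation[OF poles_sym[OF P]] .
qed

end

section \<open>The substituted representation\<close>

abbreviation "J \<equiv> substitution M \<nu> H H'"
abbreviation "u \<equiv> source M \<nu>"
abbreviation "v \<equiv> sink M \<nu>"

lemma poles_uv: "poles u v" "poles v u"
  by (auto simp: poles_def)

lemma sides:
  "side_face M H \<nu> u = side u" "side_face M H \<nu> v = side v"
  "new_side_face M \<nu> H H' u = side u" "new_side_face M \<nu> H H' v = side v"
  using side_face_eq[OF _ orthogonal_repD(1)[OF H]] new_side_face_eq poles_uv by blast+

lemma substitution_faces: "faces J = map_faces M" "outer J = ext_face M"
proof -
  note F = orthogonal_repD(1)[OF H] orthogonal_repD(1)[OF H']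
  have "faces J = {f \<in> map_faces M. \<not> f \<subseteq> D \<and> f \<noteq> side u \<and> f \<noteq> side v} \<union> {f \<in> map_faces M. f \<subseteq> D}
      \<union> {side u, side v}"
    unfolding substitution_def Let_def sides F by simp
  moreover have "side u \<in> map_faces M" "side v \<in> map_faces M"
    using side_face_map poles_uv by blast+
  ultimately show "faces J = map_faces M" by blast
  show "outer J = ext_face M"
    unfolding substitution_def Let_def sides using orthogonal_repD(2)[OF H] by simp
qed

lemma substitution_bends: "bends J d = (if d \<in> D then bends H' d else bends H d)"
  unfolding substitution_def Let_def by simp

lemma substitution_angle:
  "angle J d = (if src d \<in> {u, v} then
      (if d \<in> side u \<union> side v then (if indeg M \<nu> (src d) = 1 then angle H d else angle H' d)
       else if d \<in> D then angle H' d else angle H d)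
     else if src d \<in> node_verts M \<nu> then angle H' d else angle H d)"
  unfolding substitution_def Let_def sides by simp

lemma same_pole_side: "poles w w' \<Longrightarrow> side w \<subseteq> side u \<union> side v" "poles w w' \<Longrightarrow> side w' \<subseteq> side u \<union> side v"
  by (auto simp: poles_def)

text \<open>A single inside dart is the exit, which is on a side, so the corners off the sides are
  outside and come from \<open>H\<close>. A single outside dart is the entry, also on a side, so the
  other corners are inside and come from \<open>H'\<close>. In degree four both representations
  agree.\<close>

lemma angle_at_pole:
  assumes P: "poles w w'" and d: "d \<in> darts" "src d = w"
  shows "angle J d = (if indeg M \<nu> w = 1 then angle H d else angle H' d)"
proof -
  have w: "src d \<in> {u, v}" using P d(2) by (auto simp: poles_def)
  have sub: "side w \<subseteq> side u \<union> side v" "side w' \<subseteq> side u \<union> side v" using same_pole_side[OF P] by auto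
  show ?thesis
  proof (cases "d \<in> side u \<union> side v")
    case True
    then show ?thesis using w d(2) by (simp add: substitution_angle)
  next
    case False
    then have J: "angle J d = (if d \<in> D then angle H' d else angle H d)"
      using w by (simp add: substitution_angle)
    have ne: "d \<noteq> exit_dart w" "d \<noteq> entry_dart w"
      using False sub exit_dart_in_side[of w] boundary(3)[OF poles_sym[OF P]] by blast+
    show ?thesis
      using P
    proof (cases rule: pole_cases)
      case in1
      have "d \<notin> ins w" unfolding in1(2) using ne(1) by simp
      then have "d \<notin> D" using d by simp
      then show ?thesis using J in1(1) by simp
    next
      case out1
      have "d \<notin> outs w" unfolding out1(2) using ne(2) by simp
      then have "d \<in> D" using d by simp
      then show ?thesis using J out1(1) by simp
    next
      case two
      then have "angle H d = 90" "angle H' d = 90"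
        using degree_four_right_angles[OF H two(3)] degree_four_right_angles[OF H' two(3)] d by auto
      then show ?thesis using J by simp
    qed
  qed
qed

lemma angle_away:
  assumes "src d \<noteq> u" "src d \<noteq> v"
  shows "angle J d = (if src d \<in> node_verts M \<nu> then angle H' d else angle H d)"
  using assms by (simp add: substitution_angle)

lemma node_vert_darts:
  assumes "d \<in> darts" "src d \<noteq> u" "src d \<noteq> v"
  shows "src d \<in> node_verts M \<nu> \<longleftrightarrow> d \<in> D"
  using attached_pole[OF att rep assms(1)] assms(2,3) node_verts_eq[OF rep] by blast

lemma angle_choice: "d \<in> darts \<Longrightarrow> angle J d = angle H d \<or> angle J d = angle H' d"
  unfolding substitution_angle by presburger

text \<open>At each vertex all angles agree with those of one and the same representation.\<close>

lemma vertex_sum: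
  assumes w: "w \<in> verts (skel M)"
  shows "(\<Sum>d\<in>out_arcs (skel M) w. angle J d) = 360"
proof -
  have "\<exists>K\<in>{H, H'}. \<forall>d\<in>out_arcs (skel M) w. angle J d = angle K d"
  proof (cases "w = u \<or> w = v")
    case True
    then obtain w' where "poles w w'" using poles_uv by blast
    from angle_at_pole[OF this] show ?thesis by (cases "indeg M \<nu> w = 1") auto
  next
    case False
    then have "\<forall>d\<in>out_arcs (skel M) w. angle J d = (if w \<in> node_verts M \<nu> then angle H' d else angle H d)"
      using angle_away by auto
    then show ?thesis by (cases "w \<in> node_verts M \<nu>") auto
  qed
  then obtain K where K: "K \<in> {H, H'}" "\<forall>d\<in>out_arcs (skel M) w. angle J d = angle K d" by blast
  have "(\<Sum>d\<in>out_arcs (skel M) w. angle J d) = (\<Sum>d\<in>out_arcs (skel M) w. angle K d)"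
    using K(2) by (intro sum.cong) auto
  also have "\<dots> = 360" using K(1) orthogonal_repD(6)[OF H w] orthogonal_repD(6)[OF H' w] by auto
  finally show ?thesis .
qed

lemma bend_turn_J: "bend_turn J d = (if d \<in> D then bend_turn H' d else bend_turn H d)"
  by (simp add: bend_turn_def substitution_bends)

lemma inner_face_turn:
  assumes f: "f \<in> map_faces M" "f \<subseteq> D"
  shows "face_turn J f = face_turn H' f"
  unfolding face_turn_def
proof (rule sum.cong)
  fix d assume d: "d \<in> f"
  have dS: "d \<in> darts" "d \<in> D" using d f face_subset by auto
  \<comment> \<open>A side face also contains an entry dart, which is outside
    \<open>D\<close>.\<close>
  have "d \<notin> side w" if P: "poles w w'" for w w'
  proof
    assume "d \<in> side w"
    then have "f = side w" using face_orbit[OF f(1) d] face_orbit[OF side_face_map[OF P]] by simp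
    then show False using boundary(3)[OF P] entry_dart_props(1)[OF poles_sym[OF P]] f(2) by blast
  qed
  then have "d \<notin> side u \<union> side v" using poles_uv by blast
  moreover have "src d \<in> node_verts M \<nu>" using dS(2) unfolding node_verts_eq[OF rep] by (rule imageI)
  ultimately have "angle J d = angle H' d" using dS(2) by (simp add: substitution_angle)
  then show "180 - int (angle J d) - bend_turn J d = 180 - int (angle H' d) - bend_turn H' d"
    using dS(2) by (simp add: bend_turn_J)
qed simp

lemma outer_face_turn:
  assumes f: "f \<in> map_faces M" "f \<inter> D = {}"
  shows "face_turn J f = face_turn H f"
  unfolding face_turn_def
proof (rule sum.cong)
  fix d assume d: "d \<in> f"
  have dS: "d \<in> darts" "d \<notin> D" using d f face_subset by auto
  have "d \<notin> side w" if P: "poles w w'" for w w'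
  proof
    assume "d \<in> side w"
    then have "f = side w" using face_orbit[OF f(1) d] face_orbit[OF side_face_map[OF P]] by simp
    then show False using exit_dart_in_side[of w] exit_dart_props(1)[OF P] f(2) by blast
  qed
  then have "d \<notin> side u \<union> side v" using poles_uv by blast
  moreover have "src d \<in> {u, v} \<or> src d \<notin> node_verts M \<nu>" using node_vert_darts[OF dS(1)] dS(2) by blast
  ultimately have "angle J d = angle H d" using dS(2) by (auto simp: substitution_angle)
  then show "180 - int (angle J d) - bend_turn J d = 180 - int (angle H d) - bend_turn H d"
    using dS(2) by (simp add: bend_turn_J)
qed simp

text \<open>Along the run of \<open>D\<close>, changed corners contribute \<Theta> (ccw d) -
  \<Theta> d and bends \<Theta> d - \<Theta> (opp d). As opp d = ccw (face_next d), they cancel up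
  to the two ends, where \<open>left_start\<close> and \<open>right_end\<close> record which end
  corners take part. The remainder is zero by \<open>sides_rotation\<close>.\<close>

lemma side_turn:
  assumes P: "poles w w'"
  shows "face_turn J (side w) = face_turn H (side w)"
proof -
  obtain \<Theta> where \<Theta>: "rotation_between H H' \<Theta>" using rotation_exists[OF H H'] .
  have ccw: "int (angle H' d) - int (angle H d) = \<Theta> (ccw M d) - \<Theta> d" if "d \<in> darts" for d
    using \<Theta> that unfolding rotation_between_def by simp
  have opp: "bend_turn H' d - bend_turn H d = \<Theta> d - \<Theta> (opp M d)" if "d \<in> darts" for d
    using \<Theta> that unfolding rotation_between_def by simp
  note P' = poles_sym[OF P]
  let ?f = "side w" and ?d = "\<lambda>d. int (angle J d) - int (angle H d)"
  let ?A = "?f \<inter> D"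
  have f: "?f \<in> map_faces M" by (rule side_face_map[OF P])
  have fin: "finite ?f" by (rule face_finite[OF f])
  have fS: "?f \<subseteq> darts" by (rule face_subset[OF f])
  have exf: "exit_dart w \<in> ?A" "exit_dart w \<in> darts" "src (exit_dart w) = w" using exit_dart_in_side exit_dart_props[OF P] by auto
  have enf: "entry_dart w' \<in> ?f - D" "entry_dart w' \<in> darts" "src (entry_dart w') = w'"
    using boundary(3)[OF P] entry_dart_props[OF P'] by auto
  \<comment> \<open>If this corner comes from \<open>H\<close>, both sides are 0, since
    \<open>left_start w\<close> is then the exit dart.\<close>
  have d_ex: "?d (exit_dart w) = \<Theta> (left_start w) - \<Theta> (exit_dart w)"
    using angle_at_pole[OF P exf(2,3)] ccw[OF exf(2)] by (simp add: left_start_def)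
  have d_en: "?d (entry_dart w') = \<Theta> (ccw M (entry_dart w')) - \<Theta> (right_end w')"
    using angle_at_pole[OF P' enf(2,3)] ccw[OF enf(2)] by (simp add: right_end_def)
  have nonpole: "src d \<noteq> u" "src d \<noteq> v" if "d \<in> ?f" "d \<noteq> exit_dart w" "d \<noteq> entry_dart w'" for d
    using side_pole_dart[OF P that(1)] that(2,3) P unfolding poles_def by blast+
  have d_in: "?d d = \<Theta> (ccw M d) - \<Theta> d" if "d \<in> ?A - {exit_dart w}" for d
  proof -
    have d: "d \<in> ?f" "d \<noteq> exit_dart w" "d \<noteq> entry_dart w'" "d \<in> darts" "d \<in> D"
      using that enf(1) fS by auto
    note np = nonpole[OF d(1-3)]
    have "angle J d = angle H' d" using angle_away[OF np] node_vert_darts[OF d(4) np] d(5) by simp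
    then show ?thesis using ccw[OF d(4)] by simp
  qed
  have d_out: "?d d = 0" if "d \<in> ?f - D - {entry_dart w'}" for d
  proof -
    have d: "d \<in> ?f" "d \<noteq> exit_dart w" "d \<noteq> entry_dart w'" "d \<in> darts" "d \<notin> D"
      using that exf(1) fS by auto
    note np = nonpole[OF d(1-3)]
    show ?thesis using angle_away[OF np] node_vert_darts[OF d(4) np] d(5) by simp
  qed
  have "sum ?d ?f = sum ?d ?A + sum ?d (?f - D)"
    by (rule sum.Int_Diff[OF fin])
  also have "sum ?d (?f - D) = ?d (entry_dart w') + sum ?d (?f - D - {entry_dart w'})"
    using fin enf(1) by (intro sum.remove) auto
  also have "sum ?d (?f - D - {entry_dart w'}) = 0"
    using d_out by (intro sum.neutral) blast
  also have "sum ?d ?A = ?d (exit_dart w) + sum ?d (?A - {exit_dart w})"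
    using fin exf(1) by (intro sum.remove) auto
  also have "sum ?d (?A - {exit_dart w}) = (\<Sum>d\<in>?A - {exit_dart w}. \<Theta> (ccw M d)) - sum \<Theta> (?A - {exit_dart w})"
    using d_in by (simp add: sum_subtractf[symmetric])
  finally have angles: "sum ?d ?f = \<Theta> (left_start w) - \<Theta> (exit_dart w) + (\<Sum>d\<in>?A - {exit_dart w}. \<Theta> (ccw M d))
      - sum \<Theta> (?A - {exit_dart w}) + \<Theta> (ccw M (entry_dart w')) - \<Theta> (right_end w')"
    unfolding d_ex d_en by simp
  have inj: "inj_on (face_next M) ?A"
    using permutes_inj[OF face_next_permutes] by (rule inj_on_subset) simp
  have "(\<Sum>d\<in>?A. bend_turn H' d - bend_turn H d) = (\<Sum>d\<in>?A. \<Theta> d - \<Theta> (ccw M (face_next M d)))"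
    using opp fS by (intro sum.cong) auto
  also have "\<dots> = sum \<Theta> ?A - (\<Sum>d\<in>face_next M ` ?A. \<Theta> (ccw M d))"
    using inj by (simp add: sum_subtractf sum.reindex)
  \<comment> \<open>One step along the face shifts the run: the exit dart drops out and the entry
    dart of the other pole comes in.\<close>
  also have "(\<Sum>d\<in>face_next M ` ?A. \<Theta> (ccw M d)) = \<Theta> (ccw M (entry_dart w')) + (\<Sum>d\<in>?A - {exit_dart w}. \<Theta> (ccw M d))"
    unfolding side_run[OF P] using fin enf(1) by (intro sum.insert) auto
  also have "sum \<Theta> ?A = \<Theta> (exit_dart w) + sum \<Theta> (?A - {exit_dart w})"
    using fin exf(1) by (intro sum.remove) auto
  finally have bends: "(\<Sum>d\<in>?A. bend_turn H' d - bend_turn H d) = \<Theta> (exit_dart w) + sum \<Theta> (?A - {exit_dart w})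
      - (\<Theta> (ccw M (entry_dart w')) + (\<Sum>d\<in>?A - {exit_dart w}. \<Theta> (ccw M d)))" .
  have "face_turn H ?f - face_turn J ?f
      = (\<Sum>d\<in>?f. ?d d + (if d \<in> D then bend_turn H' d - bend_turn H d else 0))"
    unfolding face_turn_def sum_subtractf[symmetric] by (rule sum.cong) (auto simp: bend_turn_J)
  also have "\<dots> = sum ?d ?f + (\<Sum>d\<in>?A. bend_turn H' d - bend_turn H d)"
    unfolding sum.distrib sum.inter_restrict[OF fin] ..
  also have "\<dots> = \<Theta> (left_start w) - \<Theta> (right_end w')" unfolding angles bends by simp
  also have "\<dots> = 0" using sides_rotation[OF \<Theta> P] by simp
  finally show ?thesis by simp
qed

theorem substitution_orthogonal: "orthogonal_rep M J"
proof (rule orthogonal_repI)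
  show "faces J = map_faces M" "outer J = ext_face M" by (rule substitution_faces)+
  show "angle J d \<in> {90, 180, 270, 360}" if "d \<in> darts" for d
    using angle_choice[OF that] orthogonal_repD(3)[OF H that] orthogonal_repD(3)[OF H' that] by metis
  show "out_degree (skel M) (src d) = 1" if d: "d \<in> darts" "angle J d = 360" for d
  proof -
    have "angle H d = 360 \<or> angle H' d = 360" using angle_choice[OF d(1)] d(2) by auto
    moreover have "out_degree (skel M) (src d) = 1" if "orthogonal_rep M K" "angle K d = 360" for K
      using that(1)[unfolded orthogonal_rep_def, THEN conjunct2, THEN conjunct2, THEN conjunct1] d(1) that(2)
      by simp
    ultimately show ?thesis using H H' by metis
  qed
  show "set (bends J d) \<subseteq> {90, 270}" if "d \<in> darts" for d
    using orthogonal_repD(4)[OF H that] orthogonal_repD(4)[OF H' that] by (simp add: substitution_bends)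
  show "bends J (opp M d) = map (\<lambda>a. 360 - a) (rev (bends J d))" if "d \<in> darts" for d
  proof -
    have "opp M d \<in> D \<longleftrightarrow> d \<in> D" using opp_D[of d] opp_D[of "opp M d"] by auto
    then show ?thesis
      using orthogonal_repD(5)[OF H that] orthogonal_repD(5)[OF H' that] by (simp add: substitution_bends)
  qed
  show "(\<Sum>d\<in>out_arcs (skel M) w. angle J d) = 360" if "w \<in> verts (skel M)" for w
    using that by (rule vertex_sum)
  show "face_turn J f = (if f = ext_face M then - 360 else 360)" if f: "f \<in> map_faces M" for f
    using f
  proof (cases rule: face_cases)
    case inner
    then show ?thesis using inner_face_turn[OF f] orthogonal_repD(7)[OF H' f] by simp
  next
    case outer
    then show ?thesis using outer_face_turn[OF f] orthogonal_repD(7)[OF H f] by simp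
  next
    case left
    then show ?thesis using side_turn[OF poles_uv(1)] orthogonal_repD(7)[OF H f] by simp
  next
    case right
    then show ?thesis using side_turn[OF poles_uv(2)] orthogonal_repD(7)[OF H f] by simp
  qed
qed

end

theorem theorem1:
  fixes M :: "('v, 'd) plane_map" and T \<nu> :: "'d spq" and e :: 'd and H H' :: "'d angled"
  assumes "plane_graph M" and "biconnected M" and "series_parallel M" and "four_graph M"
    and "spq_tree M e T"
    and "e \<in> ext_face M \<or> opp M e \<in> ext_face M"
    and "\<nu> \<in> nodes T" and "\<nu> \<noteq> T"
    and "orthogonal_rep M H" and "e \<in> outer H \<or> opp M e \<in> outer H"
    and "orthogonal_rep M H'" and "e \<in> outer H' \<or> opp M e \<in> outer H'"
    and "H \<noteq> H'"
    and "spirality M H \<nu> = spirality M H' \<nu>"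
  shows "orthogonal_rep M (substitution M \<nu> H H')"
proof -
  interpret biconnected_plane M using assms(1,2,5) by (rule spq_tree_biconnected_plane)
  have "represents M \<nu> \<and> attached \<nu> \<and> node_linked \<nu>"
    using spq_node_facts[OF assms(5,7,8)] .
  then interpret node_substitution M \<nu> H H'
    by unfold_locales (use assms(4,9,11,14) in auto)
  show ?thesis by (rule substitution_orthogonal)
qed

end
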